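(* Let $K\in\mathbb{N}$, $0<\tau_1<\cdots<\tau_K$ and $A_0,\dots,A_K\in\mathbb{R}^{n\times n}$; write $[K]=\{1,\dots,K\}$. Suppose there exist $d \in \mathbb{N}$, a constant $\epsilon>0$, a matrix $P\in \mathbb{R}^{n\times n}$, functions $S_i, Q_i \in W_2^{n\times n}[-\tau_i,0]$, $R_{ij}\in W_2^{n\times n}\left[[-\tau_i,0]\times[-\tau_j,0]\right]$ for $i,j \in [K]$, $\{F_1,H_1\}\in \Theta_{n,n,K}$, and $\{F_2,H_2\}\in \Theta_{n(K+1),n,K}$ such that $$\{M,N\} \in \Xi_{d,2n,K} \qquad \text{and}\qquad \{-D,-E\}\in \Xi_{d,n(K+2),K},$$ where $$M(s)=M_0(s)+F_1(s)-\epsilon I_{2n},\qquad N(s,\theta)=\begin{bmatrix}0_{n} & 0_{n}\\0_{n}&N_0(s,\theta)\end{bmatrix}+H_1(s,\theta),$$ $$\{M_0,N_0\}:=\mathcal{L}_1(P-\epsilon I_n,\,Q_i,\,S_i-\epsilon I_n,\,R_{ij}),$$ $$D(s)=D_0(s)+F_2(s),\qquad E(s,\theta)=\begin{bmatrix}0_{n(K+1)} & 0_{n(K+1)\times n}\\0_{n\times n(K+1)}&E_0(s,\theta)\end{bmatrix}+H_2(s,\theta),$$ $$\{D_0,E_0\}:=\mathcal{L}_1(D_1,\,V_i,\,\dot S_i + \epsilon I_n ,\,G_{ij}),$$ and where $$D_1:=\begin{bmatrix}C_{0}+C_0^T+\epsilon I_n & C_{1} & \cdots &C_{K} \\C_{1}^T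 &-S_1(-\tau_1) & 0&0 \\ \vdots&0&\ddots&0 \\ C_{K}^T &0&0&-S_K(-\tau_K)\end{bmatrix},$$ $$C_{0}:= A_0 P + \sum_{i=1}^K \left( \tau_K A_i Q_i(-\tau_i)^T + \tfrac12 S_i(0)\right),\qquad C_{i}:=\tau_K A_iS_i(-\tau_i),\quad i\in [K],$$ $$V_i(s):=\begin{bmatrix}B_i(s)^T & 0 &\cdots &0\end{bmatrix}^T\in\mathbb{R}^{n(K+1)\times n},\qquad B_{i}(s):=A_0 Q_i(s) +\dot Q_i(s)+\sum_{j=1}^K A_jR_{ji}(-\tau_j,s),\quad i\in [K],$$ $$G_{ij}(s,\theta):=\frac{\partial}{\partial s}R_{ij}(s,\theta)+\frac{\partial}{\partial \theta}R_{ji}(\theta,s)^T, \quad i,j\in [K].$$ Furthermore, suppose that for all $i,j\in[K]$ $$P=\tau_KQ_i(0)^T + \tau_KS_i(0),\qquad S_i(s)=S_i(s)^T,\qquad R_{ij}(s,\theta)=R_{ji}(\theta,s)^T,\qquad Q_j(s)=R_{ij}(0,s).$$ Then the system $$\dot x(t)=A_0x(t)+\sum_{i=1}^KA_ix(t-\tau_i),\quad t\ge0,\qquad x(t)=\phi_0(t),\quad t\in[-\tau_K,0],$$ with $\phi_0\in\mathcal{C}[-\tau_K,0]$, is exponentially stable.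
   Context: $L_2^m[D]$ denotes the square-integrable functions $D\to\mathbb{R}^m$ and $W_2^m[D]=\{x: x,\dot x\in L_2^m[D]\}$; $W_2^{n\times m}$ is the matrix-valued analogue (for functions of two variables, first-order partial derivatives in $L_2$). Functions in $W_2$ are regarded as continuous, and $Q_i,S_i,R_{ij}$ are assumed sufficiently smooth that the one-variable sections that occur are well defined and lie in $W_2$. $I_k$ is the identity matrix, $0_k$ the $k\times k$ zero matrix, $\mathcal{C}[-\tau_K,0]$ the continuous functions $[-\tau_K,0]\to\mathbb{R}^n$. Set $\tau_0=0$. Piecewise definitions below are on the almost disjoint intervals $[-\tau_i,-\tau_{i-1}]$, $i\in[K]$ (values at breakpoints are immaterial). **The map $\mathcal{L}_1$.** Given $P\in\mathbb{R}^{m\times m}$, $Q_i:[-\tau_i,0]\to\mathbb{R}^{m\times n}$, $S_i:[-\tau_i,0]\to\mathbb{R}^{n\times n}$, $R_{ij}:[-\tau_i,0]\times[-\tau_j,0]\to\mathbb{R}^{n\times n}$, and $a_i=\frac{\tau_i-\tau_{i-1}}{\tau_i}$, we write $\{M,N\}:=\mathcal{L}_1(P,Q_i,S_i,R_{ij})$ for $$M(s)=\begin{bmatrix}P & \frac{\tau_K}{a_i} Q_i\left(\frac{s+\tau_{i-1}}{a_i}\right)\\ \frac{\tau_K}{a_i} Q_i\left(\frac{s+\tau_{i-1}}{a_i}\right)^T & \frac{\tau_K}{a_i} S_i\left(\frac{s+\tau_{i-1}}{a_i}\right)\end{bmatrix},\quad s \in [-\tau_i, -\tau_{i-1}],$$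 $$N(s,\theta)=\frac{1}{a_ia_j}R_{ij}\left(\frac{s+\tau_{i-1}}{a_i},\frac{\theta+\tau_{j-1}}{a_j}\right),\quad s \in [-\tau_i, -\tau_{i-1}],\ \theta \in [-\tau_j, -\tau_{j-1}].$$ **The set $\Theta_{m,n,K}$.** It is the set of pairs $\{F,H\}$ of the form $$F(s) = \begin{bmatrix}\mathbf{K}(s) + \frac{1}{\tau_K}\int_{-\tau_K}^0 \int_{-\tau_K}^0 L_{11}(\omega,t)\,d\omega\, dt& \int_{-\tau_K}^0 L_{12}(\omega,s)\,d\omega \\ \int_{-\tau_K}^0 L_{21}(s,\omega)\,d\omega & 0\end{bmatrix},\qquad H(s,\theta) = - \begin{bmatrix}L_{11}(s,\theta)&L_{12}(s,\theta)\\L_{21}(s,\theta)&0\end{bmatrix}$$ for some square-integrable $\mathbf{K},L_{ij}$ with $\mathbf{K}(s),L_{11}(s,\theta)\in\mathbb{R}^{m\times m}$, $L_{12}(s,\theta)\in\mathbb{R}^{m\times n}$, $L_{21}(s,\theta)\in\mathbb{R}^{n\times m}$ and $\int_{-\tau_K}^0\mathbf{K}(s)\,ds=0$. **The set $\Xi_{d,p,K}$.** Let $Y_d(s)\in\mathbb{R}^{d+1}$ be the vector of monomials in $s$ of degree at most $d$, and $Y_d(s,\theta)\in\mathbb{R}^q$, $q=(d+1)(d+2)/2$, the vector of monomials in $(s,\theta)$ of total degree at most $d$. Let $J(s)=\begin{bmatrix}I_1(s)&\cdots&I_K(s)\end{bmatrix}^T$, where (here) $I_i$ is the indicator function of $[-\tau_i,-\tau_{i-1}]$.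 Set $Y_1(s)=Y_d(s)\otimes I_p\otimes J(s)$ and $Y_2(s,\theta)=Y_d(s,\theta)\otimes I_p\otimes J(s)\otimes J(\theta)$ (with $I_p$ the identity matrix). For a function $g\ge0$ on $[-\tau_K,0]$, say that a pair $\{M,N\}$ of $p\times p$ matrix-valued functions is generated by $g$ if there is a symmetric positive semidefinite matrix $Q=\begin{bmatrix}Q_{11}&Q_{12}\\Q_{12}^T&Q_{22}\end{bmatrix}$ (blocks of conformable size) with $$M(s)=g(s)Y_1(s)^TQ_{11}Y_1(s),$$ $$N(s,\theta)=g(s)Y_1(s)^TQ_{12}Y_2(s,\theta)+g(\theta)Y_2(\theta,s)^TQ_{12}^TY_1(\theta)+\int_{-\tau_K}^0g(\omega)Y_2(\omega,s)^TQ_{22}Y_2(\omega,\theta)\,d\omega .$$ Then $\Xi_{d,p,K}$ is the set of pairs $\{M_1+M_2,N_1+N_2\}$ where $\{M_1,N_1\}$ is generated by $g=1$ and $\{M_2,N_2\}$ is generated by the function $g$ with $g(s)=-(s+\tau_i)(s+\tau_{i-1})$ for $s\in[-\tau_i,-\tau_{i-1}]$, $i\in[K]$. Exponential stability of the delay system: there are $M,\beta>0$ such that every solution satisfies $\|x(t)\|\le Me^{-\beta t}\sup_{s\in[-\tau_K,0]}\|\phi_0(s)\|$ for all $t\ge0$. *)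

theory Defs
  imports "HOL-Analysis.Analysis"
begin

subsection \<open>Function spaces\<close>

(* Elements of L_2 are represented by Borel measurable functions; everything below
   depends on them only up to null sets. *)
definition square_integrable ::
  "'a::euclidean_space set \<Rightarrow> ('a \<Rightarrow> 'b::euclidean_space) \<Rightarrow> bool" where
  "square_integrable D f \<longleftrightarrow>
     set_borel_measurable lborel D f \<and> set_integrable lborel D (\<lambda>x. (norm (f x))\<^sup>2)"

(* f belongs to W_2[a,b], in its continuous representative, and f' is (a representative of)
   its derivative. The last conjunct says that f is absolutely continuous with derivative f'. *)
definition has_W2_derivative ::
  "real \<Rightarrow> real \<Rightarrow> (real \<Rightarrow> 'b::euclidean_space) \<Rightarrow> (real \<Rightarrow> 'b) \<Rightarrow> bool" where
  "has_W2_derivative a b f f' \<longleftrightarrow>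
     square_integrable {a..b} f \<and> square_integrable {a..b} f' \<and>
     (\<forall>t\<in>{a..b}. f t = f a + (LINT s:{a..t}|lborel. f' s))"

(* f belongs to W_2([a,b] x [c,d]) and is continuous; f1, f2 are (representatives of) its
   partial derivatives in the first and second variable, each being taken along almost
   every line parallel to the respective axis. *)
definition has_W2_partials ::
  "real \<Rightarrow> real \<Rightarrow> real \<Rightarrow> real \<Rightarrow> (real \<Rightarrow> real \<Rightarrow> 'b::euclidean_space) \<Rightarrow>
   (real \<Rightarrow> real \<Rightarrow> 'b) \<Rightarrow> (real \<Rightarrow> real \<Rightarrow> 'b) \<Rightarrow> bool" where
  "has_W2_partials a b c d f f1 f2 \<longleftrightarrow>
     continuous_on ({a..b} \<times> {c..d}) (\<lambda>(s, \<theta>). f s \<theta>) \<and>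
     square_integrable ({a..b} \<times> {c..d}) (\<lambda>(s, \<theta>). f s \<theta>) \<and>
     square_integrable ({a..b} \<times> {c..d}) (\<lambda>(s, \<theta>). f1 s \<theta>) \<and>
     square_integrable ({a..b} \<times> {c..d}) (\<lambda>(s, \<theta>). f2 s \<theta>) \<and>
     (AE \<theta> in lborel. \<theta> \<in> {c..d} \<longrightarrow>
        (\<forall>t\<in>{a..b}. f t \<theta> = f a \<theta> + (LINT s:{a..t}|lborel. f1 s \<theta>))) \<and>
     (AE s in lborel. s \<in> {a..b} \<longrightarrow>
        (\<forall>t\<in>{c..d}. f s t = f s c + (LINT \<theta>:{c..t}|lborel. f2 s \<theta>)))"


subsection \<open>Block matrices\<close>

definition block_mat ::
  "real^'c^'a \<Rightarrow> real^'d^'a \<Rightarrow> real^'c^'b \<Rightarrow> real^'d^'b \<Rightarrow>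
   real^('c::finite + 'd::finite)^('a::finite + 'b::finite)" where
  "block_mat A B C D = (\<chi> i j. case i of
      Inl a \<Rightarrow> (case j of Inl c \<Rightarrow> A $ a $ c | Inr d \<Rightarrow> B $ a $ d)
    | Inr b \<Rightarrow> (case j of Inl c \<Rightarrow> C $ b $ c | Inr d \<Rightarrow> D $ b $ d))"

definition block_row ::
  "('k \<Rightarrow> real^'n^'m) \<Rightarrow> real^('k::finite \<times> 'n::finite)^'m::finite" where
  "block_row C = (\<chi> a p. C (fst p) $ a $ snd p)"

definition block_diag ::
  "('k \<Rightarrow> real^'n^'n) \<Rightarrow> real^('k::finite \<times> 'n::finite)^('k \<times> 'n)" where
  "block_diag S = (\<chi> p q. if fst p = fst q then S (fst p) $ snd p $ snd q else 0)"

definition stack_zero :: "real^'n^'a \<Rightarrow> real^'n::finite^('a::finite + 'b::finite)" where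
  "stack_zero B = (\<chi> r c. case r of Inl a \<Rightarrow> B $ a $ c | Inr _ \<Rightarrow> 0)"


subsection \<open>Delays\<close>

(* The index set {1,...,K} is a finite linearly ordered type 'k with K = CARD('k), and the
   delays are a strictly increasing positive function on it. Thus tau_last is the largest
   delay, and tau_prev i is the delay with the preceding index (0 if i is the first one). *)
definition tau_last :: "('k::{finite,linorder} \<Rightarrow> real) \<Rightarrow> real" where
  "tau_last \<tau> = \<tau> (Max UNIV)"

definition tau_prev :: "('k::{finite,linorder} \<Rightarrow> real) \<Rightarrow> 'k \<Rightarrow> real" where
  "tau_prev \<tau> i = Max (insert 0 (\<tau> ` {..<i}))"

definition piece :: "('k::{finite,linorder} \<Rightarrow> real) \<Rightarrow> 'k \<Rightarrow> real set" where
  "piece \<tau> i = {- \<tau> i .. - tau_prev \<tau> i}"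

(* At a breakpoint, which lies in two pieces, the smaller index is taken. *)
definition piece_index :: "('k::{finite,linorder} \<Rightarrow> real) \<Rightarrow> real \<Rightarrow> 'k" where
  "piece_index \<tau> s = Min {i. s \<in> piece \<tau> i}"


subsection \<open>The map $\mathcal{L}_1$\<close>

definition L1_map ::
  "('k::{finite,linorder} \<Rightarrow> real) \<Rightarrow> real^'m^'m \<Rightarrow> ('k \<Rightarrow> real \<Rightarrow> real^'n^'m) \<Rightarrow>
   ('k \<Rightarrow> real \<Rightarrow> real^'n^'n) \<Rightarrow> ('k \<Rightarrow> 'k \<Rightarrow> real \<Rightarrow> real \<Rightarrow> real^'n^'n) \<Rightarrow>
   (real \<Rightarrow> real^('m::finite + 'n::finite)^('m + 'n)) \<times> (real \<Rightarrow> real \<Rightarrow> real^'n^'n)" where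
  "L1_map \<tau> P Q S R =
    (let a = (\<lambda>i. (\<tau> i - tau_prev \<tau> i) / \<tau> i);
         \<sigma> = (\<lambda>i s. (s + tau_prev \<tau> i) / a i)
     in (\<lambda>s. let i = piece_index \<tau> s; c = tau_last \<tau> / a i in
           block_mat P (c *\<^sub>R Q i (\<sigma> i s))
             (c *\<^sub>R transpose (Q i (\<sigma> i s))) (c *\<^sub>R S i (\<sigma> i s)),
         \<lambda>s \<theta>. let i = piece_index \<tau> s; j = piece_index \<tau> \<theta> in
           (1 / (a i * a j)) *\<^sub>R R i j (\<sigma> i s) (\<sigma> j \<theta>)))"


subsection \<open>The sets $\Theta$ and $\Xi$\<close>

(* Equality in L_2 of two pairs of functions on [-T,0] and on [-T,0] x [-T,0]. *)
definition ae_eq_pair ::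
  "real \<Rightarrow> (real \<Rightarrow> 'b) \<times> (real \<Rightarrow> real \<Rightarrow> 'b) \<Rightarrow> (real \<Rightarrow> 'b) \<times> (real \<Rightarrow> real \<Rightarrow> 'b) \<Rightarrow> bool" where
  "ae_eq_pair T X Y \<longleftrightarrow>
     (AE s in lborel. s \<in> {-T..0} \<longrightarrow> fst X s = fst Y s) \<and>
     (AE z in lborel. z \<in> {-T..0} \<times> {-T..0} \<longrightarrow> snd X (fst z) (snd z) = snd Y (fst z) (snd z))"

definition Theta ::
  "('k::{finite,linorder} \<Rightarrow> real) \<Rightarrow>
   ((real \<Rightarrow> real^('m::finite + 'n::finite)^('m + 'n)) \<times>
    (real \<Rightarrow> real \<Rightarrow> real^('m + 'n)^('m + 'n))) set" where
  "Theta \<tau> =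
    {X. let T = tau_last \<tau>; I = {-T..0} in
      \<exists>(Kf :: real \<Rightarrow> real^'m^'m) (L11 :: real \<Rightarrow> real \<Rightarrow> real^'m^'m)
        (L12 :: real \<Rightarrow> real \<Rightarrow> real^'n^'m) (L21 :: real \<Rightarrow> real \<Rightarrow> real^'m^'n).
        square_integrable I Kf \<and>
        square_integrable (I \<times> I) (\<lambda>(s, \<theta>). L11 s \<theta>) \<and>
        square_integrable (I \<times> I) (\<lambda>(s, \<theta>). L12 s \<theta>) \<and>
        square_integrable (I \<times> I) (\<lambda>(s, \<theta>). L21 s \<theta>) \<and>
        (LINT s:I|lborel. Kf s) = 0 \<and>
        ae_eq_pair T X
          (\<lambda>s. block_mat
                 (Kf s + (1 / T) *\<^sub>R (LINT t:I|lborel. (LINT \<omega>:I|lborel. L11 \<omega> t)))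
                 (LINT \<omega>:I|lborel. L12 \<omega> s)
                 (LINT \<omega>:I|lborel. L21 s \<omega>)
                 0,
           \<lambda>s \<theta>. - block_mat (L11 s \<theta>) (L12 s \<theta>) (L21 s \<theta>) 0)}"

(* Matrices whose size depends on d are functions on finite index sets. The rows of
   Y_1 = Y_d (x) I_p (x) J are indexed by (exponent, row of I_p, piece), those of Y_2 by
   (pair of exponents, row of I_p, piece of s, piece of theta). *)
type_synonym ('p, 'k) row1 = "nat \<times> 'p \<times> 'k"
type_synonym ('p, 'k) row2 = "(nat \<times> nat) \<times> 'p \<times> 'k \<times> 'k"

definition rows1 :: "nat \<Rightarrow> ('p::finite, 'k::finite) row1 set" where
  "rows1 d = {..d} \<times> UNIV"

definition rows2 :: "nat \<Rightarrow> ('p::finite, 'k::finite) row2 set" where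
  "rows2 d = {(a, b). a + b \<le> d} \<times> UNIV"

definition Y1 ::
  "('k::{finite,linorder} \<Rightarrow> real) \<Rightarrow> real \<Rightarrow> ('p, 'k) row1 \<Rightarrow> 'p::finite \<Rightarrow> real" where
  "Y1 \<tau> s = (\<lambda>(a, r, i) c. s ^ a * (if r = c then 1 else 0) * indicator (piece \<tau> i) s)"

definition Y2 ::
  "('k::{finite,linorder} \<Rightarrow> real) \<Rightarrow> real \<Rightarrow> real \<Rightarrow> ('p, 'k) row2 \<Rightarrow> 'p::finite \<Rightarrow> real" where
  "Y2 \<tau> s \<theta> = (\<lambda>((a, b), r, i, j) c. s ^ a * \<theta> ^ b * (if r = c then 1 else 0) *
     indicator (piece \<tau> i) s * indicator (piece \<tau> j) \<theta>)"

(* The matrix product Y^T Q Z. *)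
definition sandwich ::
  "'u set \<Rightarrow> 'v set \<Rightarrow> ('u \<Rightarrow> 'p \<Rightarrow> real) \<Rightarrow> ('u \<Rightarrow> 'v \<Rightarrow> real) \<Rightarrow> ('v \<Rightarrow> 'p \<Rightarrow> real) \<Rightarrow>
   real^'p^'p::finite" where
  "sandwich U V Y Q Z = (\<chi> r c. \<Sum>u\<in>U. \<Sum>v\<in>V. Y u r * Q u v * Z v c)"

definition sym_psd_on :: "'u set \<Rightarrow> ('u \<Rightarrow> 'u \<Rightarrow> real) \<Rightarrow> bool" where
  "sym_psd_on U Q \<longleftrightarrow>
     (\<forall>u\<in>U. \<forall>v\<in>U. Q u v = Q v u) \<and>
     (\<forall>x::'u \<Rightarrow> real. 0 \<le> (\<Sum>u\<in>U. \<Sum>v\<in>U. x u * Q u v * x v))"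

definition generated ::
  "('k::{finite,linorder} \<Rightarrow> real) \<Rightarrow> nat \<Rightarrow> (real \<Rightarrow> real) \<Rightarrow>
   (real \<Rightarrow> real^'p^'p::finite) \<Rightarrow> (real \<Rightarrow> real \<Rightarrow> real^'p^'p) \<Rightarrow> bool" where
  "generated \<tau> d g M N \<longleftrightarrow>
    (\<exists>Q :: ('p, 'k) row1 + ('p, 'k) row2 \<Rightarrow> ('p, 'k) row1 + ('p, 'k) row2 \<Rightarrow> real.
      let U = rows1 d; V = rows2 d;
          Q11 = (\<lambda>u u'. Q (Inl u) (Inl u'));
          Q12 = (\<lambda>u v. Q (Inl u) (Inr v));
          Q22 = (\<lambda>v v'. Q (Inr v) (Inr v'))
      in sym_psd_on (U <+> V) Q \<and>
         (\<forall>s. M s = g s *\<^sub>R sandwich U U (Y1 \<tau> s) Q11 (Y1 \<tau> s)) \<and>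
         (\<forall>s \<theta>. N s \<theta> =
            g s *\<^sub>R sandwich U V (Y1 \<tau> s) Q12 (Y2 \<tau> s \<theta>) +
            g \<theta> *\<^sub>R sandwich V U (Y2 \<tau> \<theta> s) (\<lambda>v u. Q12 u v) (Y1 \<tau> \<theta>) +
            (LINT \<omega>:{- tau_last \<tau>..0}|lborel.
               g \<omega> *\<^sub>R sandwich V V (Y2 \<tau> \<omega> s) Q22 (Y2 \<tau> \<omega> \<theta>))))"

definition Xi ::
  "('k::{finite,linorder} \<Rightarrow> real) \<Rightarrow> nat \<Rightarrow>
   ((real \<Rightarrow> real^'p^'p::finite) \<times> (real \<Rightarrow> real \<Rightarrow> real^'p^'p)) set" where
  "Xi \<tau> d =
    {X. \<exists>M1 N1 M2 N2.
        generated \<tau> d (\<lambda>_. 1) M1 N1 \<and>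
        generated \<tau> d
          (\<lambda>s. let i = piece_index \<tau> s in - (s + \<tau> i) * (s + tau_prev \<tau> i)) M2 N2 \<and>
        ae_eq_pair (tau_last \<tau>) X (\<lambda>s. M1 s + M2 s, \<lambda>s \<theta>. N1 s \<theta> + N2 s \<theta>)}"


subsection \<open>Delay systems\<close>

(* At t = 0 the derivative is the right-hand one. *)
definition is_solution ::
  "real^'n^'n::finite \<Rightarrow> ('k \<Rightarrow> real^'n^'n) \<Rightarrow> ('k::{finite,linorder} \<Rightarrow> real) \<Rightarrow>
   (real \<Rightarrow> real^'n) \<Rightarrow> (real \<Rightarrow> real^'n) \<Rightarrow> bool" where
  "is_solution A0 A \<tau> \<phi> x \<longleftrightarrow>
     (\<forall>t\<in>{- tau_last \<tau>..0}. x t = \<phi> t) \<and>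
     (\<forall>t\<ge>0. (x has_vector_derivative (A0 *v x t + (\<Sum>i\<in>UNIV. A i *v x (t - \<tau> i))))
              (at t within {0..}))"

definition exponentially_stable ::
  "real^'n^'n::finite \<Rightarrow> ('k \<Rightarrow> real^'n^'n) \<Rightarrow> ('k::{finite,linorder} \<Rightarrow> real) \<Rightarrow> bool" where
  "exponentially_stable A0 A \<tau> \<longleftrightarrow>
     (\<exists>M>0. \<exists>\<beta>>0. \<forall>\<phi> x.
        continuous_on {- tau_last \<tau>..0} \<phi> \<longrightarrow> is_solution A0 A \<tau> \<phi> x \<longrightarrow>
        (\<forall>t\<ge>0. norm (x t) \<le> M * exp (- \<beta> * t) * (SUP s\<in>{- tau_last \<tau>..0}. norm (\<phi> s))))"

end

theory Submission
  imports Defs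
begin

text \<open>
The hypotheses describe a quadratic Lyapunov functional, but not for the given system: it decreases along the
transposed system $\dot z(t) = A_0^T z(t) + \sum_i A_i^T z(t-\tau_i)$. This system decays exponentially, and a
duality between the two systems carries the decay over.

The functional is \<open>delay_form\<close>, the form of an operator with kernels $P, Q_i, S_i, R_{ij}$ acting on a vector
$x$ and functions $\phi_i$ on $[-\tau_i,0]$. A pair in \<open>Xi\<close> has a nonnegative quadratic form (\<open>Xi_nonneg_form\<close>); a
pair in \<open>Theta\<close> contributes nothing to this form when the first component of the test function is
constant (\<open>Theta_zero_form\<close>); and \<open>L1_map\<close> substitutes each $[-\tau_i,0]$ into its piece of $[-\tau_K,0]$,
so that the form of its value is \<open>delay_form\<close> (\<open>L1_form\<close>). The first membership condition
thus says that the functional is coercive, the second that the form \<open>dissipation\<close> made of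
\<open>D1\<close>, \<open>V\<close>, the derivatives of \<open>S\<close>, and \<open>G\<close> is at most minus $\epsilon$ times the squared norm.

A solution $x$ of the transposed system defines the state $\phi_i(t,s) = \tau_K A_i^T x(t-\tau_i-s)$, which is
transported: $\partial_t\phi = -\partial_s\phi$, $\phi_i(t,-\tau_i) = \tau_K A_i^T x(t)$ and
$\dot x = A_0^T x + \tau_K^{-1}\sum_i\phi_i(t,0)$. Differentiating the functional along it and integrating by parts moves the
derivative to the kernels. The compatibility conditions between $P$, $Q$, $S$ and $R$ are exactly what makes the result
(\<open>rate_eq\<close>) equal to \<open>dissipation\<close> minus $\tau_K\sum_i (\phi_i(0)-x)^T S_i(0)(\phi_i(0)-x)$. The last sum has a sign,
because coercivity forces $S_i(0) \ge 0$ (\<open>S_zero_psd\<close>). Hence the functional, and with it $x$,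
decays exponentially (\<open>transposed_decay\<close>). Passing to the transposed system avoids inverting the
operator that defines the functional.

For the duality take as $x$ the solutions with $x = 0$ on the negative half-line and $x(0)$ a
basis vector (\<open>delay_fundamental_solution\<close>). Integrating the derivative of $x(r)\cdot y(t-r)$ over $[0,t]$ expresses the
corresponding component of a solution $y$ of the given system by its initial history and the values of $x$ on
$[t-\tau_K,t]$ (\<open>solution_duality\<close>), where $x$ is exponentially small.
\<close>

section \<open>Matrix-valued integrals\<close>

lemma norm_matrix_vector_mult_le: "norm ((M::real^'n^'m) *v v) \<le> norm M * norm v"
proof -
  have *: "norm ((M *v v) $ i) \<le> norm ((norm v *\<^sub>R (\<chi> i. norm (M $ i))) $ i)" for i
  proof -
    have "(M *v v) $ i = M $ i \<bullet> v"
      by (simp add: matrix_vector_mult_def inner_vec_def)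
    then show ?thesis using Cauchy_Schwarz_ineq2[of "M $ i" v] by (simp add: mult.commute)
  qed
  have "norm (M *v v) \<le> norm (norm v *\<^sub>R (\<chi> i. norm (M $ i)))"
    using * by (rule norm_le_componentwise_cart)
  also have "\<dots> = norm v * norm (\<chi> i. norm (M $ i))" by simp
  also have "norm (\<chi> i. norm (M $ i)) = norm M"
    by (simp add: norm_vec_def)
  finally show "norm (M *v v) \<le> norm M * norm v" by (simp add: mult.commute)
qed

lemma bounded_bilinear_matrix_vector_mult:
  "bounded_bilinear (\<lambda>(M::real^'n^'m) v. M *v v)"
  by (rule bounded_bilinear.intro)
     (auto simp: matrix_vector_mult_add_rdistrib matrix_vector_right_distrib
        scaleR_matrix_vector_assoc matrix_vector_mult_scaleR
        intro!: exI[of _ 1] norm_matrix_vector_mult_le)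

lemmas matrix_vector_diff = bounded_bilinear.diff_left[OF bounded_bilinear_matrix_vector_mult]
  bounded_bilinear.diff_right[OF bounded_bilinear_matrix_vector_mult]

lemmas matrix_vector_minus = bounded_bilinear.minus_left[OF bounded_bilinear_matrix_vector_mult]
  bounded_bilinear.minus_right[OF bounded_bilinear_matrix_vector_mult]

lemmas matrix_vector_sum = bounded_bilinear.sum_left[OF bounded_bilinear_matrix_vector_mult]
  bounded_bilinear.sum_right[OF bounded_bilinear_matrix_vector_mult]

lemmas matrix_vector_continuous = 
  bounded_bilinear.continuous_on[OF bounded_bilinear_matrix_vector_mult]
  
lemma abs_inner_matrix_vector_le:
  "\<bar>a \<bullet> ((M::real^'n^'m) *v b)\<bar> \<le> norm a * norm M * norm b"
  by (smt (verit, best) Cauchy_Schwarz_ineq2 mult.assoc mult_left_mono norm_ge_zero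
      norm_matrix_vector_mult_le)

lemma bounded_linear_inner_matrix_vector:
  "bounded_linear (\<lambda>M::real^'n^'m. a \<bullet> (M *v b))"
  by (intro bounded_linear_inner_right_comp
      bounded_bilinear.bounded_linear_left[OF bounded_bilinear_matrix_vector_mult])

lemma inner_LINT_matrix_vector:
  fixes K :: "'a \<Rightarrow> real^'c^'b"
  assumes "set_integrable M X K"
  shows "x \<bullet> ((LINT s:X|M. K s) *v y) = (LINT s:X|M. x \<bullet> (K s *v y))"
  using integral_bounded_linear[OF bounded_linear_inner_matrix_vector assms[unfolded set_integrable_def], of x y]
  by (simp add: set_lebesgue_integral_def scaleR_matrix_vector_assoc[symmetric])

lemma inner_transpose_matrix_vector:
  "a \<bullet> (transpose (M::real^'n^'m) *v b) = b \<bullet> (M *v a)"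
  by (metis dot_lmul_matrix inner_commute transpose_matrix_vector)

lemma bounded_linear_transpose: "bounded_linear (transpose :: real^'n^'m \<Rightarrow> real^'m^'n)"
  by (rule linear_conv_bounded_linear[THEN iffD1], rule linearI)
     (simp_all add: transpose_def vec_eq_iff)

lemma borel_measurable_inner_matrix_vector [measurable (raw)]:
  fixes M :: "'a \<Rightarrow> real^'n^'m"
  assumes "u \<in> borel_measurable N" "M \<in> borel_measurable N" "w \<in> borel_measurable N"
  shows "(\<lambda>s. u s \<bullet> (M s *v w s)) \<in> borel_measurable N"
proof -
  have "continuous_on UNIV (\<lambda>x::(real^'n^'m) \<times> (real^'n). fst x *v snd x)"
    by (intro matrix_vector_continuous continuous_intros)
  then have "(\<lambda>s. M s *v w s) \<in> borel_measurable N"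
    by (intro borel_measurable_continuous_Pair[OF assms(2,3)]) auto
  then show ?thesis using assms(1) by simp
qed

lemma set_integrable_inner_matrix_vector:
  fixes M :: "'a::euclidean_space \<Rightarrow> real^'n^'m"
  assumes M: "set_integrable lborel A M"
    and u: "u \<in> borel_measurable borel" "\<And>s. norm (u s) \<le> c"
    and w: "w \<in> borel_measurable borel" "\<And>s. norm (w s) \<le> c'"
  shows "set_integrable lborel A (\<lambda>s. u s \<bullet> (M s *v w s))"
proof (rule set_integrable_bound)
  show "set_integrable lborel A (\<lambda>s. (c * c') *\<^sub>R M s)"
    by (intro set_integrable_scaleR_right impI M)
  have "(\<lambda>s. indicator A s *\<^sub>R M s) \<in> borel_measurable lborel"
    using M by (simp add: set_integrable_def borel_measurable_integrable)
  then have "(\<lambda>s. u s \<bullet> ((indicator A s *\<^sub>R M s) *v w s)) \<in> borel_measurable lborel"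
    using u(1) w(1) by (intro borel_measurable_inner_matrix_vector) simp_all
  then show "set_borel_measurable lborel A (\<lambda>s. u s \<bullet> (M s *v w s))"
    by (simp add: set_borel_measurable_def scaleR_matrix_vector_assoc[symmetric])
  have c: "0 \<le> c" "0 \<le> c'" using u(2) w(2) norm_ge_zero order_trans by blast+
  have "norm (u s \<bullet> (M s *v w s)) \<le> norm ((c * c') *\<^sub>R M s)" for s
  proof -
    have "\<bar>u s \<bullet> (M s *v w s)\<bar> \<le> norm (u s) * norm (M s) * norm (w s)"
      by (rule abs_inner_matrix_vector_le)
    also have "\<dots> \<le> c * norm (M s) * c'"
      by (intro mult_mono u w) (use c in auto)
    finally show ?thesis using c by (simp add: mult_ac)
  qed
  then show "AE x in lborel. x \<in> A \<longrightarrow> norm (u x \<bullet> (M x *v w x)) \<le> norm ((c * c') *\<^sub>R M x)"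
    by simp
qed

text \<open>The sets have finite measure, so $|f| \<le> 1 + |f|^2$ suffices. After this step $L_2$ is used only
through integrability.\<close>
lemma square_integrable_imp_set_integrable:
  fixes f :: "'a::euclidean_space \<Rightarrow> 'b::euclidean_space"
  assumes f: "square_integrable D f" and D: "D \<in> sets borel" "emeasure lborel D < \<infinity>"
  shows "set_integrable lborel D f"
proof (rule set_integrable_bound)
  show "set_integrable lborel D (\<lambda>x. 1 + (norm (f x))\<^sup>2)"
  proof (rule set_integral_add)
    show "set_integrable lborel D (\<lambda>x. 1::real)"
      using D by (simp add: set_integrable_def)
  qed (use f in \<open>auto simp: square_integrable_def\<close>)
  have "norm (f x) \<le> norm (1 + (norm (f x))\<^sup>2)" for x
  proof -
    have "norm (f x) \<le> 1 + (norm (f x))\<^sup>2"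
      using zero_le_power2[of "norm (f x) - 1/2"] by (simp add: power2_diff field_simps)
    then show ?thesis by simp
  qed
  then show "AE x in lborel. x \<in> D \<longrightarrow> norm (f x) \<le> norm (1 + (norm (f x))\<^sup>2)" by simp
qed (use f in \<open>auto simp: square_integrable_def\<close>)

lemma Icc_Times_finite:
  fixes a b c d :: real
  shows "{a..b} \<times> {c..d} \<in> sets borel" "emeasure lborel ({a..b} \<times> {c..d}) < \<infinity>"
proof -
  have eq: "{a..b} \<times> {c..d} = cbox (a, c) (b, d)" by (simp add: cbox_Pair_eq)
  show "{a..b} \<times> {c..d} \<in> sets borel" unfolding eq by (intro borel_closed closed_cbox)
  show "emeasure lborel ({a..b} \<times> {c..d}) < \<infinity>" unfolding eq by (rule emeasure_lborel_cbox_finite)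
qed

lemma set_Fubini:
  fixes f :: "'a::euclidean_space \<Rightarrow> 'b::euclidean_space \<Rightarrow> 'c::{banach, second_countable_topology}"
  assumes "set_integrable lborel (A \<times> B) (\<lambda>(x, y). f x y)"
  shows "(LINT x:A|lborel. (LINT y:B|lborel. f x y)) = (LINT z:A \<times> B|lborel. f (fst z) (snd z))"
    and "(LINT y:B|lborel. (LINT x:A|lborel. f x y)) = (LINT z:A \<times> B|lborel. f (fst z) (snd z))"
    and "set_integrable lborel A (\<lambda>x. LINT y:B|lborel. f x y)"
    and "set_integrable lborel B (\<lambda>y. LINT x:A|lborel. f x y)"
    and "AE y in lborel. y \<in> B \<longrightarrow> set_integrable lborel A (\<lambda>x. f x y)"
    and "AE x in lborel. x \<in> A \<longrightarrow> set_integrable lborel B (\<lambda>y. f x y)"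
proof -
  let ?F = "\<lambda>x y. indicator A x *\<^sub>R indicator B y *\<^sub>R f x y"
  have eq: "indicator (A \<times> B) z *\<^sub>R f (fst z) (snd z) = ?F (fst z) (snd z)" for z
    by (cases z) (auto simp: indicator_def)
  have int: "integrable (lborel \<Otimes>\<^sub>M lborel) (case_prod ?F)"
    using assms unfolding set_integrable_def case_prod_unfold eq lborel_prod .
  have *: "(LINT x:A|lborel. (LINT y:B|lborel. f x y)) = (\<integral>x. (\<integral>y. ?F x y \<partial>lborel) \<partial>lborel)"
    by (simp only: set_lebesgue_integral_def integral_scaleR_right[symmetric])
  have l: "integral\<^sup>L (lborel \<Otimes>\<^sub>M lborel) (case_prod ?F) = (LINT z:A \<times> B|lborel. f (fst z) (snd z))"
    unfolding set_lebesgue_integral_def case_prod_unfold eq lborel_prod ..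
  show "(LINT x:A|lborel. (LINT y:B|lborel. f x y)) = (LINT z:A \<times> B|lborel. f (fst z) (snd z))"
    unfolding * lborel_pair.integral_fst[OF int] l ..
  have c: "?F x y = indicator B y *\<^sub>R indicator A x *\<^sub>R f x y" for x y by simp
  have **: "(LINT y:B|lborel. (LINT x:A|lborel. f x y)) = (\<integral>y. (\<integral>x. ?F x y \<partial>lborel) \<partial>lborel)"
    unfolding c by (simp only: set_lebesgue_integral_def integral_scaleR_right[symmetric])
  show "(LINT y:B|lborel. (LINT x:A|lborel. f x y)) = (LINT z:A \<times> B|lborel. f (fst z) (snd z))"
    unfolding ** lborel_pair.integral_snd[OF int] l ..
  show "set_integrable lborel A (\<lambda>x. LINT y:B|lborel. f x y)"
    using lborel_pair.integrable_fst[OF int]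
    by (simp only: set_integrable_def set_lebesgue_integral_def integral_scaleR_right[symmetric])
  show "set_integrable lborel B (\<lambda>y. LINT x:A|lborel. f x y)"
    using lborel_pair.integrable_snd[OF int, unfolded c]
    by (simp only: set_integrable_def set_lebesgue_integral_def integral_scaleR_right[symmetric])
  have "AE y in lborel. integrable lborel (\<lambda>x. ?F x y)"
    by (rule lborel_pair.AE_integrable_snd[OF int])
  then show "AE y in lborel. y \<in> B \<longrightarrow> set_integrable lborel A (\<lambda>x. f x y)"
    by eventually_elim (auto simp: set_integrable_def)
  have "AE x in lborel. integrable lborel (\<lambda>y. ?F x y)"
    by (rule lborel_pair.AE_integrable_fst[OF int])
  then show "AE x in lborel. x \<in> A \<longrightarrow> set_integrable lborel B (\<lambda>y. f x y)"
    by eventually_elim (auto simp: set_integrable_def)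
qed

lemma set_integrable_product:
  fixes f :: "'a::euclidean_space \<Rightarrow> real" and g :: "'b::euclidean_space \<Rightarrow> real"
  assumes f: "set_integrable lborel A f" and g: "set_integrable lborel B g"
  shows "set_integrable lborel (A \<times> B) (\<lambda>z. f (fst z) * g (snd z))" (is ?int)
    and "(LINT z:A \<times> B|lborel. f (fst z) * g (snd z)) = (LINT x:A|lborel. f x) * (LINT y:B|lborel. g y)"
proof -
  let ?f = "\<lambda>x. indicator A x * f x" let ?g = "\<lambda>y. indicator B y * g y"
  have i: "integrable lborel ?f" "integrable lborel ?g"
    using f g by (simp_all add: set_integrable_def)
  have "integrable (lborel \<Otimes>\<^sub>M lborel) (\<lambda>z. ?f (fst z) * ?g (snd z))"
  proof (rule lborel_pair.Fubini_integrable)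
    show "(\<lambda>z. ?f (fst z) * ?g (snd z)) \<in> borel_measurable (lborel \<Otimes>\<^sub>M lborel)"
      using measurable_compose[OF measurable_fst borel_measurable_integrable[OF i(1)]]
        measurable_compose[OF measurable_snd borel_measurable_integrable[OF i(2)]]
      by (rule borel_measurable_times)
    show "integrable lborel (\<lambda>x. \<integral>y. norm (?f (fst (x, y)) * ?g (snd (x, y))) \<partial>lborel)"
      using integrable_norm[OF i(1)] by (simp add: abs_mult)
    show "AE x in lborel. integrable lborel (\<lambda>y. ?f (fst (x, y)) * ?g (snd (x, y)))"
      using i by simp
  qed
  moreover have "?f (fst z) * ?g (snd z) = indicator (A \<times> B) z *\<^sub>R (f (fst z) * g (snd z))" for z
    by (cases z) (simp add: indicator_times)
  ultimately show ?int by (simp add: set_integrable_def lborel_prod)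
  from set_Fubini(1)[of A B "\<lambda>x y. f x * g y"] this
  show "(LINT z:A \<times> B|lborel. f (fst z) * g (snd z)) = (LINT x:A|lborel. f x) * (LINT y:B|lborel. g y)"
    by (simp add: case_prod_unfold)
qed

section \<open>Quadratic forms of pairs\<close>

text \<open>Integrability and value are kept together, because the Lebesgue integral of a non-integrable function
is the default value 0 and a computation must never pass through it.\<close>
definition has_set_integral :: "'a::euclidean_space set \<Rightarrow> ('a \<Rightarrow> real) \<Rightarrow> real \<Rightarrow> bool" where
  "has_set_integral A f c \<longleftrightarrow> set_integrable lborel A f \<and> (LINT x:A|lborel. f x) = c"

lemma has_set_integralI:
  "set_integrable lborel A f \<Longrightarrow> has_set_integral A f (LINT x:A|lborel. f x)"
  by (simp add: has_set_integral_def)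

lemma has_set_integral_cong:
  assumes "has_set_integral A f c" "\<And>x. x \<in> A \<Longrightarrow> f x = g x" "c = c'"
  shows "has_set_integral A g c'"
proof -
  have "set_integrable lborel A f = set_integrable lborel A g"
    using assms(2) by (intro set_integrable_cong) auto
  moreover have "(LINT x:A|lborel. f x) = (LINT x:A|lborel. g x)"
    using assms(2) unfolding set_lebesgue_integral_def
    by (intro Bochner_Integration.integral_cong refl) (auto simp: indicator_def)
  ultimately show ?thesis using assms(1,3) by (simp add: has_set_integral_def)
qed

lemma has_set_integral_unique_AE:
  assumes "has_set_integral A f c" "has_set_integral A g c'"
    and "AE x in lborel. x \<in> A \<longrightarrow> f x = g x"
  shows "c = c'"
proof -
  have "(\<integral>x. indicator A x *\<^sub>R f x \<partial>lborel) = (\<integral>x. indicator A x *\<^sub>R g x \<partial>lborel)"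
  proof (rule integral_cong_AE)
    show "AE x in lborel. indicator A x *\<^sub>R f x = indicator A x *\<^sub>R g x"
      using assms(3) by eventually_elim (auto simp: indicator_def)
  qed (use assms in \<open>auto simp: has_set_integral_def set_integrable_def dest: borel_measurable_integrable\<close>)
  then show ?thesis using assms by (simp add: has_set_integral_def set_lebesgue_integral_def)
qed

lemma has_set_integral_add:
  assumes "has_set_integral A f c" "has_set_integral A g c'"
  shows "has_set_integral A (\<lambda>x. f x + g x) (c + c')"
  using assms by (auto simp: has_set_integral_def)

lemma has_set_integral_mult_right:
  assumes "has_set_integral A f c"
  shows "has_set_integral A (\<lambda>x. k * f x) (k * c)"
  using assms by (auto simp: has_set_integral_def)

lemma has_set_integral_sum:
  assumes "\<And>i. i \<in> J \<Longrightarrow> has_set_integral A (f i) (c i)"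
  shows "has_set_integral A (\<lambda>x. \<Sum>i\<in>J. f i x) (\<Sum>i\<in>J. c i)"
  using assms
proof (induction J rule: infinite_finite_induct)
  case (insert i J)
  then show ?case using has_set_integral_add[of A "f i" "c i"] by simp
qed (auto simp: has_set_integral_def set_integrable_def)

lemma has_set_integral_product:
  assumes "has_set_integral A f c" "has_set_integral B g c'"
  shows "has_set_integral (A \<times> B) (\<lambda>z. f (fst z) * g (snd z)) (c * c')"
  using assms set_integrable_product[of A f B g] by (auto simp: has_set_integral_def)

text \<open>The form $\int v^T M v + \int\int v(s)^T N(s,\theta) v(\theta)$ on $[-T,0]$. It is a
relation and not a function: pairs in \<open>Xi\<close> and \<open>Theta\<close> are given only up to null sets, so they need not be
Borel measurable, and only suitable representatives of them have a form.\<close>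
definition has_form ::
  "real \<Rightarrow> (real \<Rightarrow> real^'p^'p) \<Rightarrow> (real \<Rightarrow> real \<Rightarrow> real^'p^'p) \<Rightarrow> (real \<Rightarrow> real^'p) \<Rightarrow> real \<Rightarrow> bool" where
  "has_form T M N v c \<longleftrightarrow> (\<exists>a b.
     has_set_integral {-T..0} (\<lambda>s. v s \<bullet> (M s *v v s)) a \<and>
     has_set_integral ({-T..0} \<times> {-T..0}) (\<lambda>z. v (fst z) \<bullet> (N (fst z) (snd z) *v v (snd z))) b \<and>
     c = a + b)"

text \<open>This carries the value of the form from one representative of a pair to another.\<close>
lemma has_form_unique_AE:
  assumes "has_form T M N v c" "has_form T M' N' v c'" "ae_eq_pair T (M, N) (M', N')"
  shows "c = c'"
proof -
  obtain a b a' b' where *: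
    "has_set_integral {-T..0} (\<lambda>s. v s \<bullet> (M s *v v s)) a"
    "has_set_integral ({-T..0} \<times> {-T..0}) (\<lambda>z. v (fst z) \<bullet> (N (fst z) (snd z) *v v (snd z))) b"
    "c = a + b"
    "has_set_integral {-T..0} (\<lambda>s. v s \<bullet> (M' s *v v s)) a'"
    "has_set_integral ({-T..0} \<times> {-T..0}) (\<lambda>z. v (fst z) \<bullet> (N' (fst z) (snd z) *v v (snd z))) b'"
    "c' = a' + b'"
    using assms by (auto simp: has_form_def)
  have "a = a'"
    using assms(3) by (intro has_set_integral_unique_AE[OF *(1,4)]) (auto simp: ae_eq_pair_def elim: eventually_mono)
  moreover have "b = b'"
    using assms(3) by (intro has_set_integral_unique_AE[OF *(2,5)]) (auto simp: ae_eq_pair_def elim: eventually_mono)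
  ultimately show ?thesis using * by simp
qed

lemma has_form_add:
  assumes "has_form T M N v c" "has_form T M' N' v c'"
  shows "has_form T (\<lambda>s. M s + M' s) (\<lambda>s \<theta>. N s \<theta> + N' s \<theta>) v (c + c')"
proof -
  obtain a b a' b' where *:
    "has_set_integral {-T..0} (\<lambda>s. v s \<bullet> (M s *v v s)) a"
    "has_set_integral ({-T..0} \<times> {-T..0}) (\<lambda>z. v (fst z) \<bullet> (N (fst z) (snd z) *v v (snd z))) b"
    "c = a + b"
    "has_set_integral {-T..0} (\<lambda>s. v s \<bullet> (M' s *v v s)) a'"
    "has_set_integral ({-T..0} \<times> {-T..0}) (\<lambda>z. v (fst z) \<bullet> (N' (fst z) (snd z) *v v (snd z))) b'"
    "c' = a' + b'"
    using assms by (auto simp: has_form_def)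
  show ?thesis
    unfolding has_form_def using has_set_integral_add[OF *(1,4)] has_set_integral_add[OF *(2,5)] *(3,6)
    by (intro exI[of _ "a + a'"] exI[of _ "b + b'"])
       (simp add: matrix_vector_mult_add_rdistrib inner_add_right)
qed

lemma has_form_scale:
  assumes "has_form T M N v c"
  shows "has_form T (\<lambda>s. k *\<^sub>R M s) (\<lambda>s \<theta>. k *\<^sub>R N s \<theta>) v (k * c)"
proof -
  obtain a b where *:
    "has_set_integral {-T..0} (\<lambda>s. v s \<bullet> (M s *v v s)) a"
    "has_set_integral ({-T..0} \<times> {-T..0}) (\<lambda>z. v (fst z) \<bullet> (N (fst z) (snd z) *v v (snd z))) b"
    "c = a + b"
    using assms by (auto simp: has_form_def)
  show ?thesis
    unfolding has_form_def using has_set_integral_mult_right[OF *(1), of k] has_set_integral_mult_right[OF *(2), of k] *(3)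
    by (intro exI[of _ "k * a"] exI[of _ "k * b"])
       (simp add: scaleR_matrix_vector_assoc[symmetric] algebra_simps)
qed

section \<open>Forms of generated pairs\<close>

definition bounded_borel_on :: "real set \<Rightarrow> (real \<Rightarrow> real) \<Rightarrow> bool" where
  "bounded_borel_on A f \<longleftrightarrow> f \<in> borel_measurable borel \<and> (\<exists>B. \<forall>s\<in>A. \<bar>f s\<bar> \<le> B)"

lemma bounded_borel_on_mult:
  assumes "bounded_borel_on A f" "bounded_borel_on A g"
  shows "bounded_borel_on A (\<lambda>s. f s * g s)"
proof -
  obtain B B' where B: "\<forall>s\<in>A. \<bar>f s\<bar> \<le> B" "\<forall>s\<in>A. \<bar>g s\<bar> \<le> B'"
    using assms by (auto simp: bounded_borel_on_def)
  have "\<bar>f s * g s\<bar> \<le> B * B'" if "s \<in> A" for s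
    unfolding abs_mult using B that by (intro mult_mono) (auto intro: order_trans[OF abs_ge_zero])
  then show ?thesis using assms by (auto simp: bounded_borel_on_def intro!: borel_measurable_times)
qed

lemma bounded_borel_on_indicator: "B \<in> sets borel \<Longrightarrow> bounded_borel_on A (indicator B)"
  by (auto simp: bounded_borel_on_def indicator_def intro!: exI[of _ 1])

lemma bounded_borel_on_const: "bounded_borel_on A (\<lambda>_. c)"
  by (auto simp: bounded_borel_on_def)

lemma bounded_borel_on_power: "bounded_borel_on {a..b} (\<lambda>s. s ^ n)"
proof -
  have "bounded ((\<lambda>s. s ^ n) ` {a..b})"
    by (intro compact_imp_bounded compact_continuous_image continuous_intros) simp
  then show ?thesis by (auto simp: bounded_borel_on_def bounded_iff)
qed

lemma bounded_borel_on_set_integrable: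
  assumes "bounded_borel_on {a..b} f"
  shows "set_integrable lborel {a..b} f"
proof -
  obtain B where B: "\<forall>s\<in>{a..b}. \<bar>f s\<bar> \<le> B" using assms by (auto simp: bounded_borel_on_def)
  show ?thesis
  proof (rule set_integrable_bound[where f = "\<lambda>_. B"])
    show "set_integrable lborel {a..b} (\<lambda>_. B)"
      unfolding set_integrable_def real_scaleR_def
      by (intro integrable_mult_left integrable_real_indicator) (simp_all add: emeasure_lborel_Icc_eq)
    show "set_borel_measurable lborel {a..b} f"
      using assms by (auto simp: bounded_borel_on_def set_borel_measurable_def)
    show "AE x in lborel. x \<in> {a..b} \<longrightarrow> norm (f x) \<le> norm B"
      using B by (intro AE_I2) fastforce
  qed
qed

lemma inner_sandwich:
  fixes x y :: "real^'b::finite" and U :: "'a set" and V :: "'c set"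
  shows "x \<bullet> (sandwich U V Y Q Z *v y) =
     (\<Sum>u\<in>U. \<Sum>v\<in>V. (\<Sum>r\<in>UNIV. Y u r * x $ r) * Q u v * (\<Sum>c\<in>UNIV. Z v c * y $ c))"
proof -
  let ?F = "\<lambda>r c u v. (Y u r * x $ r) * Q u v * (Z v c * y $ c)"
  have swap: "(\<Sum>r\<in>UNIV. \<Sum>u\<in>U. \<Sum>v\<in>V. h r u v) = (\<Sum>u\<in>U. \<Sum>v\<in>V. \<Sum>r\<in>UNIV. h r u v)"
    for h :: "'b \<Rightarrow> 'a \<Rightarrow> 'c \<Rightarrow> real"
    by (rule trans[OF sum.swap]) (intro sum.cong refl sum.swap)
  have "x \<bullet> (sandwich U V Y Q Z *v y) = (\<Sum>r\<in>UNIV. \<Sum>c\<in>UNIV. \<Sum>u\<in>U. \<Sum>v\<in>V. ?F r c u v)"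
    by (simp add: inner_vec_def matrix_vector_mult_def sandwich_def sum_distrib_left sum_distrib_right mult_ac)
  also have "\<dots> = (\<Sum>u\<in>U. \<Sum>v\<in>V. \<Sum>r\<in>UNIV. \<Sum>c\<in>UNIV. ?F r c u v)"
    unfolding swap ..
  also have "\<dots> = (\<Sum>u\<in>U. \<Sum>v\<in>V. (\<Sum>r\<in>UNIV. Y u r * x $ r) * Q u v * (\<Sum>c\<in>UNIV. Z v c * y $ c))"
    by (intro sum.cong refl) (subst sum_distrib_right, subst sum_product, rule refl)
  finally show ?thesis .
qed

lemma finite_rows: "finite (rows1 d)" "finite (rows2 d)"
proof -
  have "finite {(a::nat, b). a + b \<le> d}"
    by (rule finite_subset[of _ "{..d} \<times> {..d}"]) auto
  then show "finite (rows1 d)" "finite (rows2 d)" by (simp_all add: rows1_def rows2_def)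
qed

text \<open>The entries of $Y_1(s)v(s)$. Since every entry of $Y_2(\omega,s)$ is a monomial in
$\omega$ times a monomial in $s$, those of $Y_2(\omega,s)v(s)$ split into the two factors that follow.\<close>
definition Y1_apply :: "('k::{finite,linorder} \<Rightarrow> real) \<Rightarrow> ('p::finite, 'k) row1 \<Rightarrow> (real \<Rightarrow> real^'p) \<Rightarrow> real \<Rightarrow> real" where
  "Y1_apply \<tau> = (\<lambda>(a, r, i) v s. s ^ a * indicator (piece \<tau> i) s * v s $ r)"

definition Y2_left :: "('k::{finite,linorder} \<Rightarrow> real) \<Rightarrow> ('p::finite, 'k) row2 \<Rightarrow> real \<Rightarrow> real" where
  "Y2_left \<tau> = (\<lambda>((a, b), r, i, j) s. s ^ a * indicator (piece \<tau> i) s)"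

definition Y2_right :: "('k::{finite,linorder} \<Rightarrow> real) \<Rightarrow> ('p::finite, 'k) row2 \<Rightarrow> (real \<Rightarrow> real^'p) \<Rightarrow> real \<Rightarrow> real" where
  "Y2_right \<tau> = (\<lambda>((a, b), r, i, j) v s. s ^ b * indicator (piece \<tau> j) s * v s $ r)"

lemma sum_Y1: "(\<Sum>c\<in>UNIV. Y1 \<tau> s u c * v s $ c) = Y1_apply \<tau> u v s"
proof -
  obtain a r i where u: "u = (a, r, i)" by (cases u)
  have "Y1 \<tau> s u c * v s $ c = (if r = c then s ^ a * indicator (piece \<tau> i) s * v s $ c else 0)" for c
    by (simp add: Y1_def u)
  then show ?thesis by (simp add: Y1_apply_def u)
qed

lemma sum_Y2: "(\<Sum>c\<in>UNIV. Y2 \<tau> \<omega> s u c * v s $ c) = Y2_left \<tau> u \<omega> * Y2_right \<tau> u v s"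
proof -
  obtain a b r i j where u: "u = ((a, b), r, i, j)" by (metis surj_pair)
  have "Y2 \<tau> \<omega> s u c * v s $ c = (if r = c then \<omega> ^ a * indicator (piece \<tau> i) \<omega> * (s ^ b * indicator (piece \<tau> j) s * v s $ c) else 0)" for c
    by (simp add: Y2_def u)
  then show ?thesis by (simp add: Y2_left_def Y2_right_def u)
qed

lemma integrable_sandwich_Y2:
  fixes \<tau> :: "'k::{finite,linorder} \<Rightarrow> real"
    and Q :: "('p::finite, 'k) row2 \<Rightarrow> ('p, 'k) row2 \<Rightarrow> real"
  assumes g: "bounded_borel_on {-T..0} g"
  shows "set_integrable lborel {-T..0} (\<lambda>\<omega>. g \<omega> *\<^sub>R sandwich V V' (Y2 \<tau> \<omega> s) Q (Y2 \<tau> \<omega> \<theta>))"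
proof -
  define Z :: "('p, 'k) row2 \<Rightarrow> real \<Rightarrow> 'p \<Rightarrow> real" where
    "Z = (\<lambda>((a, b), r, i, j) s c. s ^ b * indicator (piece \<tau> j) s * (if r = c then 1 else 0))"
  have Z: "Y2 \<tau> \<omega> s u c = Y2_left \<tau> u \<omega> * Z u s c" for \<omega> s and u :: "('p, 'k) row2" and c
    by (auto simp: Y2_def Z_def Y2_left_def split: prod.split)
  have eq: "g \<omega> *\<^sub>R sandwich V V' (Y2 \<tau> \<omega> s) Q (Y2 \<tau> \<omega> \<theta>) =
     (\<Sum>v\<in>V. \<Sum>v'\<in>V'. (g \<omega> * (Y2_left \<tau> v \<omega> * Y2_left \<tau> v' \<omega>)) *\<^sub>R (\<chi> r c. Z v s r * Q v v' * Z v' \<theta> c))" for \<omega>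
    by (simp add: sandwich_def Z vec_eq_iff sum_distrib_left mult_ac)
  have b: "bounded_borel_on {-T..0} (Y2_left \<tau> v)" for v :: "('p, 'k) row2"
    by (cases v) (auto simp: Y2_left_def piece_def split: prod.split
        intro!: bounded_borel_on_mult bounded_borel_on_power bounded_borel_on_indicator)
  have "set_integrable lborel {-T..0} (\<lambda>\<omega>. g \<omega> * (Y2_left \<tau> v \<omega> * Y2_left \<tau> v' \<omega>))" for v v' :: "('p, 'k) row2"
    by (intro bounded_borel_on_set_integrable bounded_borel_on_mult g b)
  then have "integrable lborel (\<lambda>\<omega>. indicator {-T..0} \<omega> * (g \<omega> * (Y2_left \<tau> v \<omega> * Y2_left \<tau> v' \<omega>)))" for v v' :: "('p, 'k) row2"
    by (simp add: set_integrable_def)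
  then show ?thesis
    unfolding eq set_integrable_def scaleR_sum_right scaleR_scaleR
    by (intro Bochner_Integration.integrable_sum integrable_scaleR_left) auto
qed

text \<open>With $W_1(s) = Y_1(s)v(s)$ and $W_2(\omega) = \int Y_2(\omega,\theta)v(\theta)\,d\theta$ the form
equals $\int g\,(W_1,W_2)^T Q\,(W_1,W_2)$, whose integrand is nonnegative. As the entries of $Y_2$ are
products of functions of one variable, all integrals over squares and cubes factor,
and the identity is one between finite sums.\<close>
lemma generated_has_nonneg_form:
  fixes v :: "real \<Rightarrow> real^'p::finite" and \<tau> :: "'k::{finite,linorder} \<Rightarrow> real"
  assumes gen: "generated \<tau> d g M N" and T: "T = tau_last \<tau>"
    and g: "bounded_borel_on {-T..0} g" "\<And>s. s \<in> {-T..0} \<Longrightarrow> 0 \<le> g s"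
    and v: "v \<in> borel_measurable borel" "\<And>s. norm (v s) \<le> C"
  shows "\<exists>c\<ge>0. has_form T M N v c"
proof -
  obtain Q :: "('p, 'k) row1 + ('p, 'k) row2 \<Rightarrow> ('p, 'k) row1 + ('p, 'k) row2 \<Rightarrow> real" where
    psd: "sym_psd_on (rows1 d <+> rows2 d) Q"
    and M: "\<And>s. M s = g s *\<^sub>R sandwich (rows1 d) (rows1 d) (Y1 \<tau> s) (\<lambda>u u'. Q (Inl u) (Inl u')) (Y1 \<tau> s)"
    and N: "\<And>s \<theta>. N s \<theta> =
            g s *\<^sub>R sandwich (rows1 d) (rows2 d) (Y1 \<tau> s) (\<lambda>u v. Q (Inl u) (Inr v)) (Y2 \<tau> s \<theta>) +
            g \<theta> *\<^sub>R sandwich (rows2 d) (rows1 d) (Y2 \<tau> \<theta> s) (\<lambda>v u. Q (Inl u) (Inr v)) (Y1 \<tau> \<theta>) +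
            (LINT \<omega>:{- T..0}|lborel.
               g \<omega> *\<^sub>R sandwich (rows2 d) (rows2 d) (Y2 \<tau> \<omega> s) (\<lambda>v v'. Q (Inr v) (Inr v')) (Y2 \<tau> \<omega> \<theta>))"
    using gen by (auto simp: generated_def Let_def T)
  define I where "I = {-T..0}"
  define U where "U = (rows1 d :: ('p, 'k) row1 set)"
  define V where "V = (rows2 d :: ('p, 'k) row2 set)"
  have fin: "finite U" "finite V" by (simp_all add: U_def V_def finite_rows)
  define p where "p = (\<lambda>u. Y1_apply \<tau> u v)"
  define q where "q = (\<lambda>u::('p, 'k) row2. Y2_left \<tau> u)"
  define r where "r = (\<lambda>u. Y2_right \<tau> u v)"
  have "(\<lambda>x::real^'p. x $ i) \<in> borel_measurable borel" for i
    by (intro borel_measurable_continuous_onI continuous_intros)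
  then have vm: "(\<lambda>s. v s $ i) \<in> borel_measurable borel" for i
    by (rule measurable_compose[OF v(1)])
  have vc: "bounded_borel_on I (\<lambda>s. v s $ i)" for i
    using vm order_trans[OF component_le_norm_cart v(2)]
    by (auto simp: bounded_borel_on_def intro!: exI[of _ C])
  have pb: "bounded_borel_on I (p u)" for u
    unfolding p_def Y1_apply_def I_def by (cases u) (auto simp: piece_def simp flip: I_def
        intro!: vc bounded_borel_on_mult bounded_borel_on_indicator bounded_borel_on_power[of "-T" 0, folded I_def])
  have qb: "bounded_borel_on I (q u)" for u
    unfolding q_def Y2_left_def by (cases u) (auto simp: piece_def split: prod.split
        intro!: bounded_borel_on_mult bounded_borel_on_indicator bounded_borel_on_power[of "-T" 0, folded I_def])
  have rb: "bounded_borel_on I (r u)" for u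
    unfolding r_def Y2_right_def by (cases u) (auto simp: piece_def split: prod.split
        intro!: vc bounded_borel_on_mult bounded_borel_on_indicator bounded_borel_on_power[of "-T" 0, folded I_def])
  have gb: "bounded_borel_on I g" using g by (simp add: I_def)
  have int: "has_set_integral I f (LINT s:I|lborel. f s)" if "bounded_borel_on I f" for f
    using that bounded_borel_on_set_integrable[of "-T" 0 f] by (auto simp: I_def intro!: has_set_integralI)
  define m where "m = (\<lambda>f h. LINT s:I|lborel. g s * (f s * h s))"
  have m: "has_set_integral I (\<lambda>s. g s * (f s * h s)) (m f h)" if "bounded_borel_on I f" "bounded_borel_on I h" for f h
    unfolding m_def by (intro int bounded_borel_on_mult gb that)
  define b where "b = (\<lambda>u. LINT s:I|lborel. r u s)"
  have b: "has_set_integral I (r u) (b u)" for u unfolding b_def by (intro int rb)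
  define W where "W = (\<lambda>x s. case x of Inl u \<Rightarrow> p u s | Inr w \<Rightarrow> b w * q w s)"
  have Wb: "bounded_borel_on I (W x)" for x
    by (cases x) (auto simp: W_def intro!: pb qb bounded_borel_on_mult bounded_borel_on_const)
  define c where "c = (\<Sum>x\<in>U <+> V. \<Sum>y\<in>U <+> V. Q x y * m (W x) (W y))"
  have "has_set_integral I (\<lambda>s. \<Sum>x\<in>U <+> V. \<Sum>y\<in>U <+> V. Q x y * (g s * (W x s * W y s))) c"
    unfolding c_def by (intro has_set_integral_sum has_set_integral_mult_right m Wb)
  then have "c = (LINT s:I|lborel. (\<Sum>x\<in>U <+> V. \<Sum>y\<in>U <+> V. Q x y * (g s * (W x s * W y s))))"
    by (simp add: has_set_integral_def)
  also have "\<dots> \<ge> 0"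
    unfolding set_lebesgue_integral_def
  proof (rule integral_nonneg_AE, rule AE_I2)
    fix s
    have "0 \<le> g s * (\<Sum>x\<in>U <+> V. \<Sum>y\<in>U <+> V. W x s * Q x y * W y s)" if "s \<in> I"
      using psd that g(2) by (auto simp: sym_psd_on_def U_def V_def I_def)
    then show "0 \<le> indicator I s *\<^sub>R (\<Sum>x\<in>U <+> V. \<Sum>y\<in>U <+> V. Q x y * (g s * (W x s * W y s)))"
      by (auto simp: indicator_def sum_distrib_left mult_ac)
  qed
  finally have c0: "0 \<le> c" .
  \<comment> \<open>The factor b of the second block is a constant and leaves the integral.\<close>
  have mW: "m (W (Inl u)) (W (Inl u')) = m (p u) (p u')"
    "m (W (Inl u)) (W (Inr w)) = m (p u) (q w) * b w"
    "m (W (Inr w)) (W (Inl u)) = m (q w) (p u) * b w"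
    "m (W (Inr w)) (W (Inr w')) = m (q w) (q w') * (b w * b w')" for u u' w w'
    by (simp_all add: m_def W_def flip: set_integral_mult_left) (simp_all add: mult_ac)
  have m1: "has_set_integral I (\<lambda>s. v s \<bullet> (M s *v v s)) (\<Sum>u\<in>U. \<Sum>u'\<in>U. Q (Inl u) (Inl u') * m (p u) (p u'))"
    (is "has_set_integral _ _ ?a")
  proof (rule has_set_integral_cong)
    show "has_set_integral I (\<lambda>s. \<Sum>u\<in>U. \<Sum>u'\<in>U. Q (Inl u) (Inl u') * (g s * (p u s * p u' s))) ?a"
      by (intro has_set_integral_sum has_set_integral_mult_right m pb)
    show "(\<Sum>u\<in>U. \<Sum>u'\<in>U. Q (Inl u) (Inl u') * (g s * (p u s * p u' s))) = v s \<bullet> (M s *v v s)" for s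
      unfolding M scaleR_matrix_vector_assoc[symmetric] inner_scaleR_right inner_sandwich sum_Y1
      by (simp add: sum_distrib_left p_def U_def mult_ac)
  qed simp
  have m2: "has_set_integral (I \<times> I) (\<lambda>z. v (fst z) \<bullet> (N (fst z) (snd z) *v v (snd z)))
    ((\<Sum>u\<in>U. \<Sum>w\<in>V. Q (Inl u) (Inr w) * (m (p u) (q w) * b w)) +
     (\<Sum>w\<in>V. \<Sum>u\<in>U. Q (Inl u) (Inr w) * (b w * m (q w) (p u))) +
     (\<Sum>w\<in>V. \<Sum>w'\<in>V. (Q (Inr w) (Inr w') * m (q w) (q w')) * (b w * b w')))"
    (is "has_set_integral _ _ ?b")
  proof (rule has_set_integral_cong)
    show "has_set_integral (I \<times> I) (\<lambda>z.
      (\<Sum>u\<in>U. \<Sum>w\<in>V. Q (Inl u) (Inr w) * (g (fst z) * (p u (fst z) * q w (fst z)) * r w (snd z))) +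
      (\<Sum>w\<in>V. \<Sum>u\<in>U. Q (Inl u) (Inr w) * (r w (fst z) * (g (snd z) * (q w (snd z) * p u (snd z))))) +
      (\<Sum>w\<in>V. \<Sum>w'\<in>V. (Q (Inr w) (Inr w') * m (q w) (q w')) * (r w (fst z) * r w' (snd z)))) ?b"
      by (intro has_set_integral_sum has_set_integral_mult_right has_set_integral_add
          has_set_integral_product m b pb qb)
    show "(\<Sum>u\<in>U. \<Sum>w\<in>V. Q (Inl u) (Inr w) * (g (fst z) * (p u (fst z) * q w (fst z)) * r w (snd z))) +
      (\<Sum>w\<in>V. \<Sum>u\<in>U. Q (Inl u) (Inr w) * (r w (fst z) * (g (snd z) * (q w (snd z) * p u (snd z))))) +
      (\<Sum>w\<in>V. \<Sum>w'\<in>V. (Q (Inr w) (Inr w') * m (q w) (q w')) * (r w (fst z) * r w' (snd z)))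
      = v (fst z) \<bullet> (N (fst z) (snd z) *v v (snd z))" for z
    proof -
      let ?S = "\<lambda>\<omega>. g \<omega> *\<^sub>R sandwich V V (Y2 \<tau> \<omega> (fst z)) (\<lambda>v v'. Q (Inr v) (Inr v')) (Y2 \<tau> \<omega> (snd z))"
      have iS: "set_integrable lborel I ?S"
        unfolding I_def by (rule integrable_sandwich_Y2) (rule g)
      have "v (fst z) \<bullet> ((LINT \<omega>:I|lborel. ?S \<omega>) *v v (snd z)) = (LINT \<omega>:I|lborel. v (fst z) \<bullet> (?S \<omega> *v v (snd z)))"
        by (rule inner_LINT_matrix_vector[OF iS])
      also have "\<dots> = (LINT \<omega>:I|lborel. (\<Sum>w\<in>V. \<Sum>w'\<in>V. (Q (Inr w) (Inr w') * (r w (fst z) * r w' (snd z))) * (g \<omega> * (q w \<omega> * q w' \<omega>))))"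
        unfolding scaleR_matrix_vector_assoc[symmetric] inner_scaleR_right inner_sandwich sum_Y2
        by (simp add: sum_distrib_left q_def r_def mult_ac)
      also have "\<dots> = (\<Sum>w\<in>V. \<Sum>w'\<in>V. (Q (Inr w) (Inr w') * (r w (fst z) * r w' (snd z))) * m (q w) (q w'))"
      proof -
        have "has_set_integral I (\<lambda>\<omega>. (\<Sum>w\<in>V. \<Sum>w'\<in>V. (Q (Inr w) (Inr w') * (r w (fst z) * r w' (snd z))) * (g \<omega> * (q w \<omega> * q w' \<omega>))))
          (\<Sum>w\<in>V. \<Sum>w'\<in>V. (Q (Inr w) (Inr w') * (r w (fst z) * r w' (snd z))) * m (q w) (q w'))"
          by (intro has_set_integral_sum has_set_integral_mult_right m qb)
        then show ?thesis by (simp add: has_set_integral_def)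
      qed
      finally have t3: "v (fst z) \<bullet> ((LINT \<omega>:I|lborel. ?S \<omega>) *v v (snd z)) = \<dots>" .
      show ?thesis
        unfolding N matrix_vector_mult_add_rdistrib inner_add_right t3[unfolded I_def V_def]
          scaleR_matrix_vector_assoc[symmetric] inner_scaleR_right inner_sandwich sum_Y2 sum_Y1
        by (simp add: sum_distrib_left p_def q_def r_def U_def V_def mult_ac)
    qed
  qed simp
  have "c = ?a + ?b"
  proof -
    have sym: "Q (Inr w) (Inl u) = Q (Inl u) (Inr w)" if "u \<in> U" "w \<in> V" for u w
      using psd that by (auto simp: sym_psd_on_def U_def V_def)
    have s: "(\<Sum>w\<in>V. \<Sum>u\<in>U. Q (Inr w) (Inl u) * (m (q w) (p u) * b w)) =
      (\<Sum>w\<in>V. \<Sum>u\<in>U. Q (Inl u) (Inr w) * (b w * m (q w) (p u)))"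
      by (intro sum.cong refl) (simp add: sym)
    show ?thesis
      unfolding c_def sum.Plus[OF fin] o_def mW sum.distrib s by (simp add: mult_ac)
  qed
  then show ?thesis using c0 m1 m2 unfolding has_form_def I_def by blast
qed

section \<open>The pieces of the delay interval\<close>

lemma tau_prev_nonneg: "0 \<le> tau_prev \<tau> i"
  by (simp add: tau_prev_def)

lemma tau_prev_less:
  assumes "strict_mono \<tau>" "\<And>i. 0 < \<tau> i"
  shows "tau_prev \<tau> i < \<tau> i"
  using assms by (auto simp: tau_prev_def strict_mono_less)

lemma tau_le_prev: "j < i \<Longrightarrow> \<tau> j \<le> tau_prev \<tau> i"
  by (auto simp: tau_prev_def)

lemma tau_le_last: "strict_mono \<tau> \<Longrightarrow> \<tau> i \<le> tau_last \<tau>"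
  by (auto simp: tau_last_def strict_mono_less_eq)

lemma in_some_piece:
  assumes "strict_mono \<tau>" "s \<in> {- tau_last \<tau>..0}"
  shows "\<exists>i. s \<in> piece \<tau> i"
proof -
  define J where "J = {i. - s \<le> \<tau> i}"
  have "Max UNIV \<in> J" using assms by (auto simp: J_def tau_last_def)
  then have "Min J \<in> J" by (intro Min_in) auto
  moreover have "\<tau> j \<le> - s" if "j < Min J" for j
  proof -
    have "j \<notin> J" using that Min_le[of J j] by (meson finite leD)
    then show ?thesis by (simp add: J_def)
  qed
  ultimately have "s \<in> piece \<tau> (Min J)"
    using assms(2) by (auto simp: piece_def J_def tau_prev_def le_minus_iff)
  then show ?thesis ..
qed

lemma piece_index_in:
  assumes "strict_mono \<tau>" "s \<in> {- tau_last \<tau>..0}"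
  shows "s \<in> piece \<tau> (piece_index \<tau> s)"
proof -
  have "Min {i. s \<in> piece \<tau> i} \<in> {i. s \<in> piece \<tau> i}"
    using in_some_piece[OF assms] by (intro Min_in) auto
  then show ?thesis by (simp add: piece_index_def)
qed

text \<open>Two pieces meet only in a breakpoint, so away from this finite set the choice made by \<open>piece_index\<close>
is no choice at all.\<close>
lemma piece_index_unique:
  assumes "strict_mono \<tau>" "s \<in> piece \<tau> i" "s \<in> piece \<tau> j" "s \<notin> range (\<lambda>i. - \<tau> i)"
  shows "i = j"
proof (rule ccontr)
  assume "i \<noteq> j"
  then consider "i < j" | "j < i" by fastforce
  then show False
  proof cases
    case 1
    have "s = - \<tau> i" using assms tau_le_prev[OF 1, of \<tau>] by (auto simp: piece_def)
    then show ?thesis using assms by auto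
  next
    case 2
    have "s = - \<tau> j" using assms tau_le_prev[OF 2, of \<tau>] by (auto simp: piece_def)
    then show ?thesis using assms by auto
  qed
qed

lemma AE_not_breakpoint:
  fixes \<tau> :: "'k::{finite,linorder} \<Rightarrow> real"
  shows "AE s in lborel. s \<notin> range (\<lambda>i. - \<tau> i)"
  by (intro AE_not_in countable_imp_null_set_lborel countable_finite finite_imageI finite)

lemma measurable_piece_index:
  "piece_index \<tau> \<in> measurable borel (count_space UNIV)"
proof -
  have m: "(\<lambda>s. {i. s \<in> piece \<tau> i}) \<in> measurable borel (count_space UNIV)"
  proof (rule measurable_count_space_eq2[THEN iffD2], simp, safe)
    fix X :: "'a set"
    have "(\<lambda>s. {i. s \<in> piece \<tau> i}) -` {X} \<inter> space borel = 
       {s. \<forall>i. s \<in> piece \<tau> i \<longleftrightarrow> i \<in> X}" by auto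
    also have "\<dots> = (\<Inter>i. if i \<in> X then piece \<tau> i else - piece \<tau> i)"
      by (auto split: if_splits)
    also have "\<dots> \<in> sets borel" by (intro sets.finite_INT) (auto simp: piece_def)
    finally show "(\<lambda>s. {i. s \<in> piece \<tau> i}) -` {X} \<inter> space borel \<in> sets borel" .
  qed simp
  have "piece_index \<tau> = Min \<circ> (\<lambda>s. {i. s \<in> piece \<tau> i})"
    by (auto simp: piece_index_def)
  then show ?thesis using measurable_comp[OF m, of Min "count_space UNIV"] by simp
qed

lemma borel_measurable_piecewise:
  assumes "\<And>i. f i \<in> borel_measurable borel"
  shows "(\<lambda>s. f (piece_index \<tau> s) s) \<in> borel_measurable borel"
  by (rule measurable_compose_countable[where g = "piece_index \<tau>"])
     (rule assms measurable_piece_index)+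

text \<open>On a piece both factors of the second weight $-(s+\tau_i)(s+\tau_{i-1})$ have a sign, so it is nonnegative.\<close>
lemma Xi_nonneg_form:
  fixes \<tau> :: "'k::{finite,linorder} \<Rightarrow> real"
  assumes "(M, N) \<in> Xi \<tau> d" "strict_mono \<tau>" "T = tau_last \<tau>"
  shows "\<exists>M' N'. ae_eq_pair T (M, N) (M', N') \<and>
    (\<forall>v C. v \<in> borel_measurable borel \<longrightarrow> (\<forall>s. norm (v s) \<le> C) \<longrightarrow> (\<exists>c\<ge>0. has_form T M' N' v c))"
proof -
  define g where "g = (\<lambda>s. let i = piece_index \<tau> s in - (s + \<tau> i) * (s + tau_prev \<tau> i))"
  obtain M1 N1 M2 N2 where
    gen: "generated \<tau> d (\<lambda>_. 1) M1 N1" "generated \<tau> d g M2 N2"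
    and ae: "ae_eq_pair T (M, N) (\<lambda>s. M1 s + M2 s, \<lambda>s \<theta>. N1 s \<theta> + N2 s \<theta>)"
    using assms(1,3) by (auto simp: Xi_def g_def)
  have g0: "0 \<le> g s" if "s \<in> {-T..0}" for s
    using piece_index_in[OF assms(2), of s] that assms(3)
      mult_nonpos_nonpos[of "- (s + \<tau> (piece_index \<tau> s))" "s + tau_prev \<tau> (piece_index \<tau> s)"]
    by (simp add: g_def Let_def piece_def)
  have "(\<lambda>s. (\<lambda>i s. - (s + \<tau> i) * (s + tau_prev \<tau> i)) (piece_index \<tau> s) s) \<in> borel_measurable borel"
    by (rule borel_measurable_piecewise) simp
  then have gm: "g \<in> borel_measurable borel" by (simp add: g_def Let_def)
  have "\<bar>g s\<bar> \<le> T * T" if "s \<in> {-T..0}" for s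
  proof -
    let ?i = "piece_index \<tau> s"
    have "\<bar>s + \<tau> ?i\<bar> \<le> T" "\<bar>s + tau_prev \<tau> ?i\<bar> \<le> T"
      using piece_index_in[OF assms(2), of s] that assms(3) tau_le_last[OF assms(2), of ?i] tau_prev_nonneg[of \<tau> ?i]
      by (auto simp: piece_def)
    then show ?thesis
      unfolding g_def Let_def abs_mult abs_minus_cancel by (intro mult_mono) auto
  qed
  then have gb: "bounded_borel_on {-T..0} g" using gm unfolding bounded_borel_on_def by blast
  show ?thesis
  proof (rule exI, rule exI, rule conjI[OF ae], intro allI impI)
    fix v :: "real \<Rightarrow> real^'a" and C
    assume "v \<in> borel_measurable borel" "\<forall>s. norm (v s) \<le> C"
    then have v: "v \<in> borel_measurable borel" "\<And>s. norm (v s) \<le> C" by auto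
    obtain c1 c2 where "0 \<le> c1" "0 \<le> c2" "has_form T M1 N1 v c1" "has_form T M2 N2 v c2"
      using generated_has_nonneg_form[OF gen(1) assms(3) bounded_borel_on_const _ v]
        generated_has_nonneg_form[OF gen(2) assms(3) gb g0 v] by auto
    then show "\<exists>c\<ge>0. has_form T (\<lambda>s. M1 s + M2 s) (\<lambda>s \<theta>. N1 s \<theta> + N2 s \<theta>) v c"
      by (intro exI[of _ "c1 + c2"]) (simp add: has_form_add)
  qed
qed

section \<open>Block vectors and the set Theta\<close>

definition join_vec :: "real^'m \<Rightarrow> real^'n \<Rightarrow> real^('m::finite + 'n::finite)" where
  "join_vec h p = (\<chi> i. case i of Inl a \<Rightarrow> h $ a | Inr b \<Rightarrow> p $ b)"

lemma sum_UNIV_Plus: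
  "(\<Sum>i\<in>UNIV. f i) = (\<Sum>a\<in>UNIV. f (Inl a)) + (\<Sum>b\<in>UNIV. f (Inr b))"
  for f :: "'m::finite + 'n::finite \<Rightarrow> 'c::comm_monoid_add"
  using sum.Plus[of "UNIV :: 'm set" "UNIV :: 'n set" f] by (simp add: UNIV_Plus_UNIV o_def)

lemma inner_join_vec: "join_vec h p \<bullet> join_vec h' p' = h \<bullet> h' + p \<bullet> p'"
  by (simp add: inner_vec_def sum_UNIV_Plus join_vec_def)

lemma block_mat_join_vec:
  "block_mat A B C D *v join_vec h p = join_vec (A *v h + B *v p) (C *v h + D *v p)"
  by (auto simp: vec_eq_iff matrix_vector_mult_def sum_UNIV_Plus join_vec_def block_mat_def
      split: sum.split)

lemma inner_block_mat:
  "join_vec h p \<bullet> (block_mat A B C D *v join_vec h' p') =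
     h \<bullet> (A *v h') + h \<bullet> (B *v p') + p \<bullet> (C *v h') + p \<bullet> (D *v p')"
  by (simp add: block_mat_join_vec inner_join_vec inner_add_right)

lemma norm_join_vec_le: "norm (join_vec h p) \<le> norm h + norm p"
proof (rule power2_le_imp_le)
  show "(norm (join_vec h p))\<^sup>2 \<le> (norm h + norm p)\<^sup>2"
    by (simp add: power2_norm_eq_inner inner_join_vec power2_sum)
qed simp

lemma borel_measurable_join_vec:
  assumes "\<psi> \<in> borel_measurable borel"
  shows "(\<lambda>s. join_vec h (\<psi> s)) \<in> borel_measurable borel"
proof -
  have "continuous_on UNIV (\<lambda>p. join_vec h p)"
    unfolding join_vec_def
  proof (intro continuous_on_vec_lambda)
    show "continuous_on UNIV (\<lambda>p. case i of Inl a \<Rightarrow> h $ a | Inr b \<Rightarrow> p $ b)" for i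
      by (cases i) (auto intro!: continuous_intros)
  qed
  then show ?thesis
    by (intro measurable_compose[OF assms] borel_measurable_continuous_onI)
qed

text \<open>Fubini for a kernel between two bounded functions, in the three forms that occur in \<open>Theta\<close>: as a
double integral, and with the inner integral taken inside the matrix when one of the functions is constant.\<close>
lemma kernel_integrals:
  fixes L :: "real \<Rightarrow> real \<Rightarrow> real^'b^'a"
  assumes L: "set_integrable lborel (A \<times> B) (\<lambda>(s, \<theta>). L s \<theta>)"
    and u: "u \<in> borel_measurable borel" "\<And>s. norm (u s) \<le> c"
    and w: "w \<in> borel_measurable borel" "\<And>s. norm (w s) \<le> c'"
  shows "set_integrable lborel (A \<times> B) (\<lambda>z. u (fst z) \<bullet> (L (fst z) (snd z) *v w (snd z)))"
    and "(\<And>s. u s = h) \<Longrightarrow> has_set_integral B (\<lambda>s. h \<bullet> ((LINT \<omega>:A|lborel. L \<omega> s) *v w s))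
      (LINT z:A \<times> B|lborel. u (fst z) \<bullet> (L (fst z) (snd z) *v w (snd z)))"
    and "(\<And>s. w s = k) \<Longrightarrow> has_set_integral A (\<lambda>s. u s \<bullet> ((LINT \<omega>:B|lborel. L s \<omega>) *v k))
      (LINT z:A \<times> B|lborel. u (fst z) \<bullet> (L (fst z) (snd z) *v w (snd z)))"
proof -
  have m: "(\<lambda>z::real \<times> real. u (fst z)) \<in> borel_measurable borel" "(\<lambda>z::real \<times> real. w (snd z)) \<in> borel_measurable borel"
    by (rule measurable_compose[OF _ u(1)] measurable_compose[OF _ w(1)];
        intro borel_measurable_continuous_onI continuous_intros)+
  show int: "set_integrable lborel (A \<times> B) (\<lambda>z. u (fst z) \<bullet> (L (fst z) (snd z) *v w (snd z)))"
    using set_integrable_inner_matrix_vector[OF L m(1) u(2) m(2) w(2)] by (simp add: case_prod_unfold)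
  note F = set_Fubini[of A B "\<lambda>s \<theta>. u s \<bullet> (L s \<theta> *v w \<theta>)", unfolded case_prod_unfold, OF int]
  note FL = set_Fubini[of A B L, OF L]
  show "has_set_integral B (\<lambda>s. h \<bullet> ((LINT \<omega>:A|lborel. L \<omega> s) *v w s))
      (LINT z:A \<times> B|lborel. u (fst z) \<bullet> (L (fst z) (snd z) *v w (snd z)))" if h: "\<And>s. u s = h"
  proof -
    let ?f = "\<lambda>s. h \<bullet> ((LINT \<omega>:A|lborel. L \<omega> s) *v w s)"
    have 1: "has_set_integral B ?f (LINT s:B|lborel. ?f s)"
      by (intro has_set_integralI set_integrable_inner_matrix_vector[OF FL(4) borel_measurable_const order_refl w])
    have 2: "has_set_integral B (\<lambda>s. LINT \<omega>:A|lborel. u \<omega> \<bullet> (L \<omega> s *v w s))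
      (LINT z:A \<times> B|lborel. u (fst z) \<bullet> (L (fst z) (snd z) *v w (snd z)))"
      using F(2,4) by (simp add: has_set_integral_def)
    have "AE s in lborel. s \<in> B \<longrightarrow> ?f s = (LINT \<omega>:A|lborel. u \<omega> \<bullet> (L \<omega> s *v w s))"
      using FL(5) by eventually_elim (auto simp: inner_LINT_matrix_vector h)
    from has_set_integral_unique_AE[OF 1 2 this] 1 show ?thesis by simp
  qed
  show "has_set_integral A (\<lambda>s. u s \<bullet> ((LINT \<omega>:B|lborel. L s \<omega>) *v k))
      (LINT z:A \<times> B|lborel. u (fst z) \<bullet> (L (fst z) (snd z) *v w (snd z)))" if k: "\<And>s. w s = k"
  proof -
    let ?f = "\<lambda>s. u s \<bullet> ((LINT \<omega>:B|lborel. L s \<omega>) *v k)"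
    have 1: "has_set_integral A ?f (LINT s:A|lborel. ?f s)"
      by (intro has_set_integralI set_integrable_inner_matrix_vector[OF FL(3) u borel_measurable_const order_refl])
    have 2: "has_set_integral A (\<lambda>s. LINT \<omega>:B|lborel. u s \<bullet> (L s \<omega> *v w \<omega>))
      (LINT z:A \<times> B|lborel. u (fst z) \<bullet> (L (fst z) (snd z) *v w (snd z)))"
      using F(1,3) by (simp add: has_set_integral_def)
    have "AE s in lborel. s \<in> A \<longrightarrow> ?f s = (LINT \<omega>:B|lborel. u s \<bullet> (L s \<omega> *v w \<omega>))"
      using FL(6) by eventually_elim (auto simp: inner_LINT_matrix_vector k)
    from has_set_integral_unique_AE[OF 1 2 this] 1 show ?thesis by simp
  qed
qed

lemma has_set_integral_const:
  assumes "a \<le> b"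
  shows "has_set_integral {a..b} (\<lambda>_. c) ((b - a) * c)"
proof -
  have "integrable lborel (\<lambda>x::real. indicator {a..b} x * c)"
    by (intro integrable_mult_left integrable_real_indicator) (simp_all add: emeasure_lborel_Icc_eq)
  then show ?thesis
    using assms by (simp add: has_set_integral_def set_integrable_def set_integral_const emeasure_lborel_Icc_eq)
qed

text \<open>The first component of the test function does not depend on $s$. So $\int \mathbf{K} = 0$ removes one
term, and each of the remaining entries of $F$ is the integral of an entry of $-H$ and cancels against it.\<close>
lemma Theta_zero_form:
  fixes \<tau> :: "'k::{finite,linorder} \<Rightarrow> real"
    and F :: "real \<Rightarrow> real^('m::finite + 'n::finite)^('m + 'n)"
  assumes "(F, H) \<in> Theta \<tau>" "T = tau_last \<tau>" "0 < T"
  shows "\<exists>F' H'. ae_eq_pair T (F, H) (F', H') \<and>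
    (\<forall>h \<psi> C. \<psi> \<in> borel_measurable borel \<longrightarrow> (\<forall>s. norm (\<psi> s) \<le> C) \<longrightarrow>
       has_form T F' H' (\<lambda>s. join_vec h (\<psi> s)) 0)"
proof -
  define I where "I = {-T..0}"
  obtain Kf :: "real \<Rightarrow> real^'m^'m" and L11 :: "real \<Rightarrow> real \<Rightarrow> real^'m^'m" and
        L12 :: "real \<Rightarrow> real \<Rightarrow> real^'n^'m" and L21 :: "real \<Rightarrow> real \<Rightarrow> real^'m^'n" where
     sq: "square_integrable I Kf" "square_integrable (I \<times> I) (\<lambda>(s, \<theta>). L11 s \<theta>)"
        "square_integrable (I \<times> I) (\<lambda>(s, \<theta>). L12 s \<theta>)"
        "square_integrable (I \<times> I) (\<lambda>(s, \<theta>). L21 s \<theta>)"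
    and K0: "(LINT s:I|lborel. Kf s) = 0"
    and ae: "ae_eq_pair T (F, H)
          (\<lambda>s. block_mat
                 (Kf s + (1 / T) *\<^sub>R (LINT t:I|lborel. (LINT \<omega>:I|lborel. L11 \<omega> t)))
                 (LINT \<omega>:I|lborel. L12 \<omega> s)
                 (LINT \<omega>:I|lborel. L21 s \<omega>)
                 0,
           \<lambda>s \<theta>. - block_mat (L11 s \<theta>) (L12 s \<theta>) (L21 s \<theta>) 0)"
    using assms(1) unfolding Theta_def Let_def assms(2)[symmetric] I_def[symmetric] mem_Collect_eq
    by (elim exE conjE) (rule that)
  have I: "I \<in> sets borel" "emeasure lborel I < \<infinity>" by (simp_all add: I_def emeasure_lborel_Icc_eq)
  have II: "I \<times> I \<in> sets borel" "emeasure lborel (I \<times> I) < \<infinity>"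
    unfolding I_def by (rule Icc_Times_finite)+
  note iK = square_integrable_imp_set_integrable[OF sq(1) I]
  note i11 = square_integrable_imp_set_integrable[OF sq(2) II]
  note i12 = square_integrable_imp_set_integrable[OF sq(3) II]
  note i21 = square_integrable_imp_set_integrable[OF sq(4) II]
  show ?thesis
  proof (rule exI, rule exI, rule conjI[OF ae], intro allI impI)
    fix h :: "real^'m" and \<psi> :: "real \<Rightarrow> real^'n" and C
    assume "\<psi> \<in> borel_measurable borel" "\<forall>s. norm (\<psi> s) \<le> C"
    then have psi: "\<psi> \<in> borel_measurable borel" "\<And>s. norm (\<psi> s) \<le> C" by auto
    have hb: "(\<lambda>_. h) \<in> borel_measurable borel" "\<And>s::real. norm h \<le> norm h" by auto
    note k11 = kernel_integrals[OF i11 hb hb]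
    note k12 = kernel_integrals[OF i12 hb psi]
    note k21 = kernel_integrals[OF i21 psi hb]
    define c11 where "c11 = (LINT z:I \<times> I|lborel. h \<bullet> (L11 (fst z) (snd z) *v h))"
    define c12 where "c12 = (LINT z:I \<times> I|lborel. h \<bullet> (L12 (fst z) (snd z) *v \<psi> (snd z)))"
    define c21 where "c21 = (LINT z:I \<times> I|lborel. \<psi> (fst z) \<bullet> (L21 (fst z) (snd z) *v h))"
    let ?LL = "LINT t:I|lborel. (LINT \<omega>:I|lborel. L11 \<omega> t)"
    have "h \<bullet> (?LL *v h) = c11"
      using k11(2)[OF refl] unfolding inner_LINT_matrix_vector[OF set_Fubini(4)[OF i11], of h h] has_set_integral_def c11_def
      by (rule conjunct2)
    then have a2: "has_set_integral I (\<lambda>s. 1 / T * (h \<bullet> (?LL *v h))) c11"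
      using has_set_integral_const[of "-T" 0 "1 / T * c11"] assms(3) by (simp add: I_def)
    have a1: "has_set_integral I (\<lambda>s. h \<bullet> (Kf s *v h)) 0"
      using inner_LINT_matrix_vector[OF iK, of h h] set_integrable_inner_matrix_vector[OF iK hb hb]
      by (simp add: has_set_integral_def K0)
    have a3: "has_set_integral I (\<lambda>s. h \<bullet> ((LINT \<omega>:I|lborel. L12 \<omega> s) *v \<psi> s)) c12"
      unfolding c12_def by (rule k12(2)[OF refl])
    have a4: "has_set_integral I (\<lambda>s. \<psi> s \<bullet> ((LINT \<omega>:I|lborel. L21 s \<omega>) *v h)) c21"
      unfolding c21_def by (rule k21(3)[OF refl])
    have b1: "has_set_integral (I \<times> I) (\<lambda>z. h \<bullet> (L11 (fst z) (snd z) *v h)) c11"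
      unfolding c11_def by (rule has_set_integralI[OF k11(1)])
    have b2: "has_set_integral (I \<times> I) (\<lambda>z. h \<bullet> (L12 (fst z) (snd z) *v \<psi> (snd z))) c12"
      unfolding c12_def by (rule has_set_integralI[OF k12(1)])
    have b3: "has_set_integral (I \<times> I) (\<lambda>z. \<psi> (fst z) \<bullet> (L21 (fst z) (snd z) *v h)) c21"
      unfolding c21_def by (rule has_set_integralI[OF k21(1)])
    note a = has_set_integral_add[OF has_set_integral_add[OF has_set_integral_add[OF a1 a2] a3] a4]
    note b = has_set_integral_mult_right[OF has_set_integral_add[OF has_set_integral_add[OF b1 b2] b3], of "-1"]
    show "has_form T (\<lambda>s. block_mat (Kf s + (1 / T) *\<^sub>R ?LL) (LINT \<omega>:I|lborel. L12 \<omega> s) (LINT \<omega>:I|lborel. L21 s \<omega>) 0)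
       (\<lambda>s \<theta>. - block_mat (L11 s \<theta>) (L12 s \<theta>) (L21 s \<theta>) 0) (\<lambda>s. join_vec h (\<psi> s)) 0"
      unfolding has_form_def I_def[symmetric]
    proof (intro exI conjI)
      show "has_set_integral I (\<lambda>s. join_vec h (\<psi> s) \<bullet> (block_mat (Kf s + (1 / T) *\<^sub>R ?LL)
         (LINT \<omega>:I|lborel. L12 \<omega> s) (LINT \<omega>:I|lborel. L21 s \<omega>) 0 *v join_vec h (\<psi> s))) (0 + c11 + c12 + c21)"
        by (rule has_set_integral_cong[OF a])
           (simp_all add: inner_block_mat matrix_vector_mult_add_rdistrib inner_add_right
             scaleR_matrix_vector_assoc[symmetric])
      show "has_set_integral (I \<times> I) (\<lambda>z. join_vec h (\<psi> (fst z)) \<bullet> (- block_mat (L11 (fst z) (snd z))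
         (L12 (fst z) (snd z)) (L21 (fst z) (snd z)) 0 *v join_vec h (\<psi> (snd z)))) (-1 * (c11 + c12 + c21))"
        by (rule has_set_integral_cong[OF b])
           (simp_all add: inner_block_mat matrix_vector_minus)
    qed simp
  qed
qed

section \<open>The map L1 as a substitution\<close>

definition stretch :: "('k::{finite,linorder} \<Rightarrow> real) \<Rightarrow> 'k \<Rightarrow> real" where
  "stretch \<tau> i = (\<tau> i - tau_prev \<tau> i) / \<tau> i"

definition rescale :: "('k::{finite,linorder} \<Rightarrow> real) \<Rightarrow> 'k \<Rightarrow> real \<Rightarrow> real" where
  "rescale \<tau> i s = (s + tau_prev \<tau> i) / stretch \<tau> i"

lemma stretch_pos:
  assumes "strict_mono \<tau>" "\<And>i. 0 < \<tau> i"
  shows "0 < stretch \<tau> i"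
  using tau_prev_less[OF assms] assms by (simp add: stretch_def)

lemma rescale_in_iff:
  assumes "strict_mono \<tau>" "\<And>i. 0 < \<tau> i"
  shows "rescale \<tau> i s \<in> {- \<tau> i..0} \<longleftrightarrow> s \<in> piece \<tau> i"
proof -
  have "\<tau> i * stretch \<tau> i = \<tau> i - tau_prev \<tau> i"
    using assms(2)[of i] by (simp add: stretch_def)
  then show ?thesis
    using stretch_pos[OF assms, of i]
    by (auto simp: rescale_def piece_def pos_le_divide_eq divide_le_0_iff)
qed

lemma piece_subset:
  assumes "strict_mono \<tau>"
  shows "piece \<tau> i \<subseteq> {- tau_last \<tau>..0}"
  using tau_le_last[OF assms, of i] tau_prev_nonneg[of \<tau> i] by (auto simp: piece_def)

lemma rescale_affine: "rescale \<tau> i s = tau_prev \<tau> i / stretch \<tau> i + (1 / stretch \<tau> i) * s"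
  by (simp add: rescale_def add_divide_distrib)

lemma borel_measurable_rescale: "rescale \<tau> i \<in> borel_measurable borel"
  unfolding rescale_affine[abs_def] by measurable

lemma has_bochner_integral_cmult:
  fixes f :: "'a \<Rightarrow> real"
  shows "has_bochner_integral M f x \<Longrightarrow> has_bochner_integral M (\<lambda>z. k * f z) (k * x)"
  by (rule has_bochner_integral_mult_right)

text \<open>Substitution of an increasing affine map in each variable, for the kernels that
\<open>L1_map\<close> rescales.\<close>
lemma has_bochner_integral_affine_pair:
  fixes f :: "real \<times> real \<Rightarrow> real"
  assumes f: "has_bochner_integral lborel f c" and k: "0 < k" "0 < l"
  shows "has_bochner_integral lborel (\<lambda>z. f (t + k * fst z, u + l * snd z)) (c / (k * l))"
proof -
  define S where "S = (\<lambda>z::real \<times> real. (t + k * fst z, u + l * snd z))"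
  define w where "w = (\<lambda>j::real \<times> real. if j = (1, 0) then k else l)"
  have S: "S z = (t, u) + (\<Sum>j\<in>Basis. (w j * (z \<bullet> j)) *\<^sub>R j)" for z
    by (cases z) (simp add: S_def w_def Basis_prod_def sum.union_disjoint)
  have Sm: "S \<in> measurable lborel borel"
    unfolding S_def by (auto intro!: borel_measurable_continuous_onI continuous_intros)
  have "(\<Prod>j\<in>Basis. \<bar>w j\<bar>) = k * l"
    using k by (simp add: w_def Basis_prod_def)
  then have eq: "lborel = density (distr lborel borel S) (\<lambda>_. ennreal (k * l))"
    using lborel_affine_euclidean[of w "(t, u)"] k unfolding S[symmetric, abs_def]
    by (auto simp: w_def)
  have fm: "f \<in> borel_measurable borel" using f by (auto dest: borel_measurable_has_bochner_integral)
  have d: "integrable (density (distr lborel borel S) (\<lambda>_. ennreal (k * l))) f"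
    "integral\<^sup>L (density (distr lborel borel S) (\<lambda>_. ennreal (k * l))) f = c"
    using f unfolding eq[symmetric] by (simp_all add: has_bochner_integral_iff)
  have "integrable (distr lborel borel S) (\<lambda>x. (k * l) *\<^sub>R f x)"
    using d(1) k fm by (subst (asm) integrable_density) auto
  then have 1: "integrable lborel (\<lambda>x. (k * l) *\<^sub>R f (S x))"
    using fm by (subst (asm) integrable_distr_eq[OF Sm]) auto
  have "integral\<^sup>L (distr lborel borel S) (\<lambda>x. (k * l) *\<^sub>R f x) = c"
    using d(2) k fm by (subst (asm) integral_density) auto
  then have 2: "integral\<^sup>L lborel (\<lambda>x. (k * l) *\<^sub>R f (S x)) = c"
    using fm by (subst (asm) integral_distr[OF Sm]) auto
  have "has_bochner_integral lborel (\<lambda>x. (k * l) *\<^sub>R f (S x)) c"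
    using 1 2 by (simp add: has_bochner_integral_iff)
  from has_bochner_integral_cmult[OF this[unfolded real_scaleR_def], of "1 / (k * l)"] k
  show ?thesis by (simp add: S_def)
qed

lemma has_set_integral_bochner:
  "has_set_integral A f c \<longleftrightarrow> has_bochner_integral lborel (\<lambda>x. indicator A x * f x) c"
  by (simp add: has_set_integral_def set_integrable_def set_lebesgue_integral_def has_bochner_integral_iff)

text \<open>\<open>rescale\<close> maps the $i$th piece onto $[-\tau_i,0]$, and its derivative
cancels against the factor in front. Breakpoints form a null set.\<close>
lemma piecewise_set_integral:
  fixes \<tau> :: "'k::{finite,linorder} \<Rightarrow> real"
  assumes tau: "strict_mono \<tau>" "\<And>i. 0 < \<tau> i"
    and f: "\<And>i. has_set_integral {- \<tau> i..0} (f i) (c i)"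
  shows "has_set_integral {- tau_last \<tau>..0}
    (\<lambda>s. let i = piece_index \<tau> s in 1 / stretch \<tau> i * f i (rescale \<tau> i s)) (\<Sum>i\<in>UNIV. c i)"
    (is "has_set_integral ?I ?F _")
proof -
  define g where "g = (\<lambda>i x. indicator {- \<tau> i..0} x * f i x)"
  note a = stretch_pos[OF tau]
  have g: "has_bochner_integral lborel (g i) (c i)" for i
    using f[of i] by (simp add: has_set_integral_bochner g_def)
  then have gm: "g i \<in> borel_measurable borel" for i
    using borel_measurable_has_bochner_integral by fastforce
  have "has_bochner_integral lborel (\<lambda>s. 1 / stretch \<tau> i * g i (rescale \<tau> i s)) (c i)" for i
  proof -
    have "has_bochner_integral lborel (\<lambda>s. g i (rescale \<tau> i s)) (c i * stretch \<tau> i)"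
      using lborel_has_bochner_integral_real_affine_iff[of "1 / stretch \<tau> i" "g i" "c i" "tau_prev \<tau> i / stretch \<tau> i"]
        g[of i] a[of i] by (simp add: rescale_affine mult.commute)
    from has_bochner_integral_cmult[OF this, of "1 / stretch \<tau> i"] show ?thesis using a[of i] by simp
  qed
  then have sum: "has_bochner_integral lborel (\<lambda>s. \<Sum>i\<in>UNIV. 1 / stretch \<tau> i * g i (rescale \<tau> i s)) (\<Sum>i\<in>UNIV. c i)"
    by (intro has_bochner_integral_sum) auto
  have F: "indicator ?I s * ?F s = indicator ?I s *
      (1 / stretch \<tau> (piece_index \<tau> s) * g (piece_index \<tau> s) (rescale \<tau> (piece_index \<tau> s) s))" for s
  proof (cases "s \<in> ?I")
    case True
    then have "rescale \<tau> (piece_index \<tau> s) s \<in> {- \<tau> (piece_index \<tau> s)..0}"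
      unfolding rescale_in_iff[OF tau] by (rule piece_index_in[OF tau(1)])
    then show ?thesis unfolding g_def Let_def by simp
  qed simp
  have "(\<lambda>s. indicator ?I s *
      (1 / stretch \<tau> (piece_index \<tau> s) * g (piece_index \<tau> s) (rescale \<tau> (piece_index \<tau> s) s))) \<in> borel_measurable borel"
    by (intro borel_measurable_times borel_measurable_indicator
        borel_measurable_piecewise[where f = "\<lambda>i s. 1 / stretch \<tau> i * g i (rescale \<tau> i s)"]
        measurable_compose[OF borel_measurable_rescale gm]) auto
  then have Fm: "(\<lambda>s. indicator ?I s * ?F s) \<in> borel_measurable lborel"
    unfolding F by simp
  have "AE s in lborel. (\<Sum>i\<in>UNIV. 1 / stretch \<tau> i * g i (rescale \<tau> i s)) = indicator ?I s * ?F s"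
    using AE_not_breakpoint[of \<tau>]
  proof eventually_elim
    case (elim s)
    have gi: "g i (rescale \<tau> i s) = (if s \<in> piece \<tau> i then f i (rescale \<tau> i s) else 0)" for i
      unfolding rescale_in_iff[OF tau, symmetric] g_def by (simp add: indicator_def)
    show ?case
    proof (cases "s \<in> ?I")
      case True
      let ?j = "piece_index \<tau> s"
      have j: "s \<in> piece \<tau> ?j" using piece_index_in[OF tau(1) True] .
      have "1 / stretch \<tau> i * g i (rescale \<tau> i s) = (if i = ?j then 1 / stretch \<tau> i * f i (rescale \<tau> i s) else 0)" for i
      proof (cases "i = ?j")
        case True
        then show ?thesis using j unfolding gi by simp
      next
        case False
        then have "s \<notin> piece \<tau> i" using piece_index_unique[OF tau(1) _ j elim, of i] by blast
        then show ?thesis using False unfolding gi by simp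
      qed
      then show ?thesis using True by (simp add: Let_def)
    next
      case False
      then have "s \<notin> piece \<tau> i" for i using piece_subset[OF tau(1), of i] by blast
      then show ?thesis using False by (simp add: gi)
    qed
  qed
  from has_bochner_integral_cong_AE[THEN iffD1, OF borel_measurable_has_bochner_integral[OF sum] Fm this sum]
  show ?thesis unfolding has_set_integral_bochner .
qed

lemma AE_lborel_pair:
  fixes P :: "real \<Rightarrow> bool"
  assumes "AE s in lborel. P s"
  shows "AE z in lborel. P (fst z) \<and> P (snd z)"
proof -
  from assms obtain N where N: "{s. \<not> P s} \<subseteq> N" "emeasure lborel N = 0" "N \<in> sets lborel"
    by (auto elim: AE_E)
  have sets: "N \<times> (UNIV::real set) \<in> sets (lborel \<Otimes>\<^sub>M lborel)" "(UNIV::real set) \<times> N \<in> sets (lborel \<Otimes>\<^sub>M lborel)"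
    using N(3) by (auto intro!: pair_measureI)
  have "emeasure (lborel \<Otimes>\<^sub>M lborel) (N \<times> (UNIV::real set)) = 0"
    "emeasure (lborel \<Otimes>\<^sub>M lborel) ((UNIV::real set) \<times> N) = 0"
    using N by (simp_all add: lborel.emeasure_pair_measure_Times)
  then have n: "N \<times> (UNIV::real set) \<in> null_sets (lborel \<Otimes>\<^sub>M lborel)" "(UNIV::real set) \<times> N \<in> null_sets (lborel \<Otimes>\<^sub>M lborel)"
    using sets by (auto intro!: null_setsI simp del: sets_lborel)
  have "AE z in (lborel \<Otimes>\<^sub>M lborel). P (fst z) \<and> P (snd z)"
    using AE_not_in[OF n(1)] AE_not_in[OF n(2)]
    by eventually_elim (use N(1) in auto)
  then show ?thesis unfolding lborel_prod .
qed

lemma piecewise_pair_set_integral: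
  fixes \<tau> :: "'k::{finite,linorder} \<Rightarrow> real"
  assumes tau: "strict_mono \<tau>" "\<And>i. 0 < \<tau> i"
    and f: "\<And>i j. has_set_integral ({- \<tau> i..0} \<times> {- \<tau> j..0}) (\<lambda>z. f i j (fst z) (snd z)) (c i j)"
  shows "has_set_integral ({- tau_last \<tau>..0} \<times> {- tau_last \<tau>..0})
    (\<lambda>z. let i = piece_index \<tau> (fst z); j = piece_index \<tau> (snd z) in
        1 / (stretch \<tau> i * stretch \<tau> j) * f i j (rescale \<tau> i (fst z)) (rescale \<tau> j (snd z)))
     (\<Sum>i\<in>UNIV. \<Sum>j\<in>UNIV. c i j)"
    (is "has_set_integral (?I \<times> ?I) ?F _")
proof -
  define g where "g = (\<lambda>i j z. indicator ({- \<tau> i..0} \<times> {- \<tau> j..0}) z * f i j (fst z) (snd z))"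
  define h where "h = (\<lambda>i j z. 1 / (stretch \<tau> i * stretch \<tau> j) * g i j (rescale \<tau> i (fst z), rescale \<tau> j (snd z)))"
  note a = stretch_pos[OF tau]
  have g: "has_bochner_integral lborel (g i j) (c i j)" for i j
    using f[of i j] by (simp add: has_set_integral_bochner g_def)
  have h: "has_bochner_integral lborel (h i j) (c i j)" for i j
  proof -
    have "has_bochner_integral lborel (\<lambda>z. g i j (rescale \<tau> i (fst z), rescale \<tau> j (snd z))) (c i j * (stretch \<tau> i * stretch \<tau> j))"
      using has_bochner_integral_affine_pair[OF g[of i j], of "1 / stretch \<tau> i" "1 / stretch \<tau> j"
         "tau_prev \<tau> i / stretch \<tau> i" "tau_prev \<tau> j / stretch \<tau> j"] a[of i] a[of j]
      by (simp add: rescale_affine)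
    from has_bochner_integral_cmult[OF this, of "1 / (stretch \<tau> i * stretch \<tau> j)"]
    show ?thesis using a[of i] a[of j] by (simp add: h_def)
  qed
  then have hm: "h i j \<in> borel_measurable borel" for i j
    using borel_measurable_has_bochner_integral by fastforce
  have sum: "has_bochner_integral lborel (\<lambda>z. \<Sum>i\<in>UNIV. \<Sum>j\<in>UNIV. h i j z) (\<Sum>i\<in>UNIV. \<Sum>j\<in>UNIV. c i j)"
    by (intro has_bochner_integral_sum h)
  have F: "indicator (?I \<times> ?I) z * ?F z = indicator (?I \<times> ?I) z *
      h (piece_index \<tau> (fst z)) (piece_index \<tau> (snd z)) z" for z
  proof (cases "z \<in> ?I \<times> ?I")
    case True
    then have "rescale \<tau> (piece_index \<tau> (fst z)) (fst z) \<in> {- \<tau> (piece_index \<tau> (fst z))..0}"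
      "rescale \<tau> (piece_index \<tau> (snd z)) (snd z) \<in> {- \<tau> (piece_index \<tau> (snd z))..0}"
      unfolding rescale_in_iff[OF tau] by (auto intro: piece_index_in[OF tau(1)])
    then show ?thesis unfolding g_def h_def Let_def fst_conv snd_conv by simp
  qed simp
  have im: "(\<lambda>z. piece_index \<tau> (fst z)) \<in> measurable (borel :: (real \<times> real) measure) (count_space UNIV)"
    "(\<lambda>z. piece_index \<tau> (snd z)) \<in> measurable (borel :: (real \<times> real) measure) (count_space UNIV)"
    by (rule measurable_compose[OF _ measurable_piece_index];
        intro borel_measurable_continuous_onI continuous_intros)+
  have "(\<lambda>z. h (piece_index \<tau> (fst z)) (piece_index \<tau> (snd z)) z) \<in> borel_measurable borel"
    by (rule measurable_compose_countable[OF _ im(1), where f = "\<lambda>i z. h i (piece_index \<tau> (snd z)) z"])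
       (rule measurable_compose_countable[OF _ im(2), where f = "\<lambda>j z. h i j z" for i], rule hm)
  then have "(\<lambda>z. indicator (?I \<times> ?I) z * h (piece_index \<tau> (fst z)) (piece_index \<tau> (snd z)) z) \<in> borel_measurable borel"
    by (intro borel_measurable_times borel_measurable_indicator) (auto intro!: borel_closed closed_Times)
  then have Fm: "(\<lambda>z. indicator (?I \<times> ?I) z * ?F z) \<in> borel_measurable lborel"
    unfolding F by simp
  have "AE z in lborel. (\<Sum>i\<in>UNIV. \<Sum>j\<in>UNIV. h i j z) = indicator (?I \<times> ?I) z * ?F z"
    using AE_lborel_pair[OF AE_not_breakpoint[of \<tau>]]
  proof eventually_elim
    case (elim z)
    obtain s r where z: "z = (s, r)" by (cases z)
    have br: "s \<notin> range (\<lambda>i. - \<tau> i)" "r \<notin> range (\<lambda>i. - \<tau> i)" using elim z by auto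
    have hi: "h i j z = (if s \<in> piece \<tau> i \<and> r \<in> piece \<tau> j then
        1 / (stretch \<tau> i * stretch \<tau> j) * f i j (rescale \<tau> i s) (rescale \<tau> j r) else 0)" for i j
      unfolding rescale_in_iff[OF tau, symmetric] h_def g_def z fst_conv snd_conv
      by (simp add: indicator_times indicator_def)
    show ?case
    proof (cases "s \<in> ?I \<and> r \<in> ?I")
      case True
      let ?i = "piece_index \<tau> s" let ?j = "piece_index \<tau> r"
      have j: "s \<in> piece \<tau> ?i" "r \<in> piece \<tau> ?j" using piece_index_in[OF tau(1)] True by blast+
      have "h i j z = (if i = ?i then (if j = ?j then h i j z else 0) else 0)" for i j
      proof (cases "i = ?i \<and> j = ?j")
        case False
        then have "\<not> (s \<in> piece \<tau> i \<and> r \<in> piece \<tau> j)"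
          using piece_index_unique[OF tau(1) _ j(1) br(1), of i] piece_index_unique[OF tau(1) _ j(2) br(2), of j]
          by blast
        then have "h i j z = 0" unfolding hi by (rule if_not_P)
        then show ?thesis by auto
      qed simp
      then have "(\<Sum>i\<in>UNIV. \<Sum>j\<in>UNIV. h i j z) = (\<Sum>i\<in>UNIV. \<Sum>j\<in>UNIV. (if i = ?i then (if j = ?j then h i j z else 0) else 0))"
        by (intro sum.cong refl)
      also have "\<dots> = (\<Sum>i\<in>UNIV. (if i = ?i then h i ?j z else 0))"
        by (intro sum.cong refl) auto
      also have "\<dots> = h ?i ?j z" by simp
      finally show ?thesis using True F[of z] by (simp add: z)
    next
      case False
      have "s \<notin> piece \<tau> i \<or> r \<notin> piece \<tau> j" for i j
        using False piece_subset[OF tau(1), of i] piece_subset[OF tau(1), of j] by blast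
      then have "h i j z = 0" for i j by (auto simp: hi)
      then show ?thesis using False by (auto simp: z)
    qed
  qed
  from has_bochner_integral_cong_AE[THEN iffD1, OF borel_measurable_has_bochner_integral[OF sum] Fm this sum]
  show ?thesis unfolding has_set_integral_bochner .
qed

text \<open>The quadratic form $\langle (h,\phi), \mathcal{P}(h,\phi)\rangle$ of the operator with kernels $P, Q_i, S_i, R_{ij}$
on $\mathbb{R}^m \times \prod_i L_2[-\tau_i,0]$, for the inner product that weights the first component by
$\tau_K$.\<close>
definition delay_form ::
  "('k::{finite,linorder} \<Rightarrow> real) \<Rightarrow> real^'m^'m \<Rightarrow> ('k \<Rightarrow> real \<Rightarrow> real^'n^'m) \<Rightarrow>
   ('k \<Rightarrow> real \<Rightarrow> real^'n^'n) \<Rightarrow> ('k \<Rightarrow> 'k \<Rightarrow> real \<Rightarrow> real \<Rightarrow> real^'n^'n) \<Rightarrow>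
   real^'m::finite \<Rightarrow> ('k \<Rightarrow> real \<Rightarrow> real^'n::finite) \<Rightarrow> real" where
  "delay_form \<tau> P Q S R h \<phi> =
     tau_last \<tau> * (h \<bullet> (P *v h)) +
     2 * tau_last \<tau> * (\<Sum>i\<in>UNIV. LINT s:{- \<tau> i..0}|lborel. h \<bullet> (Q i s *v \<phi> i s)) +
     tau_last \<tau> * (\<Sum>i\<in>UNIV. LINT s:{- \<tau> i..0}|lborel. \<phi> i s \<bullet> (S i s *v \<phi> i s)) +
     (\<Sum>i\<in>UNIV. \<Sum>j\<in>UNIV. LINT z:{- \<tau> i..0} \<times> {- \<tau> j..0}|lborel.
        \<phi> i (fst z) \<bullet> (R i j (fst z) (snd z) *v \<phi> j (snd z)))"

text \<open>Juxtaposition of the rescaled $\phi_i$, one on each piece: the substitution behind \<open>L1_map\<close>.\<close>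
definition glue :: "('k::{finite,linorder} \<Rightarrow> real) \<Rightarrow> ('k \<Rightarrow> real \<Rightarrow> 'b) \<Rightarrow> real \<Rightarrow> 'b" where
  "glue \<tau> \<phi> s = \<phi> (piece_index \<tau> s) (rescale \<tau> (piece_index \<tau> s) s)"

lemma borel_measurable_glue:
  assumes "\<And>i. \<phi> i \<in> borel_measurable borel"
  shows "glue \<tau> \<phi> \<in> borel_measurable borel"
  unfolding glue_def[abs_def]
  by (rule borel_measurable_piecewise[where f = "\<lambda>i s. \<phi> i (rescale \<tau> i s)"])
     (rule measurable_compose[OF borel_measurable_rescale assms])

text \<open>The first component of the test function is constant on an interval of length $\tau_K$, hence the weight of
$P$; the factor $\tau_K$ in \<open>L1_map\<close> gives the same weight to the other single integrals.\<close>
lemma L1_form: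
  fixes \<tau> :: "'k::{finite,linorder} \<Rightarrow> real" and P :: "real^'m::finite^'m" and S :: "'k \<Rightarrow> real \<Rightarrow> real^'n::finite^'n"
  assumes tau: "strict_mono \<tau>" "\<And>i. 0 < \<tau> i"
    and L: "(M0, N0) = L1_map \<tau> P Q S R"
    and Q: "\<And>i. set_integrable lborel {- \<tau> i..0} (Q i)"
    and S: "\<And>i. set_integrable lborel {- \<tau> i..0} (S i)"
    and R: "\<And>i j. set_integrable lborel ({- \<tau> i..0} \<times> {- \<tau> j..0}) (\<lambda>(s, \<theta>). R i j s \<theta>)"
    and phi: "\<And>i. \<phi> i \<in> borel_measurable borel" "\<And>i s. norm (\<phi> i s) \<le> c"
  shows "has_form (tau_last \<tau>) M0 (\<lambda>s \<theta>. block_mat 0 0 0 (N0 s \<theta>))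
    (\<lambda>s. join_vec h (glue \<tau> \<phi> s)) (delay_form \<tau> P Q S R h \<phi>)"
proof -
  define T where "T = tau_last \<tau>"
  have T: "0 < T" using tau by (simp add: T_def tau_last_def)
  have M0: "M0 s = (let i = piece_index \<tau> s in block_mat P ((T / stretch \<tau> i) *\<^sub>R Q i (rescale \<tau> i s))
       ((T / stretch \<tau> i) *\<^sub>R transpose (Q i (rescale \<tau> i s))) ((T / stretch \<tau> i) *\<^sub>R S i (rescale \<tau> i s)))" for s
    using L by (simp add: L1_map_def Let_def stretch_def rescale_def T_def)
  have N0: "N0 s \<theta> = (let i = piece_index \<tau> s; j = piece_index \<tau> \<theta> in
      (1 / (stretch \<tau> i * stretch \<tau> j)) *\<^sub>R R i j (rescale \<tau> i s) (rescale \<tau> j \<theta>))" for s \<theta>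
    using L by (simp add: L1_map_def Let_def stretch_def rescale_def)
  define q where "q = (\<lambda>i. LINT s:{- \<tau> i..0}|lborel. h \<bullet> (Q i s *v \<phi> i s))"
  define e where "e = (\<lambda>i. LINT s:{- \<tau> i..0}|lborel. \<phi> i s \<bullet> (S i s *v \<phi> i s))"
  define r where "r = (\<lambda>i j. LINT z:{- \<tau> i..0} \<times> {- \<tau> j..0}|lborel.
        \<phi> i (fst z) \<bullet> (R i j (fst z) (snd z) *v \<phi> j (snd z)))"
  have q: "has_set_integral {- \<tau> i..0} (\<lambda>s. h \<bullet> (Q i s *v \<phi> i s)) (q i)" for i
    unfolding q_def
    by (intro has_set_integralI set_integrable_inner_matrix_vector[OF Q borel_measurable_const order_refl phi])
  have e: "has_set_integral {- \<tau> i..0} (\<lambda>s. \<phi> i s \<bullet> (S i s *v \<phi> i s)) (e i)" for i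
    unfolding e_def
    by (intro has_set_integralI set_integrable_inner_matrix_vector[OF S phi phi])
  have r: "has_set_integral ({- \<tau> i..0} \<times> {- \<tau> j..0}) (\<lambda>z. \<phi> i (fst z) \<bullet> (R i j (fst z) (snd z) *v \<phi> j (snd z))) (r i j)" for i j
    unfolding r_def by (intro has_set_integralI kernel_integrals(1)[OF R phi phi])
  have qe: "has_set_integral {- \<tau> i..0} (\<lambda>s. 2 * T * (h \<bullet> (Q i s *v \<phi> i s)) + T * (\<phi> i s \<bullet> (S i s *v \<phi> i s)))
     (2 * T * q i + T * e i)" for i
    by (intro has_set_integral_add has_set_integral_mult_right q e)
  have p: "has_set_integral {- T..0} (\<lambda>s. h \<bullet> (P *v h)) (T * (h \<bullet> (P *v h)))"
    using has_set_integral_const[of "-T" 0 "h \<bullet> (P *v h)"] T by simp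
  have a: "has_set_integral {- T..0} (\<lambda>s. join_vec h (glue \<tau> \<phi> s) \<bullet> (M0 s *v join_vec h (glue \<tau> \<phi> s)))
    (T * (h \<bullet> (P *v h)) + (\<Sum>i\<in>UNIV. 2 * T * q i + T * e i))"
  proof (rule has_set_integral_cong[OF has_set_integral_add[OF p piecewise_set_integral[OF tau qe, folded T_def]]])
    show "h \<bullet> (P *v h) + (let i = piece_index \<tau> s in 1 / stretch \<tau> i *
        (2 * T * (h \<bullet> (Q i (rescale \<tau> i s) *v \<phi> i (rescale \<tau> i s))) +
          T * (\<phi> i (rescale \<tau> i s) \<bullet> (S i (rescale \<tau> i s) *v \<phi> i (rescale \<tau> i s))))) =
      join_vec h (glue \<tau> \<phi> s) \<bullet> (M0 s *v join_vec h (glue \<tau> \<phi> s))" for s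
      unfolding M0 Let_def inner_block_mat scaleR_matrix_vector_assoc[symmetric] inner_scaleR_right
        inner_transpose_matrix_vector glue_def
      by (simp add: distrib_left)
  qed simp
  have b: "has_set_integral ({- T..0} \<times> {- T..0}) (\<lambda>z. join_vec h (glue \<tau> \<phi> (fst z)) \<bullet>
      (block_mat 0 0 0 (N0 (fst z) (snd z)) *v join_vec h (glue \<tau> \<phi> (snd z)))) (\<Sum>i\<in>UNIV. \<Sum>j\<in>UNIV. r i j)"
  proof (rule has_set_integral_cong)
    show "has_set_integral ({- T..0} \<times> {- T..0}) (\<lambda>z. let i = piece_index \<tau> (fst z); j = piece_index \<tau> (snd z) in
        1 / (stretch \<tau> i * stretch \<tau> j) * (\<phi> i (rescale \<tau> i (fst z)) \<bullet>
          (R i j (rescale \<tau> i (fst z)) (rescale \<tau> j (snd z)) *v \<phi> j (rescale \<tau> j (snd z))))) (\<Sum>i\<in>UNIV. \<Sum>j\<in>UNIV. r i j)"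
      unfolding T_def by (rule piecewise_pair_set_integral[OF tau r])
  qed (simp_all add: N0 Let_def inner_block_mat scaleR_matrix_vector_assoc[symmetric] glue_def)
  have "delay_form \<tau> P Q S R h \<phi> = (T * (h \<bullet> (P *v h)) + (\<Sum>i\<in>UNIV. 2 * T * q i + T * e i)) + (\<Sum>i\<in>UNIV. \<Sum>j\<in>UNIV. r i j)"
    unfolding delay_form_def q_def e_def r_def T_def by (simp add: sum.distrib sum_distrib_left)
  with a b show ?thesis
    unfolding has_form_def T_def[symmetric] by (intro exI conjI)
qed

section \<open>Integration by parts against weak derivatives\<close>

text \<open>Test functions are required to be bounded and Borel on the whole line, but they arise as continuous
functions on an interval; extension by zero connects the two.\<close>
lemma continuous_imp_extension_bounded:
  fixes u :: "real \<Rightarrow> 'b::euclidean_space"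
  assumes "continuous_on {a..b} u"
  shows "(\<lambda>s. indicator {a..b} s *\<^sub>R u s) \<in> borel_measurable borel"
    and "\<exists>c. \<forall>s. norm (indicator {a..b} s *\<^sub>R u s) \<le> c"
proof -
  show "(\<lambda>s. indicator {a..b} s *\<^sub>R u s) \<in> borel_measurable borel"
    by (rule borel_measurable_continuous_on_indicator) (use assms in auto)
  have "compact (u ` {a..b})" by (intro compact_continuous_image assms) simp
  then have "bounded (u ` {a..b})" by (rule compact_imp_bounded)
  then obtain c where c: "0 < c" "\<forall>s\<in>{a..b}. norm (u s) \<le> c"
    unfolding bounded_pos by blast
  then show "\<exists>c. \<forall>s. norm (indicator {a..b} s *\<^sub>R u s) \<le> c"
    by (intro exI[of _ c]) (auto simp: indicator_def)
qed

lemma AC_continuous: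
  fixes K :: "real \<Rightarrow> 'b::euclidean_space"
  assumes int: "set_integrable lborel {a..b} K'"
    and AC: "\<And>t. t \<in> {a..b} \<Longrightarrow> K t = K a + (LINT s:{a..t}|lborel. K' s)"
  shows "continuous_on {a..b} K"
proof -
  have "(LINT s:{a..t}|lborel. K' s) = integral {a..t} K'" if "t \<in> {a..b}" for t
    using that by (intro set_borel_integral_eq_integral set_integrable_subset[OF int]) auto
  then have eq: "K a + integral {a..t} K' = K t" if "t \<in> {a..b}" for t
    using AC[OF that] that by simp
  have "continuous_on {a..b} (\<lambda>t. K a + integral {a..t} K')"
    by (intro continuous_intros indefinite_integral_continuous_1 set_borel_integral_eq_integral int)
  then show ?thesis by (rule continuous_on_eq) (rule eq)
qed

lemma set_integrable_continuous:
  fixes f :: "real \<Rightarrow> 'b::euclidean_space"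
  shows "continuous_on {a..b} f \<Longrightarrow> set_integrable lborel {a..b} f"
  by (rule borel_integrable_atLeastAtMost')

text \<open>Here $K$ is absolutely continuous and differentiable only almost everywhere, with an integrable derivative.
Both sides are evaluations of $\int\int_{r \le s} K'(r) \cdot p'(s)$, in the two orders of integration.\<close>
lemma AC_integral_by_parts:
  fixes K K' p p' :: "real \<Rightarrow> 'b::euclidean_space"
  assumes ab: "a \<le> b"
    and int: "set_integrable lborel {a..b} K'"
    and AC: "\<And>t. t \<in> {a..b} \<Longrightarrow> K t = K a + (LINT s:{a..t}|lborel. K' s)"
    and p: "\<And>s. s \<in> {a..b} \<Longrightarrow> (p has_vector_derivative p' s) (at s within {a..b})"
    and p': "continuous_on {a..b} p'"
  shows "(LINT s:{a..b}|lborel. K s \<bullet> p' s) = K b \<bullet> p b - K a \<bullet> p a - (LINT s:{a..b}|lborel. K' s \<bullet> p s)"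
proof -
  define I where "I = {a..b}"
  have Ib [simp]: "I \<in> sets borel" by (simp add: I_def)
  define k where "k = (\<lambda>r. indicator I r *\<^sub>R K' r)"
  define q where "q = (\<lambda>s. indicator I s *\<^sub>R p' s)"
  have km: "k \<in> borel_measurable borel"
    using int by (auto simp: set_integrable_def k_def I_def dest: borel_measurable_integrable)
  have qm: "q \<in> borel_measurable borel"
    unfolding q_def I_def by (rule continuous_imp_extension_bounded[OF p'])
  obtain c where c: "norm (q s) \<le> c" for s
    using continuous_imp_extension_bounded(2)[OF p'] unfolding q_def I_def by blast
  define F where "F = (\<lambda>s r. indicator {z. snd z \<le> fst z} (s, r) * (K' r \<bullet> p' s))"
  have Fint: "set_integrable lborel (I \<times> I) (\<lambda>(s, r). F s r)"
  proof (rule set_integrable_bound)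
    show "set_integrable lborel (I \<times> I) (\<lambda>z. (\<lambda>_. c) (fst z) * (\<lambda>r. norm (K' r)) (snd z))"
      using int by (intro set_integrable_product set_integrable_norm) (auto simp: I_def intro: set_integrable_continuous)
    have eq: "indicator (I \<times> I) z *\<^sub>R (case z of (s, r) \<Rightarrow> F s r) =
        indicator {z. snd z \<le> fst z} z * (k (snd z) \<bullet> q (fst z))" for z
      by (cases z) (auto simp: F_def k_def q_def indicator_def)
    have "closed {z::real \<times> real. snd z \<le> fst z}"
      by (intro closed_Collect_le continuous_intros)
    then have "(indicator {z::real \<times> real. snd z \<le> fst z} :: real \<times> real \<Rightarrow> real) \<in> borel_measurable borel"
      by (intro borel_measurable_indicator borel_closed)
    moreover have "(\<lambda>z::real \<times> real. k (snd z)) \<in> borel_measurable borel" "(\<lambda>z::real \<times> real. q (fst z)) \<in> borel_measurable borel"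
      by (rule measurable_compose[OF _ km] measurable_compose[OF _ qm];
        intro borel_measurable_continuous_onI continuous_intros)+
    ultimately show "set_borel_measurable lborel (I \<times> I) (\<lambda>(s, r). F s r)"
      unfolding set_borel_measurable_def eq by simp
    have "norm (F s r) \<le> norm (c * norm (K' r))" if "s \<in> I" for s r
    proof -
      have "\<bar>K' r \<bullet> p' s\<bar> \<le> norm (K' r) * norm (p' s)" by (rule Cauchy_Schwarz_ineq2)
      also have "norm (p' s) \<le> c" using c[of s] that by (simp add: q_def)
      finally have "\<bar>K' r \<bullet> p' s\<bar> \<le> norm (K' r) * c" by (simp add: mult_left_mono)
      also have "\<dots> \<le> \<bar>c\<bar> * norm (K' r)" by (metis abs_ge_self mult.commute mult_right_mono norm_ge_zero)
      finally have "\<bar>K' r \<bullet> p' s\<bar> \<le> \<bar>c\<bar> * norm (K' r)" .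
      then show ?thesis by (auto simp: F_def indicator_def abs_mult)
    qed
    then show "AE x in lborel. x \<in> I \<times> I \<longrightarrow> norm (case x of (s, r) \<Rightarrow> F s r) \<le> norm (c * norm (K' (snd x)))"
      by auto
  qed
  note Fub = set_Fubini(1,2)[OF Fint]
  have 1: "(LINT r:I|lborel. F s r) = K s \<bullet> p' s - K a \<bullet> p' s" if "s \<in> I" for s
  proof -
    have i: "set_integrable lborel {a..s} K'"
      using that by (intro set_integrable_subset[OF int]) (auto simp: I_def)
    have "(LINT r:I|lborel. F s r) = (LINT r:{a..s}|lborel. K' r \<bullet> p' s)"
      using that unfolding set_lebesgue_integral_def
      by (intro Bochner_Integration.integral_cong refl) (auto simp: F_def I_def indicator_def)
    also have "\<dots> = (LINT r:{a..s}|lborel. K' r) \<bullet> p' s"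
      using integral_inner_left[of "p' s" lborel "\<lambda>r. indicator {a..s} r *\<^sub>R K' r"] i
      by (simp add: set_lebesgue_integral_def set_integrable_def)
    finally show ?thesis using AC[of s] that by (simp add: I_def inner_add_left)
  qed
  have 2: "(LINT s:I|lborel. F s r) = K' r \<bullet> p b - K' r \<bullet> p r" if "r \<in> I" for r
  proof -
    have i: "set_integrable lborel {r..b} p'"
      using that by (intro set_integrable_continuous continuous_on_subset[OF p']) (auto simp: I_def)
    have "(LINT s:I|lborel. F s r) = (LINT s:{r..b}|lborel. K' r \<bullet> p' s)"
      using that unfolding set_lebesgue_integral_def
      by (intro Bochner_Integration.integral_cong refl) (auto simp: F_def I_def indicator_def)
    also have "\<dots> = K' r \<bullet> (LINT s:{r..b}|lborel. p' s)"
      using integral_inner_right[of "K' r" lborel "\<lambda>s. indicator {r..b} s *\<^sub>R p' s"] i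
      by (simp add: set_lebesgue_integral_def set_integrable_def)
    also have "(LINT s:{r..b}|lborel. p' s) = integral {r..b} p'"
      by (rule set_borel_integral_eq_integral(2)[OF i])
    also have "integral {r..b} p' = p b - p r"
      by (intro integral_unique fundamental_theorem_of_calculus has_vector_derivative_within_subset[OF p])
         (use that in \<open>auto simp: I_def\<close>)
    finally show ?thesis by (simp add: inner_diff_right)
  qed
  have pc: "continuous_on I p"
    unfolding I_def by (rule continuous_on_vector_derivative[OF p])
  have Kc: "continuous_on I K" unfolding I_def by (rule AC_continuous[OF int AC])
  have i1: "set_integrable lborel I (\<lambda>s. K s \<bullet> p' s)" "set_integrable lborel I (\<lambda>s. K a \<bullet> p' s)"
    using Kc p' unfolding I_def by (auto intro!: set_integrable_continuous continuous_intros)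
  have i2: "set_integrable lborel I (\<lambda>r. K' r \<bullet> p b)"
    using int integrable_inner_left[of "p b" lborel "\<lambda>r. indicator I r *\<^sub>R K' r"]
    by (simp add: set_integrable_def I_def)
  have i3: "set_integrable lborel I (\<lambda>r. K' r \<bullet> p r)"
  proof -
    have "set_integrable lborel I (\<lambda>r. K' r \<bullet> p b - (LINT s:I|lborel. F s r))"
      by (intro set_integral_diff i2 set_Fubini(4)[OF Fint])
    moreover have "set_integrable lborel I (\<lambda>r. K' r \<bullet> p b - (LINT s:I|lborel. F s r)) = set_integrable lborel I (\<lambda>r. K' r \<bullet> p r)"
      by (intro set_integrable_cong refl) (simp add: 2)
    ultimately show ?thesis by simp
  qed
  have "(LINT s:I|lborel. K s \<bullet> p' s) - (LINT s:I|lborel. K a \<bullet> p' s) = (LINT s:I|lborel. K s \<bullet> p' s - K a \<bullet> p' s)"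
    by (rule set_integral_diff(2)[OF i1, symmetric])
  also have "\<dots> = (LINT s:I|lborel. (LINT r:I|lborel. F s r))"
    by (intro set_lebesgue_integral_cong) (simp_all add: 1)
  also have "\<dots> = (LINT r:I|lborel. (LINT s:I|lborel. F s r))" using Fub by simp
  also have "\<dots> = (LINT r:I|lborel. K' r \<bullet> p b - K' r \<bullet> p r)"
    by (intro set_lebesgue_integral_cong) (simp_all add: 2)
  also have "\<dots> = (LINT r:I|lborel. K' r \<bullet> p b) - (LINT r:I|lborel. K' r \<bullet> p r)"
    by (rule set_integral_diff(2)[OF i2 i3])
  also have "(LINT r:I|lborel. K' r \<bullet> p b) = (LINT r:I|lborel. K' r) \<bullet> p b"
    using integral_inner_left[of "p b" lborel "\<lambda>r. indicator I r *\<^sub>R K' r"] int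
    by (simp add: set_lebesgue_integral_def set_integrable_def I_def)
  also have "(LINT r:I|lborel. K' r) = K b - K a" using AC[of b] ab by (simp add: I_def)
  finally have *: "(LINT s:I|lborel. K s \<bullet> p' s) =
      (LINT s:I|lborel. K a \<bullet> p' s) + (K b - K a) \<bullet> p b - (LINT r:I|lborel. K' r \<bullet> p r)" by simp
  have "(LINT s:I|lborel. K a \<bullet> p' s) = K a \<bullet> (LINT s:I|lborel. p' s)"
    using integral_inner_right[of "K a" lborel "\<lambda>s. indicator I s *\<^sub>R p' s"] set_integrable_continuous[OF p']
    by (simp add: set_lebesgue_integral_def set_integrable_def I_def)
  also have "(LINT s:I|lborel. p' s) = integral I p'"
    unfolding I_def by (rule set_borel_integral_eq_integral(2)[OF set_integrable_continuous[OF p']])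
  also have "integral I p' = p b - p a"
    unfolding I_def by (intro integral_unique fundamental_theorem_of_calculus p ab)
  finally show ?thesis using * by (simp add: I_def inner_diff_right inner_diff_left)
qed

text \<open>The rank one matrix $u w^T$: pairing it with $M$ turns $u \cdot M w$ into an inner product of matrices, to which
the integration by parts for vector functions applies.\<close>
definition outer :: "real^'a \<Rightarrow> real^'b \<Rightarrow> real^'b^'a" where
  "outer u w = (\<chi> i. u $ i *\<^sub>R w)"

lemma inner_outer: "(M :: real^'b^'a) \<bullet> outer u w = u \<bullet> (M *v w)"
  by (simp add: inner_vec_def outer_def matrix_vector_mult_def sum_distrib_left mult_ac)

lemma bounded_bilinear_outer: "bounded_bilinear (outer :: real^'a \<Rightarrow> real^'b \<Rightarrow> real^'b^'a)"
  unfolding bilinear_conv_bounded_bilinear[symmetric] bilinear_def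
  by (auto intro!: linearI simp: outer_def vec_eq_iff algebra_simps)

lemma kernel_by_parts:
  fixes K :: "real \<Rightarrow> real^'b^'a"
  assumes ab: "a \<le> b"
    and int: "set_integrable lborel {a..b} K'"
    and AC: "\<And>t. t \<in> {a..b} \<Longrightarrow> K t = K a + (LINT s:{a..t}|lborel. K' s)"
    and u: "\<And>s. s \<in> {a..b} \<Longrightarrow> (u has_vector_derivative u' s) (at s within {a..b})" "continuous_on {a..b} u'"
    and w: "\<And>s. s \<in> {a..b} \<Longrightarrow> (w has_vector_derivative w' s) (at s within {a..b})" "continuous_on {a..b} w'"
  shows "(LINT s:{a..b}|lborel. u' s \<bullet> (K s *v w s) + u s \<bullet> (K s *v w' s)) =
     u b \<bullet> (K b *v w b) - u a \<bullet> (K a *v w a) - (LINT s:{a..b}|lborel. u s \<bullet> (K' s *v w s))"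
proof -
  have c: "continuous_on {a..b} u" "continuous_on {a..b} w"
    by (rule continuous_on_vector_derivative[OF u(1)] continuous_on_vector_derivative[OF w(1)]; assumption)+
  have "(LINT s:{a..b}|lborel. K s \<bullet> (outer (u s) (w' s) + outer (u' s) (w s))) =
     K b \<bullet> outer (u b) (w b) - K a \<bullet> outer (u a) (w a) - (LINT s:{a..b}|lborel. K' s \<bullet> outer (u s) (w s))"
  proof (rule AC_integral_by_parts[OF ab int AC])
    show "((\<lambda>s. outer (u s) (w s)) has_vector_derivative outer (u s) (w' s) + outer (u' s) (w s)) (at s within {a..b})"
      if "s \<in> {a..b}" for s
      by (rule bounded_bilinear.has_vector_derivative[OF bounded_bilinear_outer u(1)[OF that] w(1)[OF that]])
    show "continuous_on {a..b} (\<lambda>s. outer (u s) (w' s) + outer (u' s) (w s))"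
      by (intro continuous_intros bounded_bilinear.continuous_on[OF bounded_bilinear_outer] c u w)
  qed
  then show ?thesis by (simp add: inner_add_right inner_outer add.commute)
qed

lemma set_integrable_continuous_Times:
  fixes f :: "real \<times> real \<Rightarrow> 'b::euclidean_space"
  assumes "continuous_on ({a..b} \<times> {c..d}) f"
  shows "set_integrable lborel ({a..b} \<times> {c..d}) f"
  unfolding set_integrable_def by (intro borel_integrable_compact assms compact_Times compact_Icc)

text \<open>For almost every $\theta$ the section $R(\cdot,\theta)$ is absolutely continuous; integrating by
parts there and then integrating over $\theta$ needs the weak derivative in the first variable only.\<close>
lemma kernel_by_parts_fst:
  fixes R :: "real \<Rightarrow> real \<Rightarrow> real^'b^'a"
  assumes ab: "a \<le> b"
    and Rc: "continuous_on ({a..b} \<times> {c..d}) (\<lambda>(s, \<theta>). R s \<theta>)"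
    and int: "set_integrable lborel ({a..b} \<times> {c..d}) (\<lambda>(s, \<theta>). Rs s \<theta>)"
    and AC: "AE \<theta> in lborel. \<theta> \<in> {c..d} \<longrightarrow>
        (\<forall>t\<in>{a..b}. R t \<theta> = R a \<theta> + (LINT s:{a..t}|lborel. Rs s \<theta>))"
    and u: "\<And>s. s \<in> {a..b} \<Longrightarrow> (u has_vector_derivative u' s) (at s within {a..b})" "continuous_on {a..b} u'"
    and w: "continuous_on {c..d} w"
  shows "(LINT z:{a..b} \<times> {c..d}|lborel. u' (fst z) \<bullet> (R (fst z) (snd z) *v w (snd z))) =
     (LINT \<theta>:{c..d}|lborel. u b \<bullet> (R b \<theta> *v w \<theta>)) - (LINT \<theta>:{c..d}|lborel. u a \<bullet> (R a \<theta> *v w \<theta>))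
     - (LINT z:{a..b} \<times> {c..d}|lborel. u (fst z) \<bullet> (Rs (fst z) (snd z) *v w (snd z)))"
proof -
  define I where "I = {a..b}"
  define J where "J = {c..d}"
  have uc: "continuous_on I u" unfolding I_def by (rule continuous_on_vector_derivative[OF u(1)])
  have Rcs: "continuous_on J (\<lambda>\<theta>. R s \<theta>)" if "s \<in> I" for s
    using that by (intro continuous_on_compose2[OF Rc, of J "\<lambda>\<theta>. (s, \<theta>)", simplified])
      (auto simp: I_def J_def intro!: continuous_intros)
  have Rc': "continuous_on (I \<times> J) (\<lambda>z. R (fst z) (snd z))"
    using Rc by (simp add: case_prod_unfold I_def J_def)
  have i0: "set_integrable lborel (I \<times> J) (\<lambda>(s, \<theta>). u' s \<bullet> (R s \<theta> *v w \<theta>))"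
    unfolding I_def J_def case_prod_unfold
    by (intro set_integrable_continuous_Times continuous_intros matrix_vector_continuous Rc'[unfolded I_def J_def]
         continuous_on_compose2[OF u(2), of _ fst] continuous_on_compose2[OF w, of _ snd]) auto
  have ib: "set_integrable lborel J (\<lambda>\<theta>. u s \<bullet> (R s \<theta> *v w \<theta>))" if "s \<in> I" for s
    using Rcs[OF that] w unfolding J_def
    by (intro set_integrable_continuous continuous_intros matrix_vector_continuous)
  obtain cu where cu: "\<And>s. norm (indicator I s *\<^sub>R u s) \<le> cu"
    using continuous_imp_extension_bounded(2)[OF uc[unfolded I_def]] unfolding I_def by blast
  obtain cw where cw: "\<And>s. norm (indicator J s *\<^sub>R w s) \<le> cw"
    using continuous_imp_extension_bounded(2)[OF w] unfolding J_def by blast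
  have "set_integrable lborel (I \<times> J) (\<lambda>z. (indicator I (fst z) *\<^sub>R u (fst z)) \<bullet> (Rs (fst z) (snd z) *v (indicator J (snd z) *\<^sub>R w (snd z))))"
    using continuous_imp_extension_bounded(1)[OF uc[unfolded I_def]] continuous_imp_extension_bounded(1)[OF w] cu cw
    by (intro kernel_integrals(1)[OF int[folded I_def J_def]]) (auto simp: I_def J_def)
  also have "?this = set_integrable lborel (I \<times> J) (\<lambda>(s, \<theta>). u s \<bullet> (Rs s \<theta> *v w \<theta>))"
    by (intro set_integrable_cong refl) auto
  finally have iR: "set_integrable lborel (I \<times> J) (\<lambda>(s, \<theta>). u s \<bullet> (Rs s \<theta> *v w \<theta>))" .
  have inner: "AE \<theta> in lborel. \<theta> \<in> J \<longrightarrow> (LINT s:I|lborel. u' s \<bullet> (R s \<theta> *v w \<theta>)) =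
      u b \<bullet> (R b \<theta> *v w \<theta>) - u a \<bullet> (R a \<theta> *v w \<theta>) - (LINT s:I|lborel. u s \<bullet> (Rs s \<theta> *v w \<theta>))"
    using AC set_Fubini(5)[OF int]
  proof eventually_elim
    case (elim \<theta>)
    show ?case
    proof
      assume J: "\<theta> \<in> J"
      have "(LINT s:{a..b}|lborel. u' s \<bullet> (R s \<theta> *v w \<theta>) + u s \<bullet> (R s \<theta> *v 0)) =
        u b \<bullet> (R b \<theta> *v w \<theta>) - u a \<bullet> (R a \<theta> *v w \<theta>) - (LINT s:{a..b}|lborel. u s \<bullet> (Rs s \<theta> *v w \<theta>))"
      proof (rule kernel_by_parts[OF ab _ _ u, where w = "\<lambda>_. w \<theta>" and w' = "\<lambda>_. 0"])
        show "set_integrable lborel {a..b} (\<lambda>s. Rs s \<theta>)" using elim(2) J unfolding J_def by blast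
        show "R t \<theta> = R a \<theta> + (LINT s:{a..t}|lborel. Rs s \<theta>)" if "t \<in> {a..b}" for t
          using elim(1) J that unfolding J_def by blast
      qed (auto intro: has_vector_derivative_const)
      then show "(LINT s:I|lborel. u' s \<bullet> (R s \<theta> *v w \<theta>)) =
        u b \<bullet> (R b \<theta> *v w \<theta>) - u a \<bullet> (R a \<theta> *v w \<theta>) - (LINT s:I|lborel. u s \<bullet> (Rs s \<theta> *v w \<theta>))"
        by (simp add: I_def)
    qed
  qed
  have bI: "b \<in> I" "a \<in> I" using ab by (auto simp: I_def)
  let ?g = "\<lambda>\<theta>. u b \<bullet> (R b \<theta> *v w \<theta>) - u a \<bullet> (R a \<theta> *v w \<theta>) - (LINT s:I|lborel. u s \<bullet> (Rs s \<theta> *v w \<theta>))"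
  have g: "has_set_integral J ?g ((LINT \<theta>:J|lborel. u b \<bullet> (R b \<theta> *v w \<theta>)) - (LINT \<theta>:J|lborel. u a \<bullet> (R a \<theta> *v w \<theta>))
     - (LINT z:I \<times> J|lborel. u (fst z) \<bullet> (Rs (fst z) (snd z) *v w (snd z))))"
    unfolding has_set_integral_def set_Fubini(2)[OF iR, symmetric]
    using set_Fubini(4)[OF iR] ib[OF bI(1)] ib[OF bI(2)] by (simp add: set_integral_diff)
  have f: "has_set_integral J (\<lambda>\<theta>. LINT s:I|lborel. u' s \<bullet> (R s \<theta> *v w \<theta>))
     (LINT z:I \<times> J|lborel. u' (fst z) \<bullet> (R (fst z) (snd z) *v w (snd z)))"
    unfolding has_set_integral_def using set_Fubini(2,4)[OF i0] by simp
  from has_set_integral_unique_AE[OF f g inner] show ?thesis by (simp add: I_def J_def)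
qed

section \<open>Differentiating the functional in time\<close>

lemma set_integral_swap:
  fixes f :: "'a::euclidean_space \<Rightarrow> 'b::euclidean_space \<Rightarrow> 'c::{banach, second_countable_topology}"
  assumes "set_integrable lborel (A \<times> B) (\<lambda>(x, y). f x y)"
  shows "set_integrable lborel (B \<times> A) (\<lambda>(y, x). f x y)"
    and "(LINT z:B \<times> A|lborel. f (snd z) (fst z)) = (LINT z:A \<times> B|lborel. f (fst z) (snd z))"
proof -
  let ?F = "\<lambda>z. indicator (A \<times> B) z *\<^sub>R (case z of (x, y) \<Rightarrow> f x y)"
  have F: "integrable (lborel \<Otimes>\<^sub>M lborel) ?F"
    using assms unfolding set_integrable_def lborel_prod .
  have eq: "(\<lambda>(x, y). ?F (y, x)) = (\<lambda>z. indicator (B \<times> A) z *\<^sub>R (case z of (y, x) \<Rightarrow> f x y))"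
    by (auto simp: fun_eq_iff indicator_def)
  show "set_integrable lborel (B \<times> A) (\<lambda>(y, x). f x y)"
    using lborel_pair.integrable_product_swap[OF F] unfolding eq set_integrable_def lborel_prod .
  show "(LINT z:B \<times> A|lborel. f (snd z) (fst z)) = (LINT z:A \<times> B|lborel. f (fst z) (snd z))"
    using lborel_pair.integral_product_swap[of ?F] F[THEN borel_measurable_integrable]
    unfolding eq set_lebesgue_integral_def lborel_prod by (simp add: case_prod_unfold)
qed

lemma set_integrable_inner_matrix_vector_continuous:
  fixes K :: "real \<Rightarrow> real^'b^'a"
  assumes "set_integrable lborel {a..b} K" "continuous_on {a..b} u" "continuous_on {a..b} w"
  shows "set_integrable lborel {a..b} (\<lambda>s. u s \<bullet> (K s *v w s))"
proof -
  obtain cu where cu: "\<And>s. norm (indicator {a..b} s *\<^sub>R u s) \<le> cu"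
    using continuous_imp_extension_bounded(2)[OF assms(2)] by blast
  obtain cw where cw: "\<And>s. norm (indicator {a..b} s *\<^sub>R w s) \<le> cw"
    using continuous_imp_extension_bounded(2)[OF assms(3)] by blast
  have "set_integrable lborel {a..b} (\<lambda>s. (indicator {a..b} s *\<^sub>R u s) \<bullet> (K s *v (indicator {a..b} s *\<^sub>R w s)))"
    by (rule set_integrable_inner_matrix_vector[OF assms(1) continuous_imp_extension_bounded(1)[OF assms(2)] cu
         continuous_imp_extension_bounded(1)[OF assms(3)] cw])
  also have "?this = set_integrable lborel {a..b} (\<lambda>s. u s \<bullet> (K s *v w s))"
    by (intro set_integrable_cong refl) auto
  finally show ?thesis .
qed

lemma kernel_integrable_continuous:
  fixes L :: "real \<Rightarrow> real \<Rightarrow> real^'b^'a"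
  assumes "set_integrable lborel ({a..b} \<times> {c..d}) (\<lambda>(s, \<theta>). L s \<theta>)" "continuous_on {a..b} u" "continuous_on {c..d} w"
  shows "set_integrable lborel ({a..b} \<times> {c..d}) (\<lambda>(s, \<theta>). u s \<bullet> (L s \<theta> *v w \<theta>))"
proof -
  obtain cu where cu: "\<And>s. norm (indicator {a..b} s *\<^sub>R u s) \<le> cu"
    using continuous_imp_extension_bounded(2)[OF assms(2)] by blast
  obtain cw where cw: "\<And>s. norm (indicator {c..d} s *\<^sub>R w s) \<le> cw"
    using continuous_imp_extension_bounded(2)[OF assms(3)] by blast
  have "set_integrable lborel ({a..b} \<times> {c..d}) (\<lambda>z. (indicator {a..b} (fst z) *\<^sub>R u (fst z)) \<bullet>
      (L (fst z) (snd z) *v (indicator {c..d} (snd z) *\<^sub>R w (snd z))))"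
    by (rule kernel_integrals(1)[OF assms(1) continuous_imp_extension_bounded(1)[OF assms(2)] cu
         continuous_imp_extension_bounded(1)[OF assms(3)] cw])
  also have "?this = set_integrable lborel ({a..b} \<times> {c..d}) (\<lambda>(s, \<theta>). u s \<bullet> (L s \<theta> *v w \<theta>))"
    by (intro set_integrable_cong refl) auto
  finally show ?thesis .
qed

lemma Leibniz_set_integral:
  fixes f :: "real \<Rightarrow> 'e::euclidean_space \<Rightarrow> real"
  assumes d: "\<And>t s. t \<in> U \<Longrightarrow> s \<in> cbox a b \<Longrightarrow> ((\<lambda>t. f t s) has_real_derivative f' t s) (at t within U)"
    and c: "\<And>t. t \<in> U \<Longrightarrow> continuous_on (cbox a b) (f t)"
    and c': "continuous_on (U \<times> cbox a b) (\<lambda>(t, s). f' t s)"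
    and U: "t0 \<in> U" "convex U"
  shows "((\<lambda>t. LINT s:cbox a b|lborel. f t s) has_real_derivative (LINT s:cbox a b|lborel. f' t0 s)) (at t0 within U)"
proof -
  have L: "(LINT s:cbox a b|lborel. g s) = integral (cbox a b) g" if "continuous_on (cbox a b) g" for g :: "'e \<Rightarrow> real"
    using borel_integrable_compact[OF compact_cbox that]
    by (intro set_borel_integral_eq_integral(2)) (simp only: set_integrable_def)
  have "continuous_on (cbox a b) (f' t0)"
    by (rule continuous_on_compose2[OF c', of _ "\<lambda>s. (t0, s)", simplified]) (auto intro!: continuous_intros U)
  then have e': "(LINT s:cbox a b|lborel. f' t0 s) = integral (cbox a b) (f' t0)" by (rule L)
  have "((\<lambda>t. integral (cbox a b) (f t)) has_real_derivative integral (cbox a b) (f' t0)) (at t0 within U)"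
    by (rule leibniz_rule_field_derivative[OF d integrable_continuous[OF c] c' U])
  then show ?thesis
    unfolding e' by (rule has_field_derivative_transform_within[OF _ zero_less_one U(1)]) (auto simp: L c)
qed

lemma Leibniz_set_integral_Times:
  fixes f :: "real \<Rightarrow> real \<times> real \<Rightarrow> real"
  assumes "\<And>t z. t \<in> U \<Longrightarrow> z \<in> {a..b} \<times> {c..d} \<Longrightarrow> ((\<lambda>t. f t z) has_real_derivative f' t z) (at t within U)"
    and "\<And>t. t \<in> U \<Longrightarrow> continuous_on ({a..b} \<times> {c..d}) (f t)"
    and "continuous_on (U \<times> {a..b} \<times> {c..d}) (\<lambda>(t, z). f' t z)"
    and "t0 \<in> U" "convex U"
  shows "((\<lambda>t. LINT z:{a..b} \<times> {c..d}|lborel. f t z) has_real_derivative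
    (LINT z:{a..b} \<times> {c..d}|lborel. f' t0 z)) (at t0 within U)"
proof -
  have eq: "{a..b} \<times> {c..d} = cbox (a, c) (b, d)" by (simp add: cbox_Pair_eq)
  show ?thesis using assms unfolding eq by (rule Leibniz_set_integral)
qed

lemma inner_matrix_vector_deriv:
  fixes M :: "real^'b^'a"
  assumes "(u has_vector_derivative u') (at t within U)" "(w has_vector_derivative w') (at t within U)"
  shows "((\<lambda>t. u t \<bullet> (M *v w t)) has_real_derivative u' \<bullet> (M *v w t) + u t \<bullet> (M *v w')) (at t within U)"
proof -
  have bl: "bounded_linear ((*v) M)"
    by (rule bounded_bilinear.bounded_linear_right[OF bounded_bilinear_matrix_vector_mult])
  show ?thesis
    unfolding has_real_derivative_iff_has_vector_derivative
    using bounded_bilinear.has_vector_derivative[OF bounded_bilinear_inner assms(1)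
        bounded_linear.has_vector_derivative[OF bl assms(2)]]
    by (simp add: add.commute)
qed

text \<open>The derivative of \<open>delay_form\<close> at $(h,\phi)$ in direction $(h',\phi')$.\<close>
definition delay_form_rate ::
  "('k::{finite,linorder} \<Rightarrow> real) \<Rightarrow> real^'m^'m \<Rightarrow> ('k \<Rightarrow> real \<Rightarrow> real^'n^'m) \<Rightarrow>
   ('k \<Rightarrow> real \<Rightarrow> real^'n^'n) \<Rightarrow> ('k \<Rightarrow> 'k \<Rightarrow> real \<Rightarrow> real \<Rightarrow> real^'n^'n) \<Rightarrow>
   real^'m::finite \<Rightarrow> ('k \<Rightarrow> real \<Rightarrow> real^'n::finite) \<Rightarrow> real^'m::finite \<Rightarrow> ('k \<Rightarrow> real \<Rightarrow> real^'n::finite) \<Rightarrow> real" where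
  "delay_form_rate \<tau> P Q S R h \<phi> h' \<phi>' =
     tau_last \<tau> * (h' \<bullet> (P *v h) + h \<bullet> (P *v h')) +
     2 * tau_last \<tau> * (\<Sum>i\<in>UNIV. LINT s:{- \<tau> i..0}|lborel. h' \<bullet> (Q i s *v \<phi> i s) + h \<bullet> (Q i s *v \<phi>' i s)) +
     tau_last \<tau> * (\<Sum>i\<in>UNIV. LINT s:{- \<tau> i..0}|lborel. \<phi>' i s \<bullet> (S i s *v \<phi> i s) + \<phi> i s \<bullet> (S i s *v \<phi>' i s)) +
     (\<Sum>i\<in>UNIV. \<Sum>j\<in>UNIV. LINT z:{- \<tau> i..0} \<times> {- \<tau> j..0}|lborel.
        \<phi>' i (fst z) \<bullet> (R i j (fst z) (snd z) *v \<phi> j (snd z)) +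
        \<phi> i (fst z) \<bullet> (R i j (fst z) (snd z) *v \<phi>' j (snd z)))"

text \<open>Differentiation under the integral sign. All time dependence is in the smooth argument of the form, so
continuity of the kernels is enough.\<close>
lemma delay_form_has_derivative:
  fixes \<tau> :: "'k::{finite,linorder} \<Rightarrow> real"
  assumes Q: "\<And>i. continuous_on {- \<tau> i..0} (Q i)" and S: "\<And>i. continuous_on {- \<tau> i..0} (S i)"
    and R: "\<And>i j. continuous_on ({- \<tau> i..0} \<times> {- \<tau> j..0}) (\<lambda>(s, \<theta>). R i j s \<theta>)"
    and x: "\<And>t. t \<in> U \<Longrightarrow> (x has_vector_derivative x' t) (at t within U)" "continuous_on U x'"
    and f: "\<And>i t s. t \<in> U \<Longrightarrow> s \<in> {- \<tau> i..0} \<Longrightarrow> ((\<lambda>t. f i t s) has_vector_derivative f' i t s) (at t within U)"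
    and fc: "\<And>i. continuous_on (U \<times> {- \<tau> i..0}) (\<lambda>(t, s). f i t s)"
    and fc': "\<And>i. continuous_on (U \<times> {- \<tau> i..0}) (\<lambda>(t, s). f' i t s)"
    and U: "t0 \<in> U" "convex U"
  shows "((\<lambda>t. delay_form \<tau> P Q S R (x t) (\<lambda>i. f i t)) has_real_derivative
      delay_form_rate \<tau> P Q S R (x t0) (\<lambda>i. f i t0) (x' t0) (\<lambda>i. f' i t0)) (at t0 within U)"
proof -
  have xc: "continuous_on U x" by (rule continuous_on_vector_derivative[OF x(1)])
  have fct: "continuous_on {- \<tau> i..0} (f i t)" if "t \<in> U" for i t
    by (rule continuous_on_compose2[OF fc, of _ "\<lambda>s. (t, s)", simplified]) (auto intro!: continuous_intros that)
  have fct': "continuous_on {- \<tau> i..0} (f' i t)" if "t \<in> U" for i t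
    by (rule continuous_on_compose2[OF fc', of _ "\<lambda>s. (t, s)", simplified]) (auto intro!: continuous_intros that)
  have xp: "continuous_on (U \<times> X) (\<lambda>p. x (fst p))" "continuous_on (U \<times> X) (\<lambda>p. x' (fst p))" for X :: "'z::topological_space set"
    by (rule continuous_on_compose2[OF xc] continuous_on_compose2[OF x(2)]; auto intro!: continuous_intros)+
  have fp: "continuous_on (U \<times> {- \<tau> i..0}) (\<lambda>p. f i (fst p) (snd p))" "continuous_on (U \<times> {- \<tau> i..0}) (\<lambda>p. f' i (fst p) (snd p))" for i
    using fc[of i] fc'[of i] by (simp_all add: case_prod_unfold)
  have Qp: "continuous_on (U \<times> {- \<tau> i..0}) (\<lambda>p. Q i (snd p))" "continuous_on (U \<times> {- \<tau> i..0}) (\<lambda>p. S i (snd p))" for i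
    by (rule continuous_on_compose2[OF Q] continuous_on_compose2[OF S]; auto intro!: continuous_intros)+
  have 1: "((\<lambda>t. x t \<bullet> (P *v x t)) has_real_derivative x' t0 \<bullet> (P *v x t0) + x t0 \<bullet> (P *v x' t0)) (at t0 within U)"
    by (intro inner_matrix_vector_deriv x U)
  have 2: "((\<lambda>t. LINT s:{- \<tau> i..0}|lborel. x t \<bullet> (Q i s *v f i t s)) has_real_derivative
     (LINT s:{- \<tau> i..0}|lborel. x' t0 \<bullet> (Q i s *v f i t0 s) + x t0 \<bullet> (Q i s *v f' i t0 s))) (at t0 within U)" for i
  proof (rule Leibniz_set_integral[of U "- \<tau> i" 0, unfolded cbox_interval, where f' = "\<lambda>t s. x' t \<bullet> (Q i s *v f i t s) + x t \<bullet> (Q i s *v f' i t s)"])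
    show "continuous_on {- \<tau> i..0} (\<lambda>s. x t \<bullet> (Q i s *v f i t s))" if "t \<in> U" for t
      by (intro continuous_intros matrix_vector_continuous Q fct that)
    show "continuous_on (U \<times> {- \<tau> i..0}) (\<lambda>(t, s). x' t \<bullet> (Q i s *v f i t s) + x t \<bullet> (Q i s *v f' i t s))"
      unfolding case_prod_unfold by (intro continuous_intros matrix_vector_continuous xp fp Qp)
  qed (intro inner_matrix_vector_deriv x f U; assumption)+
  have 3: "((\<lambda>t. LINT s:{- \<tau> i..0}|lborel. f i t s \<bullet> (S i s *v f i t s)) has_real_derivative
     (LINT s:{- \<tau> i..0}|lborel. f' i t0 s \<bullet> (S i s *v f i t0 s) + f i t0 s \<bullet> (S i s *v f' i t0 s))) (at t0 within U)" for i
  proof (rule Leibniz_set_integral[of U "- \<tau> i" 0, unfolded cbox_interval, where f' = "\<lambda>t s. f' i t s \<bullet> (S i s *v f i t s) + f i t s \<bullet> (S i s *v f' i t s)"])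
    show "continuous_on {- \<tau> i..0} (\<lambda>s. f i t s \<bullet> (S i s *v f i t s))" if "t \<in> U" for t
      by (intro continuous_intros matrix_vector_continuous S fct that)
    show "continuous_on (U \<times> {- \<tau> i..0}) (\<lambda>(t, s). f' i t s \<bullet> (S i s *v f i t s) + f i t s \<bullet> (S i s *v f' i t s))"
      unfolding case_prod_unfold by (intro continuous_intros matrix_vector_continuous xp fp Qp)
  qed (intro inner_matrix_vector_deriv x f U; assumption)+
  have 4: "((\<lambda>t. LINT z:{- \<tau> i..0} \<times> {- \<tau> j..0}|lborel. f i t (fst z) \<bullet> (R i j (fst z) (snd z) *v f j t (snd z))) has_real_derivative
     (LINT z:{- \<tau> i..0} \<times> {- \<tau> j..0}|lborel. f' i t0 (fst z) \<bullet> (R i j (fst z) (snd z) *v f j t0 (snd z)) +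
        f i t0 (fst z) \<bullet> (R i j (fst z) (snd z) *v f' j t0 (snd z)))) (at t0 within U)" for i j
  proof (rule Leibniz_set_integral_Times[where f' = "\<lambda>t z. f' i t (fst z) \<bullet> (R i j (fst z) (snd z) *v f j t (snd z)) +
        f i t (fst z) \<bullet> (R i j (fst z) (snd z) *v f' j t (snd z))"])
    have Rc: "continuous_on ({- \<tau> i..0} \<times> {- \<tau> j..0}) (\<lambda>z. R i j (fst z) (snd z))"
      using R[of i j] by (simp add: case_prod_unfold)
    have sel: "continuous_on X (\<lambda>z. g (fst z))" if "continuous_on {- \<tau> i..0} g" "fst ` X \<subseteq> {- \<tau> i..0}" for X :: "(real \<times> real) set" and g :: "real \<Rightarrow> real^'c" and i
      by (rule continuous_on_compose2[OF that(1)]) (use that(2) in \<open>auto intro!: continuous_intros\<close>)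
    have sel2: "continuous_on X (\<lambda>z. g (snd z))" if "continuous_on {- \<tau> i..0} g" "snd ` X \<subseteq> {- \<tau> i..0}" for X :: "(real \<times> real) set" and g :: "real \<Rightarrow> real^'c" and i
      by (rule continuous_on_compose2[OF that(1)]) (use that(2) in \<open>auto intro!: continuous_intros\<close>)
    show "continuous_on ({- \<tau> i..0} \<times> {- \<tau> j..0}) (\<lambda>z. f i t (fst z) \<bullet> (R i j (fst z) (snd z) *v f j t (snd z)))" if "t \<in> U" for t
      by (intro continuous_on_inner matrix_vector_continuous Rc sel[OF fct[OF that, of i]] sel2[OF fct[OF that, of j]]) auto
    have p1: "continuous_on (U \<times> {- \<tau> i..0} \<times> {- \<tau> j..0}) (\<lambda>p. R i j (fst (snd p)) (snd (snd p)))"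
      by (rule continuous_on_compose2[OF Rc]) (auto intro!: continuous_intros)
    have p2: "continuous_on (U \<times> {- \<tau> i..0} \<times> {- \<tau> j..0}) (\<lambda>p. f i (fst p) (fst (snd p)))"
        "continuous_on (U \<times> {- \<tau> i..0} \<times> {- \<tau> j..0}) (\<lambda>p. f' i (fst p) (fst (snd p)))"
      by (rule continuous_on_compose2[OF fp(1), of _ "\<lambda>p. (fst p, fst (snd p))" i, simplified]
               continuous_on_compose2[OF fp(2), of _ "\<lambda>p. (fst p, fst (snd p))" i, simplified];
          auto intro!: continuous_intros)+
    have p3: "continuous_on (U \<times> {- \<tau> i..0} \<times> {- \<tau> j..0}) (\<lambda>p. f j (fst p) (snd (snd p)))"
        "continuous_on (U \<times> {- \<tau> i..0} \<times> {- \<tau> j..0}) (\<lambda>p. f' j (fst p) (snd (snd p)))"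
      by (rule continuous_on_compose2[OF fp(1), of _ "\<lambda>p. (fst p, snd (snd p))" j, simplified]
               continuous_on_compose2[OF fp(2), of _ "\<lambda>p. (fst p, snd (snd p))" j, simplified];
          auto intro!: continuous_intros)+
    show "continuous_on (U \<times> {- \<tau> i..0} \<times> {- \<tau> j..0}) (\<lambda>(t, z). f' i t (fst z) \<bullet> (R i j (fst z) (snd z) *v f j t (snd z)) +
        f i t (fst z) \<bullet> (R i j (fst z) (snd z) *v f' j t (snd z)))"
      unfolding case_prod_unfold
      by (intro continuous_on_add continuous_on_inner matrix_vector_continuous p1 p2 p3)
    show "((\<lambda>t. f i t (fst z) \<bullet> (R i j (fst z) (snd z) *v f j t (snd z))) has_real_derivative
        f' i t (fst z) \<bullet> (R i j (fst z) (snd z) *v f j t (snd z)) +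
        f i t (fst z) \<bullet> (R i j (fst z) (snd z) *v f' j t (snd z))) (at t within U)"
      if "t \<in> U" "z \<in> {- \<tau> i..0} \<times> {- \<tau> j..0}" for t z
      using that by (intro inner_matrix_vector_deriv f) auto
  qed (use U in auto)
  show ?thesis
    unfolding delay_form_def delay_form_rate_def
    by (intro DERIV_add DERIV_cmult DERIV_sum 1 2 3 4)
qed

section \<open>The rate of change along the transposed system\<close>

lemma tau_last_pos:
  fixes \<tau> :: "'k::{finite,linorder} \<Rightarrow> real"
  shows "(\<And>i. 0 < \<tau> i) \<Longrightarrow> 0 < tau_last \<tau>"
  by (simp add: tau_last_def)

lemma inner_matrix_mult: "a \<bullet> ((A ** B) *v b) = (transpose A *v a) \<bullet> (B *v b)"
  for A :: "real^'n^'m"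
  by (metis dot_lmul_matrix matrix_vector_mul_assoc transpose_matrix_vector)

text \<open>The regularity, the symmetry and the compatibility conditions of the theorem. The matrices \<open>C0\<close>, \<open>C\<close>, \<open>B\<close> and \<open>G\<close>
are the entries of \<open>D1\<close>, \<open>V\<close> and the last argument of the second \<open>L1_map\<close>, without the terms in $\epsilon$.\<close>
locale dual_functional =
  fixes \<tau> :: "'k::{finite,linorder} \<Rightarrow> real"
    and A0 P C0 :: "real^'n::finite^'n"
    and A C :: "'k \<Rightarrow> real^'n^'n"
    and T :: real
    and Q Q' S S' B :: "'k \<Rightarrow> real \<Rightarrow> real^'n^'n"
    and R Rs G :: "'k \<Rightarrow> 'k \<Rightarrow> real \<Rightarrow> real \<Rightarrow> real^'n^'n"
  assumes delays: "strict_mono \<tau>" "\<And>i. 0 < \<tau> i"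
    and T: "T = tau_last \<tau>"
    and Q'_int: "\<And>i. set_integrable lborel {- \<tau> i..0} (Q' i)"
    and Q_AC: "\<And>i t. t \<in> {- \<tau> i..0} \<Longrightarrow> Q i t = Q i (- \<tau> i) + (LINT s:{- \<tau> i..t}|lborel. Q' i s)"
    and S'_int: "\<And>i. set_integrable lborel {- \<tau> i..0} (S' i)"
    and S_AC: "\<And>i t. t \<in> {- \<tau> i..0} \<Longrightarrow> S i t = S i (- \<tau> i) + (LINT s:{- \<tau> i..t}|lborel. S' i s)"
    and R_cont: "\<And>i j. continuous_on ({- \<tau> i..0} \<times> {- \<tau> j..0}) (\<lambda>(s, \<theta>). R i j s \<theta>)"
    and Rs_int: "\<And>i j. set_integrable lborel ({- \<tau> i..0} \<times> {- \<tau> j..0}) (\<lambda>(s, \<theta>). Rs i j s \<theta>)"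
    and R_AC: "\<And>i j. AE \<theta> in lborel. \<theta> \<in> {- \<tau> j..0} \<longrightarrow>
        (\<forall>t\<in>{- \<tau> i..0}. R i j t \<theta> = R i j (- \<tau> i) \<theta> + (LINT s:{- \<tau> i..t}|lborel. Rs i j s \<theta>))"
    and C0: "C0 = A0 ** P +
          (\<Sum>i\<in>UNIV. T *\<^sub>R (A i ** transpose (Q i (- \<tau> i))) + (1/2) *\<^sub>R S i 0)"
    and C: "\<And>i. C i = T *\<^sub>R (A i ** S i (- \<tau> i))"
    and B: "\<And>i s. B i s = A0 ** Q i s + Q' i s + (\<Sum>j\<in>UNIV. A j ** R j i (- \<tau> j) s)"
    and G: "\<And>i j s \<theta>. G i j s \<theta> = Rs i j s \<theta> + transpose (Rs j i \<theta> s)"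
    and P_eq: "\<And>i. P = T *\<^sub>R transpose (Q i 0) + T *\<^sub>R S i 0"
    and S_sym: "\<And>i s. s \<in> {- \<tau> i..0} \<Longrightarrow> S i s = transpose (S i s)"
    and R_sym: "\<And>i j s \<theta>. s \<in> {- \<tau> i..0} \<Longrightarrow> \<theta> \<in> {- \<tau> j..0} \<Longrightarrow>
          R i j s \<theta> = transpose (R j i \<theta> s)"
    and QR: "\<And>i j s. s \<in> {- \<tau> j..0} \<Longrightarrow> Q j s = R i j 0 s"
begin

lemma T_pos: "0 < T"
  using tau_last_pos[of \<tau>] delays T by simp

lemma tau_le_T: "\<tau> i \<le> T"
  using tau_le_last delays T by simp

lemma tau_nonneg: "0 \<le> \<tau> i" by (rule less_imp_le[OF delays(2)])

lemma Q_cont: "continuous_on {- \<tau> i..0} (Q i)"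
  by (rule AC_continuous[OF Q'_int Q_AC])

lemma S_cont: "continuous_on {- \<tau> i..0} (S i)"
  by (rule AC_continuous[OF S'_int S_AC])

lemma R_cont_snd:
  assumes "s \<in> {- \<tau> i..0}"
  shows "continuous_on {- \<tau> j..0} (R i j s)"
  using assms by (intro continuous_on_compose2[OF R_cont, of "{- \<tau> j..0}" "\<lambda>\<theta>. (s, \<theta>)" i j, simplified])
    (auto intro!: continuous_intros)

lemma inner_S_commute: "s \<in> {- \<tau> i..0} \<Longrightarrow> a \<bullet> (S i s *v b) = b \<bullet> (S i s *v a)"
  using S_sym[of s i] inner_transpose_matrix_vector[of a "S i s" b] by simp

text \<open>$P = \tau_K Q_i(0)^T + \tau_K S_i(0)$ is symmetric, because $Q_i(0) = R_{ii}(0,0)$ is.\<close>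
lemma inner_P_commute: "a \<bullet> (P *v b) = b \<bullet> (P *v a)"
proof -
  have "Q i 0 = transpose (Q i 0)" for i
    using QR[of 0 i i] R_sym[of 0 i 0 i] tau_nonneg[of i] by simp
  then have "transpose P = P"
    using P_eq[of undefined] S_sym[of 0 undefined] tau_nonneg[of undefined]
    by (metis (no_types, lifting) atLeastAtMost_iff neg_le_0_iff_le order_refl
        transpose_scalar linear_add[OF bounded_linear.linear[OF bounded_linear_transpose]])
  then show ?thesis using inner_transpose_matrix_vector[of a P b] by simp
qed

text \<open>The form built from the data of the second \<open>L1_map\<close>, at $((x,v),\phi)$ and without the terms in
$\epsilon$.\<close>
definition dissipation :: "real^'n \<Rightarrow> ('k \<Rightarrow> real^'n) \<Rightarrow> ('k \<Rightarrow> real \<Rightarrow> real^'n) \<Rightarrow> real" where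
  "dissipation x v \<phi> =
      T * (2 * (x \<bullet> (C0 *v x)) +
         (\<Sum>i\<in>UNIV. 2 * (x \<bullet> (C i *v v i)) - v i \<bullet> (S i (- \<tau> i) *v v i))) +
      2 * T * (\<Sum>i\<in>UNIV. LINT s:{- \<tau> i..0}|lborel. x \<bullet> (B i s *v \<phi> i s)) +
      T * (\<Sum>i\<in>UNIV. LINT s:{- \<tau> i..0}|lborel. \<phi> i s \<bullet> (S' i s *v \<phi> i s)) +
      (\<Sum>i\<in>UNIV. \<Sum>j\<in>UNIV. LINT z:{- \<tau> i..0} \<times> {- \<tau> j..0}|lborel.
        \<phi> i (fst z) \<bullet> (G i j (fst z) (snd z) *v \<phi> j (snd z)))"

text \<open>The identity on which the theorem rests. Here $\psi$ is the time derivative of $\phi$, which is transported to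
the right, so $\psi = -\phi'$; the last two assumptions are the boundary condition at $-\tau_i$ and the
transposed delay equation. Integration by parts moves the derivative from $\phi$ to the kernels. The boundary terms at
$-\tau_i$ produce the $A_i$ in $C_0$, $C_i$ and $B_i$, because $\phi_i(-\tau_i) = \tau_K A_i^T x$. At $0$ the transposed
system does not have $\phi_i(0) = x$; by $Q_j = R_{ij}(0,\cdot)$ and the formula for $P$ the terms there reduce to half
of $S_i(0)$ in $C_0$ and the square of $\phi_i(0) - x$ weighted by $S_i(0)$.\<close>
lemma rate_eq:
  fixes x x' :: "real^'n" and \<phi> \<psi> :: "'k \<Rightarrow> real \<Rightarrow> real^'n"
  assumes phi: "\<And>i s. s \<in> {- \<tau> i..0} \<Longrightarrow> (\<phi> i has_vector_derivative - \<psi> i s) (at s within {- \<tau> i..0})"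
    and psi: "\<And>i. continuous_on {- \<tau> i..0} (\<psi> i)"
    and bc: "\<And>i. \<phi> i (- \<tau> i) = T *\<^sub>R (transpose (A i) *v x)"
    and x': "x' = transpose A0 *v x + (1 / T) *\<^sub>R (\<Sum>i\<in>UNIV. \<phi> i 0)"
  shows "delay_form_rate \<tau> P Q S R x \<phi> x' \<psi> =
      dissipation x (\<lambda>i. \<phi> i (- \<tau> i)) \<phi> -
      T * (\<Sum>i\<in>UNIV. (\<phi> i 0 - x) \<bullet> (S i 0 *v (\<phi> i 0 - x)))"
proof -
  define J where "J = (\<lambda>i. {- \<tau> i..0})"
  define p where "p = (\<lambda>i. \<phi> i 0)"
  define v where "v = (\<lambda>i. \<phi> i (- \<tau> i))"
  have J: "0 \<in> J i" "- \<tau> i \<in> J i" for i using tau_nonneg by (auto simp: J_def)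
  have phic: "continuous_on (J i) (\<phi> i)" for i
    unfolding J_def by (rule continuous_on_vector_derivative[OF phi])
  have npsi: "continuous_on {- \<tau> i..0} (\<lambda>s. - \<psi> i s)" for i by (intro continuous_intros psi)
  have const: "continuous_on (J i) (\<lambda>_. c)" for c :: "real^'n" and i by (intro continuous_intros)
  define a0 where "a0 = (\<lambda>i. LINT s:J i|lborel. (transpose A0 *v x) \<bullet> (Q i s *v \<phi> i s))"
  define aq where "aq = (\<lambda>j i. LINT s:J i|lborel. p j \<bullet> (Q i s *v \<phi> i s))"
  define qd where "qd = (\<lambda>i. LINT s:J i|lborel. x \<bullet> (Q' i s *v \<phi> i s))"
  define sd where "sd = (\<lambda>i. LINT s:J i|lborel. \<phi> i s \<bullet> (S' i s *v \<phi> i s))"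
  define r where "r = (\<lambda>i j. LINT s:J j|lborel. v i \<bullet> (R i j (- \<tau> i) s *v \<phi> j s))"
  define g where "g = (\<lambda>i j. LINT z:J i \<times> J j|lborel. \<phi> i (fst z) \<bullet> (Rs i j (fst z) (snd z) *v \<phi> j (snd z)))"
  define e0 where "e0 = (transpose A0 *v x) \<bullet> (P *v x)"
  define qp where "qp = (\<lambda>i. x \<bullet> (Q i 0 *v p i))"
  define qv where "qv = (\<lambda>i. x \<bullet> (Q i (- \<tau> i) *v v i))"
  define sp where "sp = (\<lambda>i. p i \<bullet> (S i 0 *v p i))"
  define sx where "sx = (\<lambda>i. p i \<bullet> (S i 0 *v x))"
  define sv where "sv = (\<lambda>i. v i \<bullet> (S i (- \<tau> i) *v v i))"
  define xx where "xx = (\<lambda>i. x \<bullet> (S i 0 *v x))"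
  have iQ: "set_integrable lborel (J i) (\<lambda>s. c \<bullet> (Q i s *v \<phi> i s))" for c i
    using Q_cont[of i] phic[of i] unfolding J_def
    by (intro set_integrable_continuous continuous_intros matrix_vector_continuous)
  have iQ': "set_integrable lborel (J i) (\<lambda>s. c \<bullet> (Q' i s *v \<phi> i s))" for c i
    unfolding J_def by (intro set_integrable_inner_matrix_vector_continuous Q'_int const[of i, unfolded J_def] phic[unfolded J_def])
  have iR: "set_integrable lborel (J j) (\<lambda>s. c \<bullet> (R i j (- \<tau> i) s *v \<phi> j s))" for c i j
    using R_cont_snd[OF J(2)[of i, unfolded J_def], of j] phic[of j] unfolding J_def
    by (intro set_integrable_continuous continuous_intros matrix_vector_continuous)
  have E1: "x' \<bullet> (P *v x) = e0 + (\<Sum>i\<in>UNIV. qp i + sx i)"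
  proof -
    have "p i \<bullet> (P *v x) = T * (qp i + sx i)" for i
      using P_eq[of i] inner_transpose_matrix_vector[of "p i" "Q i 0" x]
      by (simp add: matrix_vector_mult_add_rdistrib scaleR_matrix_vector_assoc[symmetric]
          inner_add_right qp_def sx_def distrib_left)
    then have "(\<Sum>i\<in>UNIV. p i \<bullet> (P *v x)) = T * (\<Sum>i\<in>UNIV. qp i + sx i)"
      by (simp only: sum_distrib_left)
    moreover have "x' \<bullet> (P *v x) = e0 + 1 / T * (\<Sum>i\<in>UNIV. p i \<bullet> (P *v x))"
      by (simp add: x' inner_add_left inner_sum_left e0_def p_def)
    ultimately show ?thesis using T_pos by simp
  qed
  \<comment> \<open>E2, E3 and E4 are the rates of the terms with Q, S and R after integration by parts; E5 to E8 expand the dissipation in the same quantities.\<close>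
  have E2: "(LINT s:J i|lborel. x' \<bullet> (Q i s *v \<phi> i s) + x \<bullet> (Q i s *v \<psi> i s)) =
      a0 i + 1 / T * (\<Sum>j\<in>UNIV. aq j i) - qp i + qv i + qd i" for i
  proof -
    have "(LINT s:J i|lborel. 0 \<bullet> (Q i s *v \<phi> i s) + x \<bullet> (Q i s *v (- \<psi> i s))) = qp i - qv i - qd i"
      unfolding J_def qp_def qv_def qd_def p_def v_def
      by (rule kernel_by_parts[OF _ Q'_int Q_AC, where u = "\<lambda>_. x" and u' = "\<lambda>_. 0" and w = "\<phi> i" and w' = "\<lambda>s. - \<psi> i s"])
         (auto intro: phi npsi has_vector_derivative_const tau_nonneg continuous_on_const)
    then have 1: "(LINT s:J i|lborel. x \<bullet> (Q i s *v \<psi> i s)) = - qp i + qv i + qd i"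
      by (simp add: matrix_vector_minus set_lebesgue_integral_def)
    have "has_set_integral (J i) (\<lambda>s. (transpose A0 *v x) \<bullet> (Q i s *v \<phi> i s) + 1 / T * (\<Sum>j\<in>UNIV. p j \<bullet> (Q i s *v \<phi> i s)))
       (a0 i + 1 / T * (\<Sum>j\<in>UNIV. aq j i))"
      unfolding a0_def aq_def
      by (intro has_set_integral_add has_set_integral_mult_right has_set_integral_sum has_set_integralI iQ)
    then have 2: "has_set_integral (J i) (\<lambda>s. x' \<bullet> (Q i s *v \<phi> i s)) (a0 i + 1 / T * (\<Sum>j\<in>UNIV. aq j i))"
      by (rule has_set_integral_cong) (simp_all add: x' inner_add_left inner_sum_left p_def)
    have 3: "set_integrable lborel (J i) (\<lambda>s. x \<bullet> (Q i s *v \<psi> i s))"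
      using Q_cont[of i] psi[of i] unfolding J_def
      by (intro set_integrable_continuous continuous_intros matrix_vector_continuous)
    show ?thesis
      using has_set_integral_add[OF 2 has_set_integralI[OF 3]] 1 by (simp add: has_set_integral_def)
  qed
  have E3: "(LINT s:J i|lborel. \<psi> i s \<bullet> (S i s *v \<phi> i s) + \<phi> i s \<bullet> (S i s *v \<psi> i s)) = - sp i + sv i + sd i" for i
  proof -
    have "(LINT s:J i|lborel. (- \<psi> i s) \<bullet> (S i s *v \<phi> i s) + \<phi> i s \<bullet> (S i s *v (- \<psi> i s))) = sp i - sv i - sd i"
      unfolding J_def sp_def sv_def sd_def p_def v_def
      by (rule kernel_by_parts[OF _ S'_int S_AC, where u = "\<phi> i" and u' = "\<lambda>s. - \<psi> i s" and w = "\<phi> i" and w' = "\<lambda>s. - \<psi> i s"])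
         (auto intro: phi npsi tau_nonneg)
    also have "(\<lambda>s. (- \<psi> i s) \<bullet> (S i s *v \<phi> i s) + \<phi> i s \<bullet> (S i s *v (- \<psi> i s))) =
        (\<lambda>s. - 1 * (\<psi> i s \<bullet> (S i s *v \<phi> i s) + \<phi> i s \<bullet> (S i s *v \<psi> i s)))"
      by (simp add: matrix_vector_minus fun_eq_iff)
    finally show ?thesis unfolding set_integral_mult_right by linarith
  qed
  have iK: "set_integrable lborel (J i \<times> J j) (\<lambda>z. \<psi> i (fst z) \<bullet> (R i j (fst z) (snd z) *v \<phi> j (snd z)))" 
           "set_integrable lborel (J i \<times> J j) (\<lambda>z. \<phi> i (fst z) \<bullet> (R i j (fst z) (snd z) *v \<psi> j (snd z)))" for i j
    using kernel_integrable_continuous[OF set_integrable_continuous_Times[OF R_cont[of i j]] psi[of i] phic[of j, unfolded J_def]]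
      kernel_integrable_continuous[OF set_integrable_continuous_Times[OF R_cont[of i j]] phic[of i, unfolded J_def] psi[of j]]
    by (simp_all add: case_prod_unfold J_def)
  have j3: "(LINT z:J i \<times> J j|lborel. \<psi> i (fst z) \<bullet> (R i j (fst z) (snd z) *v \<phi> j (snd z))) = - aq i j + r i j + g i j" for i j
  proof -
    have "(LINT z:J i \<times> J j|lborel. (- \<psi> i (fst z)) \<bullet> (R i j (fst z) (snd z) *v \<phi> j (snd z))) =
       (LINT \<theta>:J j|lborel. p i \<bullet> (R i j 0 \<theta> *v \<phi> j \<theta>)) - r i j - g i j"
      unfolding J_def r_def g_def p_def v_def
      by (rule kernel_by_parts_fst[OF _ R_cont Rs_int R_AC phi npsi phic[unfolded J_def]]) (rule neg_le_0_iff_le[THEN iffD2, OF tau_nonneg])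
    also have "(LINT \<theta>:J j|lborel. p i \<bullet> (R i j 0 \<theta> *v \<phi> j \<theta>)) = aq i j"
      unfolding aq_def by (rule set_lebesgue_integral_cong) (auto simp: J_def QR[of _ j i])
    finally show ?thesis
      using set_integral_uminus[OF iK(1)[of i j]] by simp
  qed
  have E4: "(LINT z:J i \<times> J j|lborel. \<psi> i (fst z) \<bullet> (R i j (fst z) (snd z) *v \<phi> j (snd z)) +
        \<phi> i (fst z) \<bullet> (R i j (fst z) (snd z) *v \<psi> j (snd z))) =
      (- aq i j + r i j + g i j) + (- aq j i + r j i + g j i)" for i j
  proof -
    have "(LINT z:J i \<times> J j|lborel. \<phi> i (fst z) \<bullet> (R i j (fst z) (snd z) *v \<psi> j (snd z))) =
       (LINT z:J i \<times> J j|lborel. \<psi> j (snd z) \<bullet> (R j i (snd z) (fst z) *v \<phi> i (fst z)))"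
    proof (rule set_lebesgue_integral_cong, simp add: J_def borel_closed closed_Times, safe)
      fix s \<theta> assume "s \<in> J i" "\<theta> \<in> J j"
      then show "\<phi> i (fst (s, \<theta>)) \<bullet> (R i j (fst (s, \<theta>)) (snd (s, \<theta>)) *v \<psi> j (snd (s, \<theta>))) =
        \<psi> j (snd (s, \<theta>)) \<bullet> (R j i (snd (s, \<theta>)) (fst (s, \<theta>)) *v \<phi> i (fst (s, \<theta>)))"
        using R_sym[of s i \<theta> j] inner_transpose_matrix_vector[of "\<phi> i s" "R j i \<theta> s" "\<psi> j \<theta>"]
        by (simp add: J_def)
    qed
    also have "\<dots> = (LINT z:J j \<times> J i|lborel. \<psi> j (fst z) \<bullet> (R j i (fst z) (snd z) *v \<phi> i (snd z)))"
      using iK(1)[of j i]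
      by (intro set_integral_swap(2)[where f = "\<lambda>\<theta> s. \<psi> j \<theta> \<bullet> (R j i \<theta> s *v \<phi> i s)"]) (simp add: case_prod_unfold)
    also have "\<dots> = - aq j i + r j i + g j i" by (rule j3)
    finally show ?thesis using set_integral_add(2)[OF iK(1)[of i j] iK(2)[of i j]] j3[of i j] by simp
  qed
  have E5: "x \<bullet> (C0 *v x) = e0 + (\<Sum>i\<in>UNIV. qv i + 1 / 2 * xx i)"
  proof -
    have "T * (x \<bullet> ((A i ** transpose (Q i (- \<tau> i))) *v x)) = qv i" for i
      using inner_transpose_matrix_vector[of "transpose (A i) *v x" "Q i (- \<tau> i)" x]
      by (simp add: inner_matrix_mult qv_def v_def bc matrix_vector_mult_scaleR)
    then show ?thesis
      unfolding C0 matrix_vector_mult_add_rdistrib inner_add_right matrix_vector_sum inner_sum_right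
        inner_matrix_mult[of x A0] scaleR_matrix_vector_assoc[symmetric] inner_scaleR_right
      by (simp add: e0_def xx_def)
  qed
  have E6: "x \<bullet> (C i *v v i) = sv i" for i
    unfolding C scaleR_matrix_vector_assoc[symmetric] inner_scaleR_right inner_matrix_mult
    by (simp add: sv_def v_def bc)
  have E7: "(LINT s:J i|lborel. x \<bullet> (B i s *v \<phi> i s)) = a0 i + qd i + 1 / T * (\<Sum>j\<in>UNIV. r j i)" for i
  proof -
    have "has_set_integral (J i) (\<lambda>s. (transpose A0 *v x) \<bullet> (Q i s *v \<phi> i s) + x \<bullet> (Q' i s *v \<phi> i s) +
        1 / T * (\<Sum>j\<in>UNIV. v j \<bullet> (R j i (- \<tau> j) s *v \<phi> i s))) (a0 i + qd i + 1 / T * (\<Sum>j\<in>UNIV. r j i))"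
      unfolding a0_def qd_def r_def
      by (intro has_set_integral_add has_set_integral_mult_right has_set_integral_sum has_set_integralI iQ iQ' iR)
    then have "has_set_integral (J i) (\<lambda>s. x \<bullet> (B i s *v \<phi> i s)) (a0 i + qd i + 1 / T * (\<Sum>j\<in>UNIV. r j i))"
    proof (rule has_set_integral_cong)
      show "(transpose A0 *v x) \<bullet> (Q i s *v \<phi> i s) + x \<bullet> (Q' i s *v \<phi> i s) +
        1 / T * (\<Sum>j\<in>UNIV. v j \<bullet> (R j i (- \<tau> j) s *v \<phi> i s)) = x \<bullet> (B i s *v \<phi> i s)" for s
        using T_pos unfolding B matrix_vector_mult_add_rdistrib inner_add_right matrix_vector_sum inner_sum_right inner_matrix_mult
        by (simp add: v_def bc sum_distrib_left[symmetric] sum_divide_distrib[symmetric])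
    qed simp
    then show ?thesis by (simp add: has_set_integral_def)
  qed
  have iG: "set_integrable lborel (J i \<times> J j) (\<lambda>(s, \<theta>). \<phi> i s \<bullet> (Rs i j s \<theta> *v \<phi> j \<theta>))" for i j
    unfolding J_def by (intro kernel_integrable_continuous Rs_int phic[unfolded J_def])
  have E8: "(LINT z:J i \<times> J j|lborel. \<phi> i (fst z) \<bullet> (G i j (fst z) (snd z) *v \<phi> j (snd z))) = g i j + g j i" for i j
  proof -
    have "has_set_integral (J i \<times> J j) (\<lambda>z. \<phi> i (fst z) \<bullet> (Rs i j (fst z) (snd z) *v \<phi> j (snd z))) (g i j)"
      using iG[of i j] by (simp add: has_set_integral_def g_def case_prod_unfold)
    moreover have "has_set_integral (J i \<times> J j) (\<lambda>z. \<phi> j (snd z) \<bullet> (Rs j i (snd z) (fst z) *v \<phi> i (fst z))) (g j i)"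
      using set_integral_swap[OF iG[of j i]] by (simp add: has_set_integral_def g_def case_prod_unfold)
    ultimately have "has_set_integral (J i \<times> J j) (\<lambda>z. \<phi> i (fst z) \<bullet> (G i j (fst z) (snd z) *v \<phi> j (snd z))) (g i j + g j i)"
      by (rule has_set_integral_cong[OF has_set_integral_add])
         (simp_all only: G matrix_vector_mult_add_rdistrib inner_add_right inner_transpose_matrix_vector)
    then show ?thesis by (simp add: has_set_integral_def)
  qed
  have E9: "(p i - x) \<bullet> (S i 0 *v (p i - x)) = sp i - 2 * sx i + xx i" for i
    using inner_S_commute[of 0 i x "p i"] J(1)[of i, unfolded J_def]
    by (simp add: matrix_vector_diff inner_diff_left inner_diff_right sp_def sx_def xx_def)
  have swap: "(\<Sum>i\<in>UNIV. \<Sum>j\<in>UNIV. f j i) = (\<Sum>i\<in>UNIV. \<Sum>j\<in>UNIV. f i j)" for f :: "'k \<Rightarrow> 'k \<Rightarrow> real"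
    by (rule sum.swap)
  have L: "delay_form_rate \<tau> P Q S R x \<phi> x' \<psi> =
    T * (2 * (e0 + (\<Sum>i\<in>UNIV. qp i + sx i))) +
    2 * T * (\<Sum>i\<in>UNIV. a0 i + 1 / T * (\<Sum>j\<in>UNIV. aq j i) - qp i + qv i + qd i) +
    T * (\<Sum>i\<in>UNIV. - sp i + sv i + sd i) +
    (\<Sum>i\<in>UNIV. \<Sum>j\<in>UNIV. (- aq i j + r i j + g i j) + (- aq j i + r j i + g j i))"
    unfolding delay_form_rate_def T[symmetric] inner_P_commute[of x x'] E1
      E2[unfolded J_def] E3[unfolded J_def] E4[unfolded J_def] by simp
  have folds: "\<phi> i (- \<tau> i) = v i" "\<phi> i 0 = p i" "v i \<bullet> (S i (- \<tau> i) *v v i) = sv i"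
    "(LINT s:{- \<tau> i..0}|lborel. \<phi> i s \<bullet> (S' i s *v \<phi> i s)) = sd i" for i
    by (simp_all add: v_def p_def sv_def sd_def J_def)
  show ?thesis
    unfolding L dissipation_def folds E5 E6 E7[unfolded J_def] E8[unfolded J_def] E9
      sum.distrib sum_subtractf sum_negf sum_distrib_left[symmetric] swap[of aq] swap[of r] swap[of g]
    using T_pos by (simp add: field_simps)
qed

end

section \<open>Coercivity and its consequences\<close>

text \<open>The squared norm of the state for the inner product of \<open>delay_form\<close>.\<close>
definition state_sq :: "('k::{finite,linorder} \<Rightarrow> real) \<Rightarrow> real^'m::finite \<Rightarrow> ('k \<Rightarrow> real \<Rightarrow> real^'n::finite) \<Rightarrow> real" where
  "state_sq \<tau> h \<phi> = tau_last \<tau> * (h \<bullet> h + (\<Sum>i\<in>UNIV. LINT s:{- \<tau> i..0}|lborel. \<phi> i s \<bullet> \<phi> i s))"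

lemma set_integral_cong_Icc:
  fixes f :: "real \<Rightarrow> real"
  shows "(\<And>s. s \<in> {a..b} \<Longrightarrow> f s = g s) \<Longrightarrow> (LINT s:{a..b}|lborel. f s) = (LINT s:{a..b}|lborel. g s)"
  by (rule set_lebesgue_integral_cong) auto

lemma set_integral_cong_Times:
  fixes f :: "real \<times> real \<Rightarrow> real"
  shows "(\<And>z. z \<in> {a..b} \<times> {c..d} \<Longrightarrow> f z = g z) \<Longrightarrow>
    (LINT z:{a..b} \<times> {c..d}|lborel. f z) = (LINT z:{a..b} \<times> {c..d}|lborel. g z)"
  by (rule set_lebesgue_integral_cong) (auto intro!: borel_closed closed_Times)

lemma delay_form_cong:
  assumes "\<And>i s. s \<in> {- \<tau> i..0} \<Longrightarrow> \<phi> i s = \<psi> i s"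
  shows "delay_form \<tau> P Q S R h \<phi> = delay_form \<tau> P Q S R h \<psi>"
  unfolding delay_form_def
  by (intro arg_cong2[of _ _ _ _ "(+)"] arg_cong2[of _ _ _ _ "(*)"] refl sum.cong
      set_integral_cong_Icc set_integral_cong_Times) (auto simp: assms)

lemma state_sq_cong:
  assumes "\<And>i s. s \<in> {- \<tau> i..0} \<Longrightarrow> \<phi> i s = \<psi> i s"
  shows "state_sq \<tau> h \<phi> = state_sq \<tau> h \<psi>"
  unfolding state_sq_def
  by (intro arg_cong2[of _ _ _ _ "(+)"] arg_cong2[of _ _ _ _ "(*)"] refl sum.cong
      set_integral_cong_Icc) (auto simp: assms)

lemma set_integral_nonneg_Icc:
  fixes f :: "real \<Rightarrow> real"
  shows "(\<And>s. s \<in> {a..b} \<Longrightarrow> 0 \<le> f s) \<Longrightarrow> 0 \<le> (LINT s:{a..b}|lborel. f s)"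
  unfolding set_lebesgue_integral_def by (intro integral_nonneg_AE AE_I2) (auto simp: indicator_def)

lemma inner_matrix_vector_bound:
  assumes "norm (M :: real^'b^'a) \<le> c"
  shows "u \<bullet> (M *v w) \<le> c / 2 * (u \<bullet> u + w \<bullet> w)"
proof -
  have c: "0 \<le> c" using order_trans[OF norm_ge_zero assms] .
  have "u \<bullet> (M *v w) \<le> norm u * norm M * norm w"
    using abs_inner_matrix_vector_le[of u M w] by linarith
  also have "\<dots> \<le> c * (norm u * norm w)"
    using mult_right_mono[OF assms, of "norm u * norm w"] by (simp add: mult_ac)
  also have "\<dots> \<le> c * (((norm u)\<^sup>2 + (norm w)\<^sup>2) / 2)"
    using sum_squares_bound[of "norm u" "norm w"] by (intro mult_left_mono c) simp
  finally show ?thesis by (simp add: power2_norm_eq_inner)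
qed

text \<open>The kernels are continuous on compact sets, hence bounded, and $u \cdot M w$ is at most
$\frac12 |M| (|u|^2 + |w|^2)$ in every term.\<close>
lemma delay_form_upper_bound:
  fixes \<tau> :: "'k::{finite,linorder} \<Rightarrow> real" and P :: "real^'m::finite^'m" and S :: "'k \<Rightarrow> real \<Rightarrow> real^'n::finite^'n"
  assumes tau: "strict_mono \<tau>" "\<And>i. 0 < \<tau> i"
    and Q: "\<And>i. continuous_on {- \<tau> i..0} (Q i)" and S: "\<And>i. continuous_on {- \<tau> i..0} (S i)"
    and R: "\<And>i j. continuous_on ({- \<tau> i..0} \<times> {- \<tau> j..0}) (\<lambda>(s, \<theta>). R i j s \<theta>)"
  shows "\<exists>K>0. \<forall>h \<phi>. (\<forall>i. continuous_on {- \<tau> i..0} (\<phi> i)) \<longrightarrow>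
      delay_form \<tau> P Q S R h \<phi> \<le> K * state_sq \<tau> h \<phi>"
proof -
  define T where "T = tau_last \<tau>"
  have T: "0 < T" "\<And>i. \<tau> i \<le> T" using tau_last_pos tau tau_le_last[OF tau(1)] by (auto simp: T_def)
  have bnd: "\<exists>c. \<forall>i. \<forall>z\<in>X i. norm (f i z) \<le> c"
    if "\<And>i. compact (X i)" "\<And>i. continuous_on (X i) (f i)"
    for f :: "'i::finite \<Rightarrow> 'z::topological_space \<Rightarrow> 'e::real_normed_vector" and X
  proof -
    have "bounded (\<Union>i. f i ` X i)"
      by (intro bounded_UN finite ballI compact_imp_bounded compact_continuous_image that)
    then show ?thesis by (auto simp: bounded_iff)
  qed
  obtain q where q: "\<forall>i. \<forall>s\<in>{- \<tau> i..0}. norm (Q i s) \<le> q"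
    using bnd[of "\<lambda>i. {- \<tau> i..0}" Q] Q by auto
  obtain \<sigma> where \<sigma>: "\<forall>i. \<forall>s\<in>{- \<tau> i..0}. norm (S i s) \<le> \<sigma>"
    using bnd[of "\<lambda>i. {- \<tau> i..0}" S] S by auto
  obtain \<rho> where \<rho>: "\<forall>p. \<forall>z\<in>{- \<tau> (fst p)..0} \<times> {- \<tau> (snd p)..0}. norm (case z of (s, \<theta>) \<Rightarrow> R (fst p) (snd p) s \<theta>) \<le> \<rho>"
    using bnd[of "\<lambda>p. {- \<tau> (fst p)..0} \<times> {- \<tau> (snd p)..0}" "\<lambda>p (s, \<theta>). R (fst p) (snd p) s \<theta>"] R
    by (auto simp: compact_Times)
  have z: "0 \<in> {- \<tau> i..0}" for i using tau(2)[of i] by simp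
  have pos: "0 \<le> q" "0 \<le> \<sigma>" "0 \<le> \<rho>"
    using order_trans[OF norm_ge_zero q[rule_format, OF z[of undefined]]]
      order_trans[OF norm_ge_zero \<sigma>[rule_format, OF z[of undefined]]]
      order_trans[OF norm_ge_zero \<rho>[rule_format, of "(0, 0)" "(undefined, undefined)"]] z
    by auto
  define k where "k = real CARD('k)"
  have k: "0 \<le> k" by (simp add: k_def)
  define K where "K = norm P + T * q * k + q + \<sigma> + \<rho> * k + 1"
  have K: "0 < K" using pos k T by (auto simp: K_def intro!: add_nonneg_pos add_nonneg_nonneg mult_nonneg_nonneg)
  show ?thesis
  proof (rule exI, rule conjI[OF K], intro allI impI)
    fix h :: "real^'m" and \<phi> :: "'k \<Rightarrow> real \<Rightarrow> real^'n"
    assume "\<forall>i. continuous_on {- \<tau> i..0} (\<phi> i)"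
    then have phi: "continuous_on {- \<tau> i..0} (\<phi> i)" for i by blast
    define n where "n = (\<lambda>i. LINT s:{- \<tau> i..0}|lborel. \<phi> i s \<bullet> \<phi> i s)"
    have n0: "0 \<le> n i" for i unfolding n_def by (intro set_integral_nonneg_Icc inner_ge_zero)
    have n: "has_set_integral {- \<tau> i..0} (\<lambda>s. \<phi> i s \<bullet> \<phi> i s) (n i)" for i
      unfolding n_def by (intro has_set_integralI set_integrable_continuous continuous_intros phi)
    have c: "has_set_integral {- \<tau> i..0} (\<lambda>_. y) (\<tau> i * y)" for y i
      using has_set_integral_const[of "- \<tau> i" 0 y] tau(2)[of i] by simp
    have mono: "(LINT s:{- \<tau> i..0}|lborel. f s) \<le> d" if "continuous_on {- \<tau> i..0} f" "has_set_integral {- \<tau> i..0} g d"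
      "\<And>s. s \<in> {- \<tau> i..0} \<Longrightarrow> f s \<le> g s" for f g d i
      using that set_integral_mono[OF set_integrable_continuous[OF that(1)], of g]
      by (auto simp: has_set_integral_def)
    have b1: "h \<bullet> (P *v h) \<le> norm P * (h \<bullet> h)"
      using inner_matrix_vector_bound[of P "norm P" h h] by simp
    have b2: "(LINT s:{- \<tau> i..0}|lborel. h \<bullet> (Q i s *v \<phi> i s)) \<le> q / 2 * (T * (h \<bullet> h) + n i)" for i
    proof -
      have "(LINT s:{- \<tau> i..0}|lborel. h \<bullet> (Q i s *v \<phi> i s)) \<le> q / 2 * (\<tau> i * (h \<bullet> h) + n i)"
      proof (rule mono[OF _ has_set_integral_mult_right[OF has_set_integral_add[OF c n]]])
        show "continuous_on {- \<tau> i..0} (\<lambda>s. h \<bullet> (Q i s *v \<phi> i s))"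
          by (intro continuous_intros matrix_vector_continuous Q phi)
      qed (rule inner_matrix_vector_bound, use q in blast)
      also have "\<dots> \<le> q / 2 * (T * (h \<bullet> h) + n i)"
        using pos T(2)[of i] by (intro mult_left_mono add_right_mono mult_right_mono) auto
      finally show ?thesis .
    qed
    have b3: "(LINT s:{- \<tau> i..0}|lborel. \<phi> i s \<bullet> (S i s *v \<phi> i s)) \<le> \<sigma> / 2 * (n i + n i)" for i
    proof (rule mono[OF _ has_set_integral_mult_right[OF has_set_integral_add[OF n n]]])
      show "continuous_on {- \<tau> i..0} (\<lambda>s. \<phi> i s \<bullet> (S i s *v \<phi> i s))"
        by (intro continuous_intros matrix_vector_continuous S phi)
    qed (rule inner_matrix_vector_bound, use \<sigma> in blast)
    have b4: "(LINT z:{- \<tau> i..0} \<times> {- \<tau> j..0}|lborel. \<phi> i (fst z) \<bullet> (R i j (fst z) (snd z) *v \<phi> j (snd z))) \<le> \<rho> / 2 * T * (n i + n j)" for i j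
    proof -
      have i1: "has_set_integral ({- \<tau> i..0} \<times> {- \<tau> j..0}) (\<lambda>z. \<rho> / 2 * ((\<phi> i (fst z) \<bullet> \<phi> i (fst z)) * 1 + 1 * (\<phi> j (snd z) \<bullet> \<phi> j (snd z))))
         (\<rho> / 2 * (n i * (\<tau> j * 1) + (\<tau> i * 1) * n j))"
        by (intro has_set_integral_mult_right has_set_integral_add has_set_integral_product n
            has_set_integral_product[where f = "\<lambda>s. \<phi> i s \<bullet> \<phi> i s" and g = "\<lambda>_. 1"]
            has_set_integral_product[where f = "\<lambda>_. 1" and g = "\<lambda>s. \<phi> j s \<bullet> \<phi> j s"] c)
      have i2: "set_integrable lborel ({- \<tau> i..0} \<times> {- \<tau> j..0}) (\<lambda>z. \<phi> i (fst z) \<bullet> (R i j (fst z) (snd z) *v \<phi> j (snd z)))"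
        using kernel_integrable_continuous[OF set_integrable_continuous_Times[OF R[of i j]] phi[of i] phi[of j]]
        by (simp add: case_prod_unfold)
      have "(LINT z:{- \<tau> i..0} \<times> {- \<tau> j..0}|lborel. \<phi> i (fst z) \<bullet> (R i j (fst z) (snd z) *v \<phi> j (snd z))) \<le>
         (LINT z:{- \<tau> i..0} \<times> {- \<tau> j..0}|lborel. \<rho> / 2 * ((\<phi> i (fst z) \<bullet> \<phi> i (fst z)) * 1 + 1 * (\<phi> j (snd z) \<bullet> \<phi> j (snd z))))"
      proof (rule set_integral_mono[OF i2])
        show "\<phi> i (fst z) \<bullet> (R i j (fst z) (snd z) *v \<phi> j (snd z)) \<le> \<rho> / 2 * (\<phi> i (fst z) \<bullet> \<phi> i (fst z) * 1 + 1 * (\<phi> j (snd z) \<bullet> \<phi> j (snd z)))"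
          if "z \<in> {- \<tau> i..0} \<times> {- \<tau> j..0}" for z
          using \<rho>[rule_format, of z "(i, j)"] that
            inner_matrix_vector_bound[of "R i j (fst z) (snd z)" \<rho> "\<phi> i (fst z)" "\<phi> j (snd z)"]
          by (simp add: case_prod_unfold)
      qed (use i1 in \<open>simp add: has_set_integral_def\<close>)
      also have "\<dots> = \<rho> / 2 * (n i * \<tau> j + \<tau> i * n j)"
        using i1 by (simp add: has_set_integral_def)
      also have "\<dots> \<le> \<rho> / 2 * (n i * T + T * n j)"
        using T(2)[of i] T(2)[of j] pos n0 by (intro mult_left_mono add_mono mult_right_mono mult_left_mono) auto
      finally show ?thesis by (simp add: algebra_simps)
    qed
    let ?N = "\<Sum>i\<in>UNIV. n i"
    have N0: "0 \<le> ?N" by (intro sum_nonneg n0)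
    have "delay_form \<tau> P Q S R h \<phi> \<le> T * (norm P * (h \<bullet> h)) + 2 * T * (\<Sum>i\<in>(UNIV::'k set). q / 2 * (T * (h \<bullet> h) + n i)) +
        T * (\<Sum>i\<in>UNIV. \<sigma> / 2 * (n i + n i)) + (\<Sum>i\<in>UNIV. \<Sum>j\<in>UNIV. \<rho> / 2 * T * (n i + n j))"
      unfolding delay_form_def T_def[symmetric]
      by (intro add_mono mult_left_mono sum_mono b1 b2 b3 b4) (use T in auto)
    also have "(\<Sum>i\<in>(UNIV::'k set). q / 2 * (T * (h \<bullet> h) + n i)) = q / 2 * (k * (T * (h \<bullet> h)) + ?N)"
      unfolding sum_distrib_left[symmetric] sum.distrib by (simp add: k_def)
    also have "(\<Sum>i\<in>UNIV. \<sigma> / 2 * (n i + n i)) = \<sigma> * ?N"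
      by (simp add: sum_distrib_left)
    also have "(\<Sum>i\<in>(UNIV::'k set). \<Sum>j\<in>(UNIV::'k set). \<rho> / 2 * T * (n i + n j)) = \<rho> * T * k * ?N"
      unfolding sum_distrib_left[symmetric] sum.distrib by (simp add: k_def sum_distrib_left[symmetric])
    also have "T * (norm P * (h \<bullet> h)) + 2 * T * (q / 2 * (k * (T * (h \<bullet> h)) + ?N)) + T * (\<sigma> * ?N) + \<rho> * T * k * ?N =
      T * ((norm P + T * q * k) * (h \<bullet> h) + (q + \<sigma> + \<rho> * k) * ?N)"
      by (simp add: algebra_simps)
    also have "\<dots> \<le> T * (K * (h \<bullet> h) + K * ?N)"
      using T pos k N0 by (intro mult_left_mono add_mono mult_right_mono) (auto simp: K_def)
    also have "\<dots> = K * state_sq \<tau> h \<phi>"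
      by (simp add: state_sq_def T_def n_def algebra_simps)
    finally show "delay_form \<tau> P Q S R h \<phi> \<le> K * state_sq \<tau> h \<phi>" .
  qed
qed

text \<open>What the two membership hypotheses contribute: the functional is coercive, and its rate of change is
bounded by minus the squared norm of the state.\<close>
locale dual_lyapunov = dual_functional +
  fixes \<epsilon> :: real
  assumes eps: "0 < \<epsilon>"
    and coercive: "\<And>h \<phi> c. (\<And>i. \<phi> i \<in> borel_measurable borel) \<Longrightarrow> (\<And>i s. norm (\<phi> i s) \<le> c) \<Longrightarrow>
      \<epsilon> * state_sq \<tau> h \<phi> \<le> delay_form \<tau> P Q S R h \<phi>"
    and dissipative: "\<And>x v \<phi> c. (\<And>i. \<phi> i \<in> borel_measurable borel) \<Longrightarrow> (\<And>i s. norm (\<phi> i s) \<le> c) \<Longrightarrow>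
      dissipation x v \<phi> \<le> - \<epsilon> * state_sq \<tau> x \<phi>"
begin

lemma bounded_borel_extension:
  fixes \<phi> :: "'a \<Rightarrow> real \<Rightarrow> real^'b"
  assumes "\<And>i. continuous_on {- \<tau> i..0} (\<phi> i)"
  obtains \<psi> c where "\<And>i. \<psi> i \<in> borel_measurable borel" "\<And>i s. norm (\<psi> i s) \<le> c"
    "\<And>i s. s \<in> {- \<tau> i..0} \<Longrightarrow> \<psi> i s = \<phi> i s"
proof -
  define \<psi> where "\<psi> = (\<lambda>i s. indicator {- \<tau> i..0} s *\<^sub>R \<phi> i s)"
  obtain c where c: "\<And>i s. norm (\<psi> i s) \<le> c i"
    using continuous_imp_extension_bounded(2)[OF assms] unfolding \<psi>_def by metis
  show ?thesis
  proof (rule that[of \<psi> "Max (range c)"])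
    show "norm (\<psi> i s) \<le> Max (range c)" for i s
      by (rule order_trans[OF c Max_ge]) auto
    show "\<psi> i \<in> borel_measurable borel" for i
      unfolding \<psi>_def by (rule continuous_imp_extension_bounded(1)[OF assms])
  qed (simp add: \<psi>_def)
qed

lemma coercive_continuous:
  assumes "\<And>i. continuous_on {- \<tau> i..0} (\<phi> i)"
  shows "\<epsilon> * state_sq \<tau> h \<phi> \<le> delay_form \<tau> P Q S R h \<phi>"
proof -
  obtain \<psi> c where psi: "\<And>i. \<psi> i \<in> borel_measurable borel" "\<And>i s. norm (\<psi> i s) \<le> c"
    "\<And>i s. s \<in> {- \<tau> i..0} \<Longrightarrow> \<psi> i s = \<phi> i s"
    using bounded_borel_extension[of \<phi>, OF assms] by metis
  show ?thesis
    using coercive[where \<phi> = \<psi> and c = c and h = h, OF psi(1,2)] delay_form_cong[where \<tau> = \<tau> and \<phi> = \<psi> and \<psi> = \<phi> and P = P and Q = Q and S = S and R = R and h = h, OF psi(3)]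
      state_sq_cong[where \<tau> = \<tau> and \<phi> = \<psi> and \<psi> = \<phi> and h = h, OF psi(3)] by simp
qed

lemma dissipative_continuous:
  assumes "\<And>i. continuous_on {- \<tau> i..0} (\<phi> i)"
  shows "dissipation x v \<phi> \<le> - \<epsilon> * state_sq \<tau> x \<phi>"
proof -
  obtain \<psi> c where psi: "\<And>i. \<psi> i \<in> borel_measurable borel" "\<And>i s. norm (\<psi> i s) \<le> c"
    "\<And>i s. s \<in> {- \<tau> i..0} \<Longrightarrow> \<psi> i s = \<phi> i s"
    using bounded_borel_extension[of \<phi>, OF assms] by metis
  have "dissipation x v \<phi> = dissipation x v \<psi>"
    unfolding dissipation_def
    by (intro arg_cong2[of _ _ _ _ "(+)"] arg_cong2[of _ _ _ _ "(*)"] refl sum.cong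
      set_integral_cong_Icc set_integral_cong_Times) (auto simp: psi(3))
  then show ?thesis
    using dissipative[where \<phi> = \<psi> and c = c and x = x and v = v, OF psi(1,2)] state_sq_cong[where \<tau> = \<tau> and \<phi> = \<psi> and \<psi> = \<phi> and h = x, OF psi(3)] by simp
qed

text \<open>Test coercivity on $w$ times the indicator function of $[-\delta,0]$: the single integral with $S_i$ is of order $\delta$ and
the double integral with $R_{ii}$ of order $\delta^2$, so a negative value of $S_i(0)$ would win for small $\delta$.\<close>
lemma S_zero_psd: "0 \<le> w \<bullet> (S i 0 *v w)"
proof (rule ccontr)
  assume "\<not> 0 \<le> w \<bullet> (S i 0 *v w)"
  define \<eta> where "\<eta> = - (w \<bullet> (S i 0 *v w))"
  have eta: "0 < \<eta>" using \<open>\<not> 0 \<le> w \<bullet> (S i 0 *v w)\<close> by (simp add: \<eta>_def)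
  have cS: "continuous_on {- \<tau> i..0} (\<lambda>s. w \<bullet> (S i s *v w))"
    by (intro continuous_intros matrix_vector_continuous S_cont)
  have z: "0 \<in> {- \<tau> i..0}" using tau_nonneg by simp
  have "\<exists>d>0. \<forall>s\<in>{- \<tau> i..0}. dist s 0 < d \<longrightarrow> dist (w \<bullet> (S i s *v w)) (w \<bullet> (S i 0 *v w)) < \<eta> / 2"
    using cS z eta unfolding continuous_on_iff by (meson half_gt_zero)
  then obtain d where d: "0 < d" "\<And>s. s \<in> {- \<tau> i..0} \<Longrightarrow> dist s 0 < d \<Longrightarrow> dist (w \<bullet> (S i s *v w)) (w \<bullet> (S i 0 *v w)) < \<eta> / 2"
    by blast
  have "compact ((\<lambda>(s, \<theta>). w \<bullet> (R i i s \<theta> *v w)) ` ({- \<tau> i..0} \<times> {- \<tau> i..0}))"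
    using R_cont[of i i] unfolding case_prod_unfold
    by (intro compact_continuous_image compact_Times continuous_intros matrix_vector_continuous) auto
  then obtain \<rho> where rho: "0 < \<rho>" "\<And>s \<theta>. s \<in> {- \<tau> i..0} \<Longrightarrow> \<theta> \<in> {- \<tau> i..0} \<Longrightarrow> \<bar>w \<bullet> (R i i s \<theta> *v w)\<bar> \<le> \<rho>"
    by (auto dest!: compact_imp_bounded simp: bounded_pos)
  \<comment> \<open>The last bound makes the double integral at most half of what the single integral loses.\<close>
  define \<delta> where "\<delta> = min (\<tau> i) (min (d / 2) (T * \<eta> / (4 * \<rho>)))"
  have delta: "0 < \<delta>" "\<delta> \<le> \<tau> i" "\<delta> < d" "\<delta> * \<rho> < T * \<eta> / 2"
  proof -
    show "0 < \<delta>" "\<delta> \<le> \<tau> i" using delays(2)[of i] d(1) T_pos eta rho by (auto simp: \<delta>_def)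
    have "\<delta> \<le> d / 2" "\<delta> \<le> T * \<eta> / (4 * \<rho>)" by (auto simp: \<delta>_def)
    then show "\<delta> < d" using d(1) by simp
    have "\<delta> * \<rho> \<le> T * \<eta> / 4"
      using mult_right_mono[OF \<open>\<delta> \<le> T * \<eta> / (4 * \<rho>)\<close>, of \<rho>] rho(1) by simp
    moreover have "0 < T * \<eta>" using T_pos eta by simp
    ultimately show "\<delta> * \<rho> < T * \<eta> / 2" by linarith
  qed
  define \<phi> where "\<phi> = (\<lambda>j s. if j = i then indicator {- \<delta>..0} s *\<^sub>R w else 0)"
  have sub: "{- \<delta>..0} \<subseteq> {- \<tau> i..0}" using delta by auto
  have meas: "\<phi> j \<in> borel_measurable borel" for j
    by (cases "j = i") (auto simp: \<phi>_def intro!: borel_measurable_scaleR borel_measurable_indicator)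
  have bdd: "norm (\<phi> j s) \<le> norm w" for j s by (auto simp: \<phi>_def indicator_def)
  have "0 \<le> \<epsilon> * state_sq \<tau> (0 :: real^'b) \<phi>"
    using eps T_pos unfolding state_sq_def T[symmetric]
    by (intro mult_nonneg_nonneg add_nonneg_nonneg sum_nonneg set_integral_nonneg_Icc inner_ge_zero) auto
  also have "\<dots> \<le> delay_form \<tau> P Q S R 0 \<phi>" by (rule coercive[OF meas bdd])
  also have "\<dots> = T * (\<Sum>j\<in>UNIV. LINT s:{- \<tau> j..0}|lborel. \<phi> j s \<bullet> (S j s *v \<phi> j s)) +
      (\<Sum>j\<in>UNIV. \<Sum>k\<in>UNIV. LINT z:{- \<tau> j..0} \<times> {- \<tau> k..0}|lborel. \<phi> j (fst z) \<bullet> (R j k (fst z) (snd z) *v \<phi> k (snd z)))"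
    by (simp add: delay_form_def T)
  also have "(\<Sum>j\<in>UNIV. LINT s:{- \<tau> j..0}|lborel. \<phi> j s \<bullet> (S j s *v \<phi> j s)) =
      (\<Sum>j\<in>UNIV. if j = i then LINT s:{- \<delta>..0}|lborel. w \<bullet> (S i s *v w) else 0)"
  proof (rule sum.cong[OF refl])
    fix j
    show "(LINT s:{- \<tau> j..0}|lborel. \<phi> j s \<bullet> (S j s *v \<phi> j s)) = (if j = i then LINT s:{- \<delta>..0}|lborel. w \<bullet> (S i s *v w) else 0)"
      using sub unfolding set_lebesgue_integral_def
      by (auto simp: \<phi>_def indicator_def intro!: Bochner_Integration.integral_cong)
  qed
  also have "\<dots> = (LINT s:{- \<delta>..0}|lborel. w \<bullet> (S i s *v w))" by simp
  also have "(\<Sum>j\<in>UNIV. \<Sum>k\<in>UNIV. LINT z:{- \<tau> j..0} \<times> {- \<tau> k..0}|lborel. \<phi> j (fst z) \<bullet> (R j k (fst z) (snd z) *v \<phi> k (snd z))) =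
      (\<Sum>j\<in>UNIV. \<Sum>k\<in>UNIV. if k = i then if j = i then LINT z:{- \<delta>..0} \<times> {- \<delta>..0}|lborel. w \<bullet> (R i i (fst z) (snd z) *v w) else 0 else 0)"
  proof (intro sum.cong refl)
    fix j k
    show "(LINT z:{- \<tau> j..0} \<times> {- \<tau> k..0}|lborel. \<phi> j (fst z) \<bullet> (R j k (fst z) (snd z) *v \<phi> k (snd z))) =
      (if k = i then if j = i then LINT z:{- \<delta>..0} \<times> {- \<delta>..0}|lborel. w \<bullet> (R i i (fst z) (snd z) *v w) else 0 else 0)"
      using sub unfolding set_lebesgue_integral_def
      by (auto simp: \<phi>_def indicator_def intro!: Bochner_Integration.integral_cong)
  qed
  also have "\<dots> = (LINT z:{- \<delta>..0} \<times> {- \<delta>..0}|lborel. w \<bullet> (R i i (fst z) (snd z) *v w))" by simp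
  finally have "0 \<le> T * (LINT s:{- \<delta>..0}|lborel. w \<bullet> (S i s *v w)) + (LINT z:{- \<delta>..0} \<times> {- \<delta>..0}|lborel. w \<bullet> (R i i (fst z) (snd z) *v w))" .
  moreover have "(LINT s:{- \<delta>..0}|lborel. w \<bullet> (S i s *v w)) \<le> \<delta> * (- \<eta> / 2)"
  proof -
    have "(LINT s:{- \<delta>..0}|lborel. w \<bullet> (S i s *v w)) \<le> (LINT s:{- \<delta>..0}|lborel. - \<eta> / 2)"
    proof (rule set_integral_mono)
      show "set_integrable lborel {- \<delta>..0} (\<lambda>s. w \<bullet> (S i s *v w))"
        by (intro set_integrable_continuous continuous_on_subset[OF cS sub])
      show "w \<bullet> (S i s *v w) \<le> - \<eta> / 2" if "s \<in> {- \<delta>..0}" for s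
      proof -
        have "s \<in> {- \<tau> i..0}" "dist s 0 < d" using that sub delta by (auto simp: dist_real_def)
        then show ?thesis using d(2)[of s] by (auto simp: dist_real_def \<eta>_def)
      qed
    qed (intro set_integrable_continuous continuous_intros)
    also have "\<dots> = \<delta> * (- \<eta> / 2)"
      using has_set_integral_const[of "- \<delta>" 0 "- \<eta> / 2"] delta by (simp add: has_set_integral_def)
    finally show ?thesis .
  qed
  moreover have "(LINT z:{- \<delta>..0} \<times> {- \<delta>..0}|lborel. w \<bullet> (R i i (fst z) (snd z) *v w)) \<le> \<delta> * (\<delta> * \<rho>)"
  proof -
    have c: "has_set_integral {- \<delta>..0} (\<lambda>_. 1) \<delta>" "has_set_integral {- \<delta>..0} (\<lambda>_. \<rho>) (\<delta> * \<rho>)"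
      using has_set_integral_const[of "- \<delta>" 0 1] has_set_integral_const[of "- \<delta>" 0 \<rho>] delta by simp_all
    note cc = has_set_integral_product[OF c]
    have "(LINT z:{- \<delta>..0} \<times> {- \<delta>..0}|lborel. w \<bullet> (R i i (fst z) (snd z) *v w)) \<le> (LINT z:{- \<delta>..0} \<times> {- \<delta>..0}|lborel. 1 * \<rho>)"
    proof (rule set_integral_mono)
      have "continuous_on ({- \<delta>..0} \<times> {- \<delta>..0}) (\<lambda>z. w \<bullet> (R i i (fst z) (snd z) *v w))"
        using continuous_on_subset[OF R_cont[of i i] Sigma_mono[OF sub sub]] unfolding case_prod_unfold
        by (intro continuous_intros matrix_vector_continuous) auto
      then show "set_integrable lborel ({- \<delta>..0} \<times> {- \<delta>..0}) (\<lambda>z. w \<bullet> (R i i (fst z) (snd z) *v w))"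
        by (rule set_integrable_continuous_Times)
      show "set_integrable lborel ({- \<delta>..0} \<times> {- \<delta>..0}) (\<lambda>z. 1 * \<rho>)"
        using cc by (simp add: has_set_integral_def)
      show "w \<bullet> (R i i (fst z) (snd z) *v w) \<le> 1 * \<rho>" if "z \<in> {- \<delta>..0} \<times> {- \<delta>..0}" for z
      proof -
        have "fst z \<in> {- \<tau> i..0}" "snd z \<in> {- \<tau> i..0}" using that sub by auto
        then show ?thesis using rho(2)[of "fst z" "snd z"] by simp
      qed
    qed
    also have "\<dots> = \<delta> * (\<delta> * \<rho>)" using cc by (simp add: has_set_integral_def)
    finally show ?thesis .
  qed
  ultimately have "0 \<le> T * (\<delta> * (- \<eta> / 2)) + \<delta> * (\<delta> * \<rho>)"
    using T_pos mult_left_mono[of "LINT s:{- \<delta>..0}|lborel. w \<bullet> (S i s *v w)" "\<delta> * (- \<eta> / 2)" T] by linarith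
  also have "\<dots> = \<delta> * (\<delta> * \<rho> - T * \<eta> / 2)" by (simp add: algebra_simps)
  also have "\<dots> < 0" using delta by (intro mult_pos_neg) auto
  finally show False by simp
qed

end

section \<open>The fundamental solution\<close>

text \<open>For $t < 0$ the interval is empty, so this is the integral of the function that is $f$ on $[0,\infty)$
and zero on the negative half-line.\<close>
definition ramp_integral :: "(real \<Rightarrow> 'b::euclidean_space) \<Rightarrow> real \<Rightarrow> 'b" where
  "ramp_integral f t = integral {0..t} f"

lemma ramp_integral_neg: "t \<le> 0 \<Longrightarrow> ramp_integral f t = 0"
  by (cases "t = 0") (simp_all add: ramp_integral_def)

lemma ramp_integral_deriv_within:
  assumes "continuous_on {0..} f" "0 \<le> t"
  shows "(ramp_integral f has_vector_derivative f t) (at t within {0..})"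
proof -
  have "((\<lambda>u. integral {0..u} f) has_vector_derivative f t) (at t within {0..t + 1})"
    using assms by (intro integral_has_vector_derivative continuous_on_subset[OF assms(1)]) auto
  moreover have "at t within {0..t + 1} = at t within {0..}"
    by (rule at_within_nhd[of t "{..<t + 1}"]) (use assms in auto)
  ultimately show ?thesis by (simp add: ramp_integral_def[abs_def])
qed

lemma ramp_integral_deriv:
  assumes "continuous_on {0..} f" "t \<noteq> 0"
  shows "(ramp_integral f has_vector_derivative (if t < 0 then 0 else f t)) (at t)"
proof (cases "t < 0")
  case True
  have "((\<lambda>_. 0) has_vector_derivative 0) (at t)" by simp
  then have "(ramp_integral f has_vector_derivative 0) (at t)"
    by (rule has_vector_derivative_transform_within_open[of _ _ _ "{..<0}"])
       (use True in \<open>auto simp: ramp_integral_neg\<close>)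
  then show ?thesis using True by simp
next
  case False
  then have "at t within {0..} = at t" using assms(2) by (intro at_within_interior) (auto simp: interior_real_atLeast)
  then show ?thesis using ramp_integral_deriv_within[OF assms(1), of t] False by simp
qed

lemma continuous_ramp_integral:
  assumes "continuous_on {0..} f"
  shows "continuous_on UNIV (ramp_integral f)"
proof -
  have "continuous_on {0..} (ramp_integral f)"
    by (intro continuous_on_vector_derivative[where f' = f] ramp_integral_deriv_within assms) auto
  then have "continuous_on UNIV (\<lambda>t. ramp_integral f (max 0 t))"
    by (rule continuous_on_compose2) (auto intro!: continuous_intros)
  moreover have "ramp_integral f (max 0 t) = ramp_integral f t" for t
    by (cases "t \<le> 0") (simp_all add: ramp_integral_neg max_def)
  ultimately show ?thesis by simp
qed

lemma norm_ramp_integral_le: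
  assumes f: "continuous_on {0..} f" and L: "0 < L" and b: "\<And>r. 0 \<le> r \<Longrightarrow> norm (f r) \<le> exp (L * r) * d"
    and t: "t \<le> s" "0 \<le> s"
  shows "norm (ramp_integral f t) \<le> exp (L * s) * d / L"
proof -
  have d: "0 \<le> d" using order_trans[OF norm_ge_zero b[of 0]] by simp
  show ?thesis
  proof (cases "t \<le> 0")
    case True
    then show ?thesis using d L by (simp add: ramp_integral_neg)
  next
    case False
    have int: "((\<lambda>r. exp (L * r) * d) has_integral (exp (L * t) * d / L - exp (L * 0) * d / L)) {0..t}"
    proof (rule fundamental_theorem_of_calculus)
      show "((\<lambda>r. exp (L * r) * d / L) has_vector_derivative exp (L * r) * d) (at r within {0..t})" for r
        unfolding has_real_derivative_iff_has_vector_derivative[symmetric]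
        using L by (auto intro!: derivative_eq_intros)
    qed (use False in simp)
    have "norm (ramp_integral f t) \<le> exp (L * t) * d / L - exp (L * 0) * d / L"
      unfolding ramp_integral_def integral_unique[OF int, symmetric]
      using int
      by (intro integral_norm_bound_integral integrable_continuous_interval continuous_on_subset[OF f])
         (auto intro: b intro!: continuous_intros)
    also have "\<dots> \<le> exp (L * t) * d / L" using d L by simp
    also have "\<dots> \<le> exp (L * s) * d / L"
      using t d L by (intro divide_right_mono mult_right_mono) auto
    finally show ?thesis .
  qed
qed

text \<open>The solution with value $e$ at $0$ and zero before. The integrated equation is
$x(t) = e + A_0 W(t) + \sum_i A_i W(t - \tau_i)$ where $W$ is the integral of $x$ from $0$. On the space of
bounded continuous $u$ with $x(t) = e^{Lt} u(t)$ its right-hand side is a contraction once $L$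
exceeds twice the sum of the norms of the matrices. The times $\tau_i$, at which the jump of $x$ at $0$
arrives in the equation, are excluded.\<close>
lemma delay_fundamental_solution:
  fixes A0 :: "real^'n^'n" and A :: "'k::finite \<Rightarrow> real^'n^'n" and e :: "real^'n"
  assumes tau: "\<And>i. 0 < \<tau> i"
  obtains x where "continuous_on {0..} x" "x 0 = e" "\<And>t. t < 0 \<Longrightarrow> x t = 0"
    "\<And>t. 0 < t \<Longrightarrow> t \<notin> range \<tau> \<Longrightarrow>
      (x has_vector_derivative (A0 *v x t + (\<Sum>i\<in>UNIV. A i *v x (t - \<tau> i)))) (at t)"
proof -
  define c where "c = norm A0 + (\<Sum>i\<in>UNIV. norm (A i))"
  have c0: "0 \<le> c" by (auto simp: c_def intro!: add_nonneg_nonneg sum_nonneg)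
  \<comment> \<open>Any rate above twice the sum of the norms makes the contraction constant at most one half.\<close>
  define L where "L = 2 * c + 1"
  have L: "0 < L" "c / L \<le> 1 / 2" using c0 by (auto simp: L_def field_simps)
  define X where "X = (\<lambda>(u :: real \<Rightarrow>\<^sub>C (real^'n)) t. exp (L * t) *\<^sub>R u t)"
  have Xc: "continuous_on S (X u)" for S u unfolding X_def by (intro continuous_intros) auto
  define D where "D = (\<lambda>u t. A0 *v ramp_integral (X u) t + (\<Sum>i\<in>UNIV. A i *v ramp_integral (X u) (t - \<tau> i)))"
  define Phi where "Phi = (\<lambda>u t. exp (- L * max 0 t) *\<^sub>R (e + D u (max 0 t)))"
  have Dc: "continuous_on UNIV (D u)" for u
    unfolding D_def
    by (intro continuous_intros matrix_vector_continuous
         continuous_on_compose2[OF continuous_ramp_integral[OF Xc]]) auto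
  have Phic: "continuous_on UNIV (Phi u)" for u
    unfolding Phi_def by (intro continuous_intros continuous_on_compose2[OF Dc]) auto
  have Ddiff: "norm (D u t - D v t) \<le> exp (L * t) * (dist u v / 2)" if t: "0 \<le> t" for u v t
  proof -
    have b: "norm (X u r - X v r) \<le> exp (L * r) * dist u v" for r
    proof -
      have "norm (X u r - X v r) = exp (L * r) * dist (u r) (v r)"
        by (simp add: X_def dist_norm flip: scaleR_diff_right)
      then show ?thesis using dist_bounded[of u r v] by simp
    qed
    have W: "norm (ramp_integral (X u) s - ramp_integral (X v) s) \<le> exp (L * t) * dist u v / L" if "s \<le> t" for s
    proof -
      have "ramp_integral (X u) s - ramp_integral (X v) s = ramp_integral (\<lambda>r. X u r - X v r) s"
        unfolding ramp_integral_def
        by (intro Henstock_Kurzweil_Integration.integral_diff[symmetric] integrable_continuous_interval Xc)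
      also have "norm \<dots> \<le> exp (L * t) * dist u v / L"
        by (intro norm_ramp_integral_le continuous_on_diff Xc L b that t)
      finally show ?thesis .
    qed
    let ?w = "\<lambda>s. ramp_integral (X u) s - ramp_integral (X v) s"
    have M: "norm (B *v ?w s) \<le> norm B * (exp (L * t) * dist u v / L)" if "s \<le> t" for B :: "real^'n^'n" and s
      by (rule order_trans[OF norm_matrix_vector_mult_le mult_left_mono[OF W[OF that] norm_ge_zero]])
    have "D u t - D v t = A0 *v ?w t + (\<Sum>i\<in>UNIV. A i *v ?w (t - \<tau> i))"
      by (simp add: D_def matrix_vector_diff sum_subtractf)
    also have "norm \<dots> \<le> norm A0 * (exp (L * t) * dist u v / L) + (\<Sum>i\<in>UNIV. norm (A i) * (exp (L * t) * dist u v / L))"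
      using tau by (intro norm_triangle_mono M sum_norm_le) (auto intro: less_imp_le)
    also have "\<dots> = c * (exp (L * t) * dist u v / L)"
      by (simp only: c_def distrib_right sum_distrib_right[symmetric])
    also have "\<dots> = exp (L * t) * (dist u v * (c / L))" by simp
    also have "\<dots> \<le> exp (L * t) * (dist u v * (1 / 2))"
      by (intro mult_left_mono L) auto
    finally show ?thesis by simp
  qed
  have D0: "D 0 t = 0" for t by (simp add: D_def X_def ramp_integral_def)
  have Phidiff: "dist (Phi u t) (Phi v t) \<le> 1 / 2 * dist u v" for u v t
  proof -
    let ?s = "max 0 t"
    have "dist (Phi u t) (Phi v t) = exp (- L * ?s) * norm (D u ?s - D v ?s)"
      by (simp add: Phi_def dist_norm flip: scaleR_diff_right)
    also have "\<dots> \<le> exp (- L * ?s) * (exp (L * ?s) * (dist u v / 2))"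
      by (intro mult_left_mono Ddiff) auto
    also have "\<dots> = (exp (- L * ?s) * exp (L * ?s)) * (dist u v / 2)" by (simp only: mult.assoc)
    also have "exp (- L * ?s) * exp (L * ?s) = 1" by (simp flip: exp_add)
    finally show ?thesis by simp
  qed
  have Phib: "Phi u \<in> bcontfun" for u
  proof (rule bcontfun_normI[OF Phic])
    fix t
    have "norm (Phi u t) \<le> norm (Phi 0 t) + dist (Phi u t) (Phi 0 t)"
      by (metis dist_norm norm_triangle_sub)
    also have "norm (Phi 0 t) \<le> norm e"
      using L(1) by (simp add: Phi_def D0 mult_left_le_one_le)
    also have "dist (Phi u t) (Phi 0 t) \<le> 1 / 2 * dist u 0" by (rule Phidiff)
    finally show "norm (Phi u t) \<le> norm e + 1 / 2 * dist u 0" by simp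
  qed
  have "\<exists>!u. Bcontfun (Phi u) = u"
  proof (rule banach_fix_type[of "1 / 2"], safe)
    show "dist (Bcontfun (Phi u)) (Bcontfun (Phi v)) \<le> 1 / 2 * dist u v" for u v
      by (rule dist_bound) (simp add: Bcontfun_inverse[OF Phib] Phidiff[simplified])
  qed auto
  then obtain u where u: "Bcontfun (Phi u) = u" by blast
  have ut: "u t = Phi u t" for t
    using Bcontfun_inverse[OF Phib[of u]] u by simp
  have Xu: "X u t = e + D u t" if "0 \<le> t" for t
  proof -
    have "X u t = (exp (L * t) * exp (- L * t)) *\<^sub>R (e + D u t)"
      using that by (simp add: X_def ut[of t] Phi_def max_def)
    also have "exp (L * t) * exp (- L * t) = 1" by (simp flip: exp_add)
    finally show ?thesis by simp
  qed
  define x where "x = (\<lambda>t. if t < 0 then 0 else X u t)"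
  show ?thesis
  proof
    show "continuous_on {0..} x"
      by (rule continuous_on_eq[OF Xc[of _ u]]) (simp add: x_def)
    show "x 0 = e" using Xu[of 0] tau by (simp add: x_def D_def ramp_integral_neg less_imp_le)
    show "x t = 0" if "t < 0" for t using that by (simp add: x_def)
    show "(x has_vector_derivative (A0 *v x t + (\<Sum>i\<in>UNIV. A i *v x (t - \<tau> i)))) (at t)"
      if t: "0 < t" "t \<notin> range \<tau>" for t
    proof -
      have Wd: "((\<lambda>t. ramp_integral (X u) (t - s)) has_vector_derivative x (t - s)) (at t)" if "t - s \<noteq> 0" for s
        using vector_diff_chain_at[of "\<lambda>t. t - s" 1 t "ramp_integral (X u)" "x (t - s)"]
          ramp_integral_deriv[OF Xc[of _ u] that]
        by (simp add: x_def o_def has_vector_derivative_diff_const)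
      have bl: "bounded_linear ((*v) B)" for B :: "real^'n^'n"
        by (rule bounded_bilinear.bounded_linear_right[OF bounded_bilinear_matrix_vector_mult])
      have "((\<lambda>t. e + D u t) has_vector_derivative 0 + (A0 *v x (t - 0) + (\<Sum>i\<in>UNIV. A i *v x (t - \<tau> i)))) (at t)"
        unfolding D_def using t Wd[of 0]
        by (intro has_vector_derivative_add has_vector_derivative_const has_vector_derivative_sum
             bounded_linear.has_vector_derivative[OF bl] Wd) auto
      then have "((\<lambda>t. e + D u t) has_vector_derivative (A0 *v x t + (\<Sum>i\<in>UNIV. A i *v x (t - \<tau> i)))) (at t)"
        by simp
      then show ?thesis
        by (rule has_vector_derivative_transform_within_open[of _ _ _ "{0<..}"])
           (use t in \<open>auto simp: x_def Xu\<close>)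
    qed
  qed
qed

section \<open>Exponential decay and duality\<close>

lemma has_vector_derivative_shifted:
  fixes x :: "real \<Rightarrow> 'e::real_normed_vector"
  assumes "(x has_vector_derivative d) (at (t - c))"
  shows "((\<lambda>t. x (t - c)) has_vector_derivative d) (at t)"
proof -
  have "((\<lambda>t::real. t - c) has_vector_derivative 1 - 0) (at t)"
    by (intro has_vector_derivative_diff has_vector_derivative_id has_vector_derivative_const)
  from vector_diff_chain_at[OF this assms] show ?thesis by (simp add: o_def)
qed

lemma has_vector_derivative_reflected:
  fixes x :: "real \<Rightarrow> 'e::real_normed_vector"
  assumes "(x has_vector_derivative d) (at (c - s))"
  shows "((\<lambda>s. x (c - s)) has_vector_derivative - d) (at s)"
proof -
  have "((\<lambda>s::real. c - s) has_vector_derivative 0 - 1) (at s)"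
    by (intro has_vector_derivative_diff has_vector_derivative_id has_vector_derivative_const)
  from vector_diff_chain_at[OF this assms] show ?thesis by (simp add: o_def)
qed
context dual_lyapunov begin

text \<open>$V(t)$ is the functional at the state $(x(t), \phi(t))$ with $\phi_i(t,s) = \tau_K A_i^T x(t - \tau_i - s)$. By \<open>rate_eq\<close>, \<open>S_zero_psd\<close>
and the dissipation bound, $V' \le -\epsilon\,|(x,\phi)|^2 \le -2\beta V$, and coercivity bounds $|x|^2$ by a multiple of
$V$. The argument starts at $t > 2\tau_K$: there the state involves $x$ only after time $\tau_K$, where a solution
is continuously differentiable whatever its history.\<close>
lemma transposed_decay:
  "\<exists>\<beta>>0. \<forall>x. continuous_on {0..} x \<longrightarrow>
      (\<forall>t>T. (x has_vector_derivative
         (transpose A0 *v x t + (\<Sum>i\<in>UNIV. transpose (A i) *v x (t - \<tau> i)))) (at t)) \<longrightarrow>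
      (\<exists>K\<ge>0. \<forall>t\<ge>0. norm (x t) \<le> K * exp (- \<beta> * t))"
proof -
  obtain K0 where K0: "0 < K0" "\<And>h \<phi>. (\<And>i. continuous_on {- \<tau> i..0} (\<phi> i)) \<Longrightarrow>
      delay_form \<tau> P Q S R h \<phi> \<le> K0 * state_sq \<tau> h \<phi>"
    using delay_form_upper_bound[where P = P, OF delays Q_cont S_cont R_cont] by blast
  \<comment> \<open>The factor 2 is due to the passage from the squared norm to the norm.\<close>
  define \<beta> where "\<beta> = \<epsilon> / (2 * K0)"
  have beta: "0 < \<beta>" "2 * \<beta> * K0 = \<epsilon>" using eps K0 by (auto simp: \<beta>_def)
  show ?thesis
  proof (rule exI, rule conjI[OF beta(1)], intro allI impI)
    fix x :: "real \<Rightarrow> real^'b"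
    assume xc: "continuous_on {0..} x"
      and xd: "\<forall>t>T. (x has_vector_derivative
         (transpose A0 *v x t + (\<Sum>i\<in>UNIV. transpose (A i) *v x (t - \<tau> i)))) (at t)"
    define x' where "x' = (\<lambda>t. transpose A0 *v x t + (\<Sum>i\<in>UNIV. transpose (A i) *v x (t - \<tau> i)))"
    define f where "f = (\<lambda>i t s. T *\<^sub>R (transpose (A i) *v x (t - \<tau> i - s)))"
    define f' where "f' = (\<lambda>i t s. T *\<^sub>R (transpose (A i) *v x' (t - \<tau> i - s)))"
    define U where "U = {2 * T<..}"
    have U: "open U" "convex U" by (simp_all add: U_def)
    have xd': "(x has_vector_derivative x' t) (at t)" if "T < t" for t
      using xd that by (simp add: x'_def)
    have x'c: "continuous_on {T<..} x'"
      unfolding x'_def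
    proof (intro continuous_on_add continuous_on_sum matrix_vector_continuous continuous_on_const)
      show "continuous_on {T<..} x" using T_pos by (intro continuous_on_subset[OF xc]) auto
      show "continuous_on {T<..} (\<lambda>t. x (t - \<tau> i))" for i
      proof (rule continuous_on_compose2[OF xc])
        show "(\<lambda>t. t - \<tau> i) ` {T<..} \<subseteq> {0..}" using tau_le_T[of i] by auto
      qed (intro continuous_intros)
    qed
    have arg: "T < t - \<tau> i - s" if "t \<in> U" "s \<in> {- \<tau> i..0}" for t s i
      using that tau_le_T[of i] by (auto simp: U_def)
    have bl: "bounded_linear ((*v) M)" for M :: "real^'b^'b"
      by (rule bounded_bilinear.bounded_linear_right[OF bounded_bilinear_matrix_vector_mult])
    have fd: "((\<lambda>t. f i t s) has_vector_derivative f' i t s) (at t within U)" if "t \<in> U" "s \<in> {- \<tau> i..0}" for i t s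
    proof -
      have "((\<lambda>t. x (t - (\<tau> i + s))) has_vector_derivative x' (t - (\<tau> i + s))) (at t)"
        by (rule has_vector_derivative_shifted[where x = x], rule xd') (use arg[OF that] in simp)
      then have "((\<lambda>t. x (t - \<tau> i - s)) has_vector_derivative x' (t - \<tau> i - s)) (at t)"
        by (simp add: diff_diff_eq)
      then have "((\<lambda>t. x (t - \<tau> i - s)) has_vector_derivative x' (t - \<tau> i - s)) (at t within U)"
        by (rule has_vector_derivative_at_within)
      then have "((\<lambda>t. transpose (A i) *v x (t - \<tau> i - s)) has_vector_derivative transpose (A i) *v x' (t - \<tau> i - s)) (at t within U)"
        by (rule bounded_linear.has_vector_derivative[OF bl])
      then show ?thesis unfolding f_def f'_def
        by (rule bounded_linear.has_vector_derivative[OF bounded_linear_scaleR_right])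
    qed
    have fs: "(f i t has_vector_derivative - f' i t s) (at s within {- \<tau> i..0})" if "t \<in> U" "s \<in> {- \<tau> i..0}" for i t s
    proof -
      have "((\<lambda>s. x (t - \<tau> i - s)) has_vector_derivative - x' (t - \<tau> i - s)) (at s within {- \<tau> i..0})"
        by (rule has_vector_derivative_at_within, rule has_vector_derivative_reflected[where x = x], rule xd', rule arg[OF that])
      then have "((\<lambda>s. transpose (A i) *v x (t - \<tau> i - s)) has_vector_derivative transpose (A i) *v (- x' (t - \<tau> i - s))) (at s within {- \<tau> i..0})"
        by (rule bounded_linear.has_vector_derivative[OF bl])
      then have "(f i t has_vector_derivative T *\<^sub>R (transpose (A i) *v (- x' (t - \<tau> i - s)))) (at s within {- \<tau> i..0})"
        unfolding f_def by (rule bounded_linear.has_vector_derivative[OF bounded_linear_scaleR_right])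
      then show ?thesis by (simp add: f'_def matrix_vector_minus)
    qed
    have sub: "(\<lambda>p. fst p - \<tau> i - snd p) ` (U \<times> {- \<tau> i..0}) \<subseteq> {T<..}" for i
      using arg[of _ _ i] by auto
    then have sub0: "(\<lambda>p. fst p - \<tau> i - snd p) ` (U \<times> {- \<tau> i..0}) \<subseteq> {0..}" for i
      by (rule order_trans) (use T_pos in auto)
    have fc: "continuous_on (U \<times> {- \<tau> i..0}) (\<lambda>(t, s). f i t s)" for i
    proof -
      have "continuous_on (U \<times> {- \<tau> i..0}) (\<lambda>p. x (fst p - \<tau> i - snd p))"
        by (rule continuous_on_compose2[OF xc _ sub0]) (intro continuous_intros)
      then show ?thesis unfolding f_def case_prod_unfold
        by (intro continuous_on_scaleR matrix_vector_continuous continuous_on_const)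
    qed
    have fc': "continuous_on (U \<times> {- \<tau> i..0}) (\<lambda>(t, s). f' i t s)" for i
    proof -
      have "continuous_on (U \<times> {- \<tau> i..0}) (\<lambda>p. x' (fst p - \<tau> i - snd p))"
        by (rule continuous_on_compose2[OF x'c _ sub]) (intro continuous_intros)
      then show ?thesis unfolding f'_def case_prod_unfold
        by (intro continuous_on_scaleR matrix_vector_continuous continuous_on_const)
    qed
    have fct: "continuous_on {- \<tau> i..0} (f i t)" "continuous_on {- \<tau> i..0} (f' i t)" if "t \<in> U" for i t
    proof -
      have P: "continuous_on {- \<tau> i..0} (Pair t)" "Pair t ` {- \<tau> i..0} \<subseteq> U \<times> {- \<tau> i..0}"
        using that by (auto intro!: continuous_intros)
      show "continuous_on {- \<tau> i..0} (f i t)" "continuous_on {- \<tau> i..0} (f' i t)"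
        using continuous_on_compose2[OF fc[of i] P] continuous_on_compose2[OF fc'[of i] P] by simp_all
    qed
    define V where "V = (\<lambda>t. delay_form \<tau> P Q S R (x t) (\<lambda>i. f i t))"
    have V': "\<exists>d. (V has_real_derivative d) (at t) \<and> d \<le> - 2 * \<beta> * V t" if t: "t \<in> U" for t
    proof -
      define d where "d = delay_form_rate \<tau> P Q S R (x t) (\<lambda>i. f i t) (x' t) (\<lambda>i. f' i t)"
      have "(V has_real_derivative d) (at t within U)"
        unfolding V_def d_def
      proof (rule delay_form_has_derivative[OF Q_cont S_cont R_cont _ _ fd fc fc' t U(2)])
        show "(x has_vector_derivative x' t) (at t within U)" if "t \<in> U" for t
          by (rule has_vector_derivative_at_within, rule xd') (use that T_pos in \<open>auto simp: U_def\<close>)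
        show "continuous_on U x'" using T_pos by (intro continuous_on_subset[OF x'c]) (auto simp: U_def)
      qed
      then have Vd: "(V has_real_derivative d) (at t)"
        using at_within_open[OF t U(1)] by simp
      have "d = dissipation (x t) (\<lambda>i. f i t (- \<tau> i)) (\<lambda>i. f i t) -
         T * (\<Sum>i\<in>UNIV. (f i t 0 - x t) \<bullet> (S i 0 *v (f i t 0 - x t)))"
        unfolding d_def
      proof (rule rate_eq[OF fs[OF t] fct(2)[OF t]])
        show "f i t (- \<tau> i) = T *\<^sub>R (transpose (A i) *v x t)" for i by (simp add: f_def)
        show "x' t = transpose A0 *v x t + (1 / T) *\<^sub>R (\<Sum>i\<in>UNIV. f i t 0)"
          using T_pos by (simp add: x'_def f_def scaleR_sum_right)
      qed
      also have "\<dots> \<le> dissipation (x t) (\<lambda>i. f i t (- \<tau> i)) (\<lambda>i. f i t)"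
        using T_pos by (simp add: sum_nonneg S_zero_psd)
      also have "\<dots> \<le> - \<epsilon> * state_sq \<tau> (x t) (\<lambda>i. f i t)"
        by (rule dissipative_continuous[OF fct(1)[OF t]])
      also have "\<dots> = - 2 * \<beta> * (K0 * state_sq \<tau> (x t) (\<lambda>i. f i t))"
        by (simp add: beta(2)[symmetric])
      also have "\<dots> \<le> - 2 * \<beta> * V t"
        unfolding V_def using beta(1) K0(2)[of "\<lambda>i. f i t" "x t", OF fct(1)[OF t]] by simp
      finally show ?thesis using Vd by blast
    qed
    have Vlow: "\<epsilon> * T * (norm (x t))\<^sup>2 \<le> V t" if t: "t \<in> U" for t
    proof -
      have "0 \<le> (\<Sum>i\<in>UNIV. LINT s:{- \<tau> i..0}|lborel. f i t s \<bullet> f i t s)"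
        by (intro sum_nonneg set_integral_nonneg_Icc inner_ge_zero)
      then have "T * (norm (x t))\<^sup>2 \<le> state_sq \<tau> (x t) (\<lambda>i. f i t)"
        using T_pos by (simp add: state_sq_def T[symmetric] power2_norm_eq_inner)
      then have "\<epsilon> * (T * (norm (x t))\<^sup>2) \<le> \<epsilon> * state_sq \<tau> (x t) (\<lambda>i. f i t)"
        using eps by (intro mult_left_mono) auto
      also have "\<dots> \<le> V t" unfolding V_def by (rule coercive_continuous[OF fct(1)[OF t]])
      finally show ?thesis by (simp add: mult.assoc)
    qed
    \<comment> \<open>Any starting time above twice the largest delay would do.\<close>
    define t1 where "t1 = 2 * T + 1"
    have t1: "t1 \<in> U" "0 \<le> t1" "\<And>t. t1 \<le> t \<Longrightarrow> t \<in> U" using T_pos by (auto simp: t1_def U_def)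
    define W where "W = (\<lambda>t. V t * exp (2 * \<beta> * t))"
    have Wmono: "W t \<le> W t1" if "t1 \<le> t" for t
    proof (rule DERIV_nonpos_imp_nonincreasing[OF that])
      fix r assume "t1 \<le> r" "r \<le> t"
      then obtain d where d: "(V has_real_derivative d) (at r)" "d \<le> - 2 * \<beta> * V r"
        using V' t1(3) by blast
      have "(W has_real_derivative d * exp (2 * \<beta> * r) + (exp (2 * \<beta> * r) * (2 * \<beta>)) * V r) (at r)"
        unfolding W_def using d(1) by (auto intro!: derivative_eq_intros)
      moreover have "d * exp (2 * \<beta> * r) + (exp (2 * \<beta> * r) * (2 * \<beta>)) * V r = exp (2 * \<beta> * r) * (d + 2 * \<beta> * V r)"
        by (simp add: algebra_simps)
      moreover have "exp (2 * \<beta> * r) * (d + 2 * \<beta> * V r) \<le> 0"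
        using d(2) by (intro mult_nonneg_nonpos) auto
      ultimately show "\<exists>y. (W has_real_derivative y) (at r) \<and> y \<le> 0" by auto
    qed
    define c1 where "c1 = sqrt (W t1 / (\<epsilon> * T))"
    have eT: "0 < \<epsilon> * T" using eps T_pos by simp
    have "0 \<le> V t1" using order_trans[OF _ Vlow[OF t1(1)]] eT by simp
    then have c1: "0 \<le> c1" using eT by (simp add: c1_def W_def)
    have late: "norm (x t) \<le> c1 * exp (- \<beta> * t)" if "t1 \<le> t" for t
    proof -
      have "\<epsilon> * T * (norm (x t))\<^sup>2 * exp (2 * \<beta> * t) \<le> W t"
        unfolding W_def using Vlow[OF t1(3)[OF that]] by (intro mult_right_mono) auto
      also have "\<dots> \<le> W t1" by (rule Wmono[OF that])
      finally have "(norm (x t))\<^sup>2 * exp (2 * \<beta> * t) \<le> W t1 / (\<epsilon> * T)"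
        using eT by (simp add: field_simps)
      moreover have "(norm (x t))\<^sup>2 * exp (2 * \<beta> * t) = (norm (x t) * exp (\<beta> * t))\<^sup>2"
        by (simp add: power_mult_distrib exp_double[symmetric] mult.assoc)
      ultimately have "norm (x t) * exp (\<beta> * t) \<le> c1"
        unfolding c1_def by (simp add: real_le_rsqrt)
      then have "norm (x t) * exp (\<beta> * t) * exp (- \<beta> * t) \<le> c1 * exp (- \<beta> * t)"
        by (rule mult_right_mono) simp
      then show ?thesis by (simp add: mult.assoc flip: exp_add)
    qed
    have "compact (x ` {0..t1})"
      by (intro compact_continuous_image continuous_on_subset[OF xc]) auto
    then have "bounded (x ` {0..t1})" by (rule compact_imp_bounded)
    then obtain c0 where c0: "0 < c0" "\<And>t. t \<in> {0..t1} \<Longrightarrow> norm (x t) \<le> c0"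
      unfolding bounded_pos by blast
    have early: "norm (x t) \<le> c0 * exp (\<beta> * t1) * exp (- \<beta> * t)" if "0 \<le> t" "t \<le> t1" for t
    proof -
      have "0 \<le> \<beta> * (t1 - t)" using that beta(1) by simp
      then have "1 \<le> exp (\<beta> * t1) * exp (- \<beta> * t)"
        by (simp add: algebra_simps flip: exp_add)
      then have "c0 * 1 \<le> c0 * (exp (\<beta> * t1) * exp (- \<beta> * t))"
        using c0(1) by (intro mult_left_mono) auto
      then show ?thesis using c0(2)[of t] that by (simp add: mult.assoc)
    qed
    show "\<exists>K\<ge>0. \<forall>t\<ge>0. norm (x t) \<le> K * exp (- \<beta> * t)"
    proof (intro exI[of _ "c0 * exp (\<beta> * t1) + c1"] conjI allI impI)
      show "0 \<le> c0 * exp (\<beta> * t1) + c1" using c0 c1 by simp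
      fix t :: real assume t: "0 \<le> t"
      have "0 \<le> c1 * exp (- \<beta> * t)" "0 \<le> c0 * exp (\<beta> * t1) * exp (- \<beta> * t)" using c0 c1 by simp_all
      then show "norm (x t) \<le> (c0 * exp (\<beta> * t1) + c1) * exp (- \<beta> * t)"
        using late[of t] early[of t] t unfolding distrib_right by linarith
    qed
  qed
qed

end

lemma solution_continuous:
  fixes \<tau> :: "'k::{finite,linorder} \<Rightarrow> real"
  assumes y: "is_solution A0 A \<tau> \<phi> y" and phi: "continuous_on {- tau_last \<tau>..0} \<phi>"
  shows "continuous_on {- tau_last \<tau>..} y"
proof -
  have "continuous_on {- tau_last \<tau>..0} y"
    using y by (intro continuous_on_eq[OF phi]) (auto simp: is_solution_def)
  moreover have "continuous_on {0..} y"
    using y by (intro continuous_on_vector_derivative) (auto simp: is_solution_def)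
  ultimately have "continuous_on ({- tau_last \<tau>..0} \<union> {0..}) y"
    by (intro continuous_on_closed_Un) auto
  then show ?thesis by (rule continuous_on_subset) auto
qed

text \<open>Let $y$ solve the given system and $x$ the transposed one. In the derivative of $x(r) \cdot y(t-r)$ the
terms with $A_0$ cancel, and those with $A_i$ are the difference of one function at $r - \tau_i$ and at $r$. Integrating over $[0,t]$
leaves an integral over $[t-\tau_i,t]$, in which $y$ enters only through its initial history.\<close>
lemma solution_duality:
  fixes \<tau> :: "'k::{finite,linorder} \<Rightarrow> real" and y :: "real \<Rightarrow> real^'n::finite"
  assumes tau: "strict_mono \<tau>" "\<And>i. 0 < \<tau> i"
    and y: "is_solution A0 A \<tau> \<phi> y" and phi: "continuous_on {- tau_last \<tau>..0} \<phi>"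
    and x: "continuous_on {0..} x" "\<And>t. t < 0 \<Longrightarrow> x t = 0"
      "\<And>t. 0 < t \<Longrightarrow> t \<notin> range \<tau> \<Longrightarrow> (x has_vector_derivative
         (transpose A0 *v x t + (\<Sum>i\<in>UNIV. transpose (A i) *v x (t - \<tau> i)))) (at t)"
    and t: "0 \<le> t"
  shows "x 0 \<bullet> y t = x t \<bullet> y 0 + (\<Sum>i\<in>UNIV. integral {t - \<tau> i..t} (\<lambda>u. x u \<bullet> (A i *v y (t - \<tau> i - u))))"
    and "\<And>i. (\<lambda>u. x u \<bullet> (A i *v y (t - \<tau> i - u))) integrable_on {t - \<tau> i..t}"
proof -
  note yc = solution_continuous[OF y phi]
  have le: "\<tau> i \<le> tau_last \<tau>" "0 \<le> \<tau> i" for i using tau_le_last[OF tau(1)] tau(2)[of i] by (auto intro: less_imp_le)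
  define h where "h = (\<lambda>i u. x u \<bullet> (A i *v y (t - \<tau> i - u)))"
  have hc: "continuous_on {0..t} (h i)" for i
    unfolding h_def
    by (intro continuous_intros matrix_vector_continuous continuous_on_subset[OF x(1)] continuous_on_compose2[OF yc])
       (use le[of i] in auto)
  have h0: "(h i has_integral 0) {- \<tau> i..0}" for i
    by (rule has_integral_spike_finite[of "{0}" _ _ "\<lambda>_. 0"]) (auto simp: h_def x(2))
  have hint: "h i integrable_on {- \<tau> i..t}" for i
  proof (rule Henstock_Kurzweil_Integration.integrable_combine)
    show "h i integrable_on {- \<tau> i..0}" using h0[of i] by blast
    show "h i integrable_on {0..t}" by (rule integrable_continuous_interval[OF hc])
  qed (use le[of i] t in auto)
  show "(\<lambda>u. x u \<bullet> (A i *v y (t - \<tau> i - u))) integrable_on {t - \<tau> i..t}" for i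
    by (rule integrable_on_subinterval[OF hint[of i, unfolded h_def]]) (use le t in auto)
  have yd: "(y has_vector_derivative (A0 *v y s + (\<Sum>i\<in>UNIV. A i *v y (s - \<tau> i)))) (at s)" if "0 < s" for s
  proof -
    have eq: "at s within {0..} = at s" using that by (intro at_within_interior) (simp add: interior_real_atLeast)
    have "(y has_vector_derivative (A0 *v y s + (\<Sum>i\<in>UNIV. A i *v y (s - \<tau> i)))) (at s within {0..})"
      using y that unfolding is_solution_def by (blast intro: less_imp_le)
    then show ?thesis unfolding eq .
  qed
  have y0: "(\<lambda>r. x r \<bullet> y (t - r)) t = x t \<bullet> y 0" "(\<lambda>r. x r \<bullet> y (t - r)) 0 = x 0 \<bullet> y t" by simp_all
  have main: "((\<lambda>r. \<Sum>i\<in>UNIV. h i (r - \<tau> i) - h i r) has_integral (x t \<bullet> y (t - t) - x 0 \<bullet> y (t - 0))) {0..t}"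
  proof (rule fundamental_theorem_of_calculus_interior_strong[OF _ t])
    show "finite (range \<tau>)" by simp
    show "continuous_on {0..t} (\<lambda>r. x r \<bullet> y (t - r))"
      by (intro continuous_intros continuous_on_subset[OF x(1)] continuous_on_compose2[OF yc])
         (use tau_last_pos[of \<tau>] tau in auto)
    fix r assume r: "r \<in> {0<..<t} - range \<tau>"
    have "0 < t - r" using r by auto
    then have dy: "((\<lambda>r. y (t - r)) has_vector_derivative - (A0 *v y (t - r) + (\<Sum>i\<in>UNIV. A i *v y (t - r - \<tau> i)))) (at r)"
      by (rule has_vector_derivative_reflected[where x = y, OF yd])
    have "((\<lambda>r. x r \<bullet> y (t - r)) has_vector_derivative
       x r \<bullet> (- (A0 *v y (t - r) + (\<Sum>i\<in>UNIV. A i *v y (t - r - \<tau> i)))) +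
       (transpose A0 *v x r + (\<Sum>i\<in>UNIV. transpose (A i) *v x (r - \<tau> i))) \<bullet> y (t - r)) (at r)"
      by (rule bounded_bilinear.has_vector_derivative[OF bounded_bilinear_inner x(3) dy]) (use r in auto)
    also have "x r \<bullet> (- (A0 *v y (t - r) + (\<Sum>i\<in>UNIV. A i *v y (t - r - \<tau> i)))) +
       (transpose A0 *v x r + (\<Sum>i\<in>UNIV. transpose (A i) *v x (r - \<tau> i))) \<bullet> y (t - r) =
       (\<Sum>i\<in>UNIV. h i (r - \<tau> i) - h i r)"
    proof -
      have tr: "(transpose M *v a) \<bullet> b = a \<bullet> (M *v b)" for M :: "real^'n^'n" and a b
        by (metis inner_commute inner_transpose_matrix_vector)
      have e: "h i (r - \<tau> i) = x (r - \<tau> i) \<bullet> (A i *v y (t - r))"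
        "h i r = x r \<bullet> (A i *v y (t - r - \<tau> i))" for i
        by (simp_all add: h_def algebra_simps)
      show ?thesis
        unfolding e inner_add_left inner_sum_left tr inner_minus_right inner_add_right inner_sum_right sum_subtractf
        by simp
    qed
    finally show "((\<lambda>r. x r \<bullet> y (t - r)) has_vector_derivative (\<Sum>i\<in>UNIV. h i (r - \<tau> i) - h i r)) (at r)" .
  qed
  have shift: "((\<lambda>r. h i (r - \<tau> i)) has_integral integral {- \<tau> i..t - \<tau> i} (h i)) {0..t}" for i
  proof -
    have "(h i has_integral integral {- \<tau> i..t - \<tau> i} (h i)) (cbox (- \<tau> i) (t - \<tau> i))"
      using integrable_integral[OF integrable_on_subinterval[OF hint[of i], of "- \<tau> i" "t - \<tau> i"]] le by simp
    from has_integral_affinity[OF this, of 1 "- \<tau> i"] show ?thesis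
      by (simp add: image_affinity_atLeastAtMost)
  qed
  \<comment> \<open>Before time 0 the function h vanishes, so only the last delay interval survives.\<close>
  have part: "integral {- \<tau> i..t - \<tau> i} (h i) - integral {0..t} (h i) = - integral {t - \<tau> i..t} (h i)" for i
  proof -
    have "integral {- \<tau> i..t - \<tau> i} (h i) + integral {t - \<tau> i..t} (h i) = integral {- \<tau> i..t} (h i)"
      using le t by (intro Henstock_Kurzweil_Integration.integral_combine hint) auto
    moreover have "integral {- \<tau> i..0} (h i) + integral {0..t} (h i) = integral {- \<tau> i..t} (h i)"
      using le t by (intro Henstock_Kurzweil_Integration.integral_combine hint) auto
    ultimately show ?thesis using integral_unique[OF h0[of i]] by simp
  qed
  have "((\<lambda>r. \<Sum>i\<in>UNIV. h i (r - \<tau> i) - h i r) has_integral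
     (\<Sum>i\<in>UNIV. integral {- \<tau> i..t - \<tau> i} (h i) - integral {0..t} (h i))) {0..t}"
    by (intro has_integral_sum has_integral_diff shift integrable_integral integrable_continuous_interval hc) simp
  from has_integral_unique[OF main this]
  show "x 0 \<bullet> y t = x t \<bullet> y 0 + (\<Sum>i\<in>UNIV. integral {t - \<tau> i..t} (\<lambda>u. x u \<bullet> (A i *v y (t - \<tau> i - u))))"
    unfolding part by (simp add: sum_negf h_def)
qed

text \<open>Apply \<open>solution_duality\<close> to the fundamental solutions of the transposed system with initial values the
standard basis vectors: the components of $y(t)$ are bounded by the decay of these solutions on $[t-\tau_K,t]$ times the
norm of the initial history.\<close>
lemma (in dual_lyapunov) stable_system: "exponentially_stable A0 A \<tau>"
proof -
  obtain \<beta> where beta: "0 < \<beta>"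
    "\<And>x. continuous_on {0..} x \<Longrightarrow>
      (\<And>t. T < t \<Longrightarrow> (x has_vector_derivative
         (transpose A0 *v x t + (\<Sum>i\<in>UNIV. transpose (A i) *v x (t - \<tau> i)))) (at t)) \<Longrightarrow>
      \<exists>K\<ge>0. \<forall>t\<ge>0. norm (x t) \<le> K * exp (- \<beta> * t)"
    using transposed_decay by blast
  define good where "good = (\<lambda>k (x, K). continuous_on {0..} x \<and> x 0 = axis k 1 \<and> (\<forall>t<0. x t = 0) \<and>
     (\<forall>t>0. t \<notin> range \<tau> \<longrightarrow> (x has_vector_derivative
         (transpose A0 *v x t + (\<Sum>i\<in>UNIV. transpose (A i) *v x (t - \<tau> i)))) (at t)) \<and>
     0 \<le> K \<and> (\<forall>t\<ge>0. norm (x t) \<le> K * exp (- \<beta> * t)))"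
  have "\<exists>p. good k p" for k :: 'b
  proof -
    obtain x where x: "continuous_on {0..} x" "x 0 = axis k 1" "\<And>t. t < 0 \<Longrightarrow> x t = 0"
      "\<And>t. 0 < t \<Longrightarrow> t \<notin> range \<tau> \<Longrightarrow> (x has_vector_derivative
         (transpose A0 *v x t + (\<Sum>i\<in>UNIV. transpose (A i) *v x (t - \<tau> i)))) (at t)"
      using delay_fundamental_solution[of \<tau> "axis k 1" "transpose A0" "\<lambda>i. transpose (A i)", OF delays(2)] by blast
    have "(x has_vector_derivative (transpose A0 *v x t + (\<Sum>i\<in>UNIV. transpose (A i) *v x (t - \<tau> i)))) (at t)" if "T < t" for t
    proof (rule x(4))
      show "0 < t" using that T_pos by simp
      show "t \<notin> range \<tau>"
      proof
        assume "t \<in> range \<tau>"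
        then obtain i where "t = \<tau> i" by blast
        then show False using that tau_le_T[of i] by simp
      qed
    qed
    from beta(2)[OF x(1) this] obtain K where K: "0 \<le> K" "\<forall>t\<ge>0. norm (x t) \<le> K * exp (- \<beta> * t)" by blast
    have "good k (x, K)" using x(1-3) K x(4) unfolding good_def prod.case by blast
    then show ?thesis ..
  qed
  then have "\<forall>k. \<exists>p. good k p" by blast
  from choice[OF this] obtain p where p: "\<And>k. good k (p k)" by blast
  define X where "X = (\<lambda>k. fst (p k))"
  define K where "K = (\<lambda>k. snd (p k))"
  have XK: "good k (X k, K k)" for k using p[of k] by (simp add: X_def K_def)
  have X: "continuous_on {0..} (X k)" "X k 0 = axis k 1" "\<And>t. t < 0 \<Longrightarrow> X k t = 0"
     "\<And>t. 0 < t \<Longrightarrow> t \<notin> range \<tau> \<Longrightarrow> (X k has_vector_derivative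
         (transpose A0 *v X k t + (\<Sum>i\<in>UNIV. transpose (A i) *v X k (t - \<tau> i)))) (at t)"
     and K: "0 \<le> K k" "\<And>t. 0 \<le> t \<Longrightarrow> norm (X k t) \<le> K k * exp (- \<beta> * t)" for k
    using XK[of k] unfolding good_def prod.case by blast+
  define c where "c = 1 + (\<Sum>i\<in>UNIV. \<tau> i * (exp (\<beta> * T) * norm (A i)))"
  have c: "0 \<le> c" unfolding c_def by (intro add_nonneg_nonneg sum_nonneg mult_nonneg_nonneg tau_nonneg) auto
  define L where "L = (\<Sum>k\<in>UNIV. K k * c) + 1"
  have L: "0 < L" unfolding L_def using K(1) c by (intro add_nonneg_pos sum_nonneg) auto
  show ?thesis
    unfolding exponentially_stable_def
  proof (rule exI[of _ L], rule conjI[OF L], rule exI[of _ \<beta>], rule conjI[OF beta(1)], intro allI impI)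
    fix \<phi> y t
    assume phi: "continuous_on {- tau_last \<tau>..0} \<phi>" and y: "is_solution A0 A \<tau> \<phi> y" and t: "0 \<le> (t :: real)"
    define m where "m = (SUP s\<in>{- tau_last \<tau>..0}. norm (\<phi> s))"
    have bdd: "bdd_above ((\<lambda>s. norm (\<phi> s)) ` {- tau_last \<tau>..0})"
      by (intro compact_imp_bounded[THEN bounded_imp_bdd_above] compact_continuous_image continuous_on_norm phi) simp
    have m: "norm (y s) \<le> m" if "s \<in> {- T..0}" for s
    proof -
      have "norm (\<phi> s) \<le> m" unfolding m_def using that by (intro cSUP_upper bdd) (simp add: T)
      then show ?thesis using y that by (simp add: is_solution_def T)
    qed
    have m0: "0 \<le> m" using order_trans[OF norm_ge_zero m[of 0]] T_pos by simp
    have comp: "\<bar>y t $ k\<bar> \<le> K k * c * (exp (- \<beta> * t) * m)" for k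
    proof -
      note D = solution_duality[where x = "X k", OF delays y phi X(1) X(3) X(4) t]
      have "\<bar>y t $ k\<bar> = \<bar>X k 0 \<bullet> y t\<bar>" by (simp add: X(2) inner_axis')
      also have "X k 0 \<bullet> y t = X k t \<bullet> y 0 + (\<Sum>i\<in>UNIV. integral {t - \<tau> i..t} (\<lambda>u. X k u \<bullet> (A i *v y (t - \<tau> i - u))))"
        by (rule D(1))
      also have "\<bar>\<dots>\<bar> \<le> \<bar>X k t \<bullet> y 0\<bar> + (\<Sum>i\<in>UNIV. \<bar>integral {t - \<tau> i..t} (\<lambda>u. X k u \<bullet> (A i *v y (t - \<tau> i - u)))\<bar>)"
        by (rule order_trans[OF abs_triangle_ineq add_left_mono[OF sum_abs]])
      also have "\<dots> \<le> K k * exp (- \<beta> * t) * m + (\<Sum>i\<in>UNIV. \<tau> i * (K k * exp (- \<beta> * t) * exp (\<beta> * T) * norm (A i) * m))"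
      proof (intro add_mono sum_mono)
        have "\<bar>X k t \<bullet> y 0\<bar> \<le> norm (X k t) * norm (y 0)" by (rule Cauchy_Schwarz_ineq2)
        also have "\<dots> \<le> K k * exp (- \<beta> * t) * m"
          using K t m[of 0] T_pos by (intro mult_mono) auto
        finally show "\<bar>X k t \<bullet> y 0\<bar> \<le> K k * exp (- \<beta> * t) * m" .
        fix i
        let ?b = "K k * exp (- \<beta> * t) * exp (\<beta> * T) * norm (A i) * m"
        have "norm (integral {t - \<tau> i..t} (\<lambda>u. X k u \<bullet> (A i *v y (t - \<tau> i - u)))) \<le> integral {t - \<tau> i..t} (\<lambda>_. ?b)"
        proof (rule integral_norm_bound_integral[OF D(2)])
          show "(\<lambda>_. ?b) integrable_on {t - \<tau> i..t}" by (intro integrable_continuous_interval continuous_on_const)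
          fix u assume u: "u \<in> {t - \<tau> i..t}"
          have Xu: "norm (X k u) \<le> K k * exp (- \<beta> * t) * exp (\<beta> * T)"
          proof (cases "u < 0")
            case True
            then show ?thesis using K(1)[of k] by (simp add: X(3))
          next
            case False
            have "- \<beta> * u \<le> - \<beta> * t + \<beta> * T"
              using u tau_le_T[of i] beta(1) mult_left_mono[of t "u + T" \<beta>] by (simp add: algebra_simps)
            then have "exp (- \<beta> * u) \<le> exp (- \<beta> * t) * exp (\<beta> * T)" by (simp flip: exp_add)
            then have "K k * exp (- \<beta> * u) \<le> K k * (exp (- \<beta> * t) * exp (\<beta> * T))"
              by (rule mult_left_mono) (rule K(1))
            then show ?thesis using K(2)[of u k] False by (simp add: mult.assoc)
          qed
          have yu: "norm (y (t - \<tau> i - u)) \<le> m" using u tau_le_T[of i] by (intro m) auto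
          have "norm (X k u \<bullet> (A i *v y (t - \<tau> i - u))) \<le> norm (X k u) * norm (A i) * norm (y (t - \<tau> i - u))"
            using abs_inner_matrix_vector_le by simp
          also have "\<dots> \<le> ?b"
            using Xu yu K(1)[of k] by (intro mult_mono) auto
          finally show "norm (X k u \<bullet> (A i *v y (t - \<tau> i - u))) \<le> ?b" .
        qed
        also have "\<dots> = \<tau> i * ?b" using tau_nonneg[of i] by simp
        finally show "\<bar>integral {t - \<tau> i..t} (\<lambda>u. X k u \<bullet> (A i *v y (t - \<tau> i - u)))\<bar> \<le> \<tau> i * ?b" by simp
      qed
      also have "\<dots> = K k * c * (exp (- \<beta> * t) * m)"
        by (simp add: c_def distrib_left distrib_right sum_distrib_left sum_distrib_right mult_ac)
      finally show ?thesis .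
    qed
    have e0: "0 \<le> exp (- \<beta> * t) * m" using m0 by simp
    have "norm (y t) \<le> (\<Sum>k\<in>UNIV. \<bar>y t $ k\<bar>)" by (rule norm_le_l1_cart)
    also have "\<dots> \<le> (\<Sum>k\<in>UNIV. K k * c * (exp (- \<beta> * t) * m))" by (intro sum_mono comp)
    also have "\<dots> = (\<Sum>k\<in>UNIV. K k * c) * (exp (- \<beta> * t) * m)" by (simp add: sum_distrib_right)
    also have "\<dots> \<le> L * (exp (- \<beta> * t) * m)" unfolding L_def by (intro mult_right_mono e0) simp
    finally show "norm (y t) \<le> L * exp (- \<beta> * t) * (SUP s\<in>{- tau_last \<tau>..0}. norm (\<phi> s))"
      by (simp add: m_def mult.assoc)
  qed
qed

section \<open>From the membership conditions to the functional\<close>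

lemma set_integrable_bounded_linear:
  fixes F :: "'c::euclidean_space \<Rightarrow> 'd::euclidean_space"
  assumes F: "bounded_linear F" and f: "set_integrable M X f"
  shows "set_integrable M X (\<lambda>s. F (f s))"
  using integrable_bounded_linear[OF F f[unfolded set_integrable_def]]
  by (simp add: set_integrable_def linear_cmul[OF bounded_linear.linear[OF F]])

lemma bounded_linear_matrix_mult: "bounded_linear (\<lambda>X. (M :: real^'b^'a) ** (X :: real^'c^'b))"
  by (rule linear_conv_bounded_linear[THEN iffD1], rule linearI)
     (simp_all add: matrix_add_ldistrib matrix_scalar_ac scalar_matrix_assoc)

lemma bounded_linear_stack_zero: "bounded_linear (stack_zero :: real^'n::finite^'a::finite \<Rightarrow> real^'n^('a + 'b::finite))"
  by (rule linear_conv_bounded_linear[THEN iffD1], rule linearI)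
     (auto simp: stack_zero_def vec_eq_iff split: sum.split)

lemma stack_zero_mult: "stack_zero M *v x = join_vec (M *v x) 0"
  by (auto simp: stack_zero_def join_vec_def vec_eq_iff matrix_vector_mult_def split: sum.split)

text \<open>The vector of the delayed states, indexed like the rows of \<open>block_row\<close> and \<open>block_diag\<close>.\<close>
definition stack_vec :: "('k \<Rightarrow> real^'n) \<Rightarrow> real^('k::finite \<times> 'n::finite)" where
  "stack_vec v = (\<chi> p. v (fst p) $ snd p)"

lemma sum_UNIV_prod: "(\<Sum>p\<in>UNIV. f (fst p) (snd p)) = (\<Sum>i\<in>UNIV. \<Sum>a\<in>UNIV. f i a)"
  for f :: "'k::finite \<Rightarrow> 'n::finite \<Rightarrow> real"
  by (simp add: sum.cartesian_product case_prod_unfold flip: UNIV_Times_UNIV)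

lemma block_row_mult: "block_row M *v stack_vec v = (\<Sum>i\<in>UNIV. M i *v v i)"
  using sum_UNIV_prod[of "\<lambda>i a. M i $ _ $ a * v i $ a"]
  by (simp add: vec_eq_iff matrix_vector_mult_def block_row_def stack_vec_def)

lemma block_diag_mult: "block_diag M *v stack_vec v = stack_vec (\<lambda>i. M i *v v i)"
proof -
  have "(\<Sum>q\<in>UNIV. (if fst p = fst q then M (fst p) $ snd p $ snd q else 0) * v (fst q) $ snd q) =
     (\<Sum>a\<in>UNIV. M (fst p) $ snd p $ a * v (fst p) $ a)" for p
  proof -
    have "(\<Sum>q\<in>UNIV. (if fst p = fst q then M (fst p) $ snd p $ snd q else 0) * v (fst q) $ snd q) =
      (\<Sum>i\<in>UNIV. \<Sum>a\<in>UNIV. (if fst p = i then M (fst p) $ snd p $ a else 0) * v i $ a)"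
      by (rule sum_UNIV_prod)
    also have "\<dots> = (\<Sum>i\<in>UNIV. if fst p = i then \<Sum>a\<in>UNIV. M (fst p) $ snd p $ a * v i $ a else 0)"
      by (intro sum.cong refl) auto
    finally show ?thesis by simp
  qed
  then show ?thesis by (simp add: vec_eq_iff matrix_vector_mult_def block_diag_def stack_vec_def)
qed

lemma inner_stack_vec: "stack_vec v \<bullet> stack_vec w = (\<Sum>i\<in>UNIV. v i \<bullet> w i)"
  using sum_UNIV_prod[of "\<lambda>i a. v i $ a * w i $ a"] by (simp add: inner_vec_def stack_vec_def)

text \<open>Adding $a I$ to every $S_i$ adds $a$ times the part of the squared norm that belongs to $\phi$.\<close>
lemma delay_form_shift:
  fixes S :: "'k::{finite,linorder} \<Rightarrow> real \<Rightarrow> real^'n::finite^'n"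
  assumes S: "\<And>i. set_integrable lborel {- \<tau> i..0} (S i)"
    and phi: "\<And>i. \<phi> i \<in> borel_measurable borel" "\<And>i s. norm (\<phi> i s) \<le> c"
  shows "delay_form \<tau> P Q (\<lambda>i s. S i s + a *\<^sub>R mat 1) R h \<phi> =
     delay_form \<tau> P Q S R h \<phi> + a * (state_sq \<tau> h \<phi> - tau_last \<tau> * (h \<bullet> h))"
proof -
  have 1: "has_set_integral {- \<tau> i..0} (\<lambda>s. \<phi> i s \<bullet> (S i s *v \<phi> i s)) (LINT s:{- \<tau> i..0}|lborel. \<phi> i s \<bullet> (S i s *v \<phi> i s))" for i
    by (intro has_set_integralI set_integrable_inner_matrix_vector[OF S phi phi])
  have "set_integrable lborel {- \<tau> i..0} (\<lambda>s. \<phi> i s \<bullet> (mat 1 *v \<phi> i s))" for i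
    by (rule set_integrable_inner_matrix_vector[OF _ phi phi]) (intro set_integrable_continuous continuous_on_const)
  then have 2: "has_set_integral {- \<tau> i..0} (\<lambda>s. \<phi> i s \<bullet> \<phi> i s) (LINT s:{- \<tau> i..0}|lborel. \<phi> i s \<bullet> \<phi> i s)" for i
    by (intro has_set_integralI) simp
  have "(LINT s:{- \<tau> i..0}|lborel. \<phi> i s \<bullet> ((S i s + a *\<^sub>R mat 1) *v \<phi> i s)) =
     (LINT s:{- \<tau> i..0}|lborel. \<phi> i s \<bullet> (S i s *v \<phi> i s)) + a * (LINT s:{- \<tau> i..0}|lborel. \<phi> i s \<bullet> \<phi> i s)" for i
    using has_set_integral_add[OF 1[of i] has_set_integral_mult_right[OF 2[of i], of a]]
    by (simp add: has_set_integral_def matrix_vector_mult_add_rdistrib scaleR_matrix_vector_assoc[symmetric] inner_add_right)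
  then show ?thesis
    by (simp add: delay_form_def state_sq_def sum.distrib sum_distrib_left[symmetric] algebra_simps)
qed

lemma has_form_identity:
  assumes v: "v \<in> borel_measurable borel" "\<And>s. norm (v s) \<le> c"
  shows "\<exists>d\<ge>0. has_form T (\<lambda>_. mat 1) (\<lambda>_ _. 0) v d"
proof -
  have "set_integrable lborel {-T..0} (\<lambda>s. v s \<bullet> (mat 1 *v v s))"
    by (rule set_integrable_inner_matrix_vector[OF _ v v]) (intro set_integrable_continuous continuous_on_const)
  then have "has_set_integral {-T..0} (\<lambda>s. v s \<bullet> (mat 1 *v v s)) (LINT s:{-T..0}|lborel. v s \<bullet> v s)"
    using has_set_integralI[of "{-T..0}" "\<lambda>s. v s \<bullet> (mat 1 *v v s)"] by simp
  moreover have "0 \<le> (LINT s:{-T..0}|lborel. v s \<bullet> v s)"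
    by (intro set_integral_nonneg_Icc inner_ge_zero)
  moreover have "has_set_integral ({-T..0} \<times> {-T..0}) (\<lambda>z. v (fst z) \<bullet> (0 *v v (snd z))) 0"
    by (simp add: has_set_integral_def set_integrable_def)
  ultimately show ?thesis
    unfolding has_form_def
    by (intro exI[of _ "LINT s:{-T..0}|lborel. v s \<bullet> v s"] exI[of _ "0::real"] conjI) simp_all
qed

theorem theorem12:
  fixes \<tau> :: "'k::{finite,linorder} \<Rightarrow> real"
    and A0 P C0 :: "real^'n::finite^'n"
    and A C :: "'k \<Rightarrow> real^'n^'n"
    and d :: nat and \<epsilon> T :: real
    and Q Q' S S' B :: "'k \<Rightarrow> real \<Rightarrow> real^'n^'n"
    and R Rs Rt G :: "'k \<Rightarrow> 'k \<Rightarrow> real \<Rightarrow> real \<Rightarrow> real^'n^'n"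
    and D1 :: "real^('n + 'k \<times> 'n)^('n + 'k \<times> 'n)"
    and V :: "'k \<Rightarrow> real \<Rightarrow> real^'n^('n + 'k \<times> 'n)"
    and M0 M F1 :: "real \<Rightarrow> real^('n + 'n)^('n + 'n)"
    and N0 E0 :: "real \<Rightarrow> real \<Rightarrow> real^'n^'n"
    and N H1 :: "real \<Rightarrow> real \<Rightarrow> real^('n + 'n)^('n + 'n)"
    and D0 D F2 :: "real \<Rightarrow> real^(('n + 'k \<times> 'n) + 'n)^(('n + 'k \<times> 'n) + 'n)"
    and E H2 :: "real \<Rightarrow> real \<Rightarrow> real^(('n + 'k \<times> 'n) + 'n)^(('n + 'k \<times> 'n) + 'n)"
  assumes delays: "strict_mono \<tau>" "\<And>i. 0 < \<tau> i"
    and T: "T = tau_last \<tau>"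
    and eps: "0 < \<epsilon>"
    and Q_W2: "\<And>i. has_W2_derivative (- \<tau> i) 0 (Q i) (Q' i)"
    and S_W2: "\<And>i. has_W2_derivative (- \<tau> i) 0 (S i) (S' i)"
    and R_W2: "\<And>i j. has_W2_partials (- \<tau> i) 0 (- \<tau> j) 0 (R i j) (Rs i j) (Rt i j)"
    and R_sections: "\<And>i j c. c \<in> {- \<tau> i, 0} \<Longrightarrow> \<exists>r'. has_W2_derivative (- \<tau> j) 0 (R i j c) r'"
    and FH1: "(F1, H1) \<in> Theta \<tau>"
    and FH2: "(F2, H2) \<in> Theta \<tau>"
    and MN0: "(M0, N0) = L1_map \<tau> (P - \<epsilon> *\<^sub>R mat 1) Q (\<lambda>i s. S i s - \<epsilon> *\<^sub>R mat 1) R"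
    and M: "\<And>s. M s = M0 s + F1 s - \<epsilon> *\<^sub>R mat 1"
    and N: "\<And>s \<theta>. N s \<theta> = block_mat 0 0 0 (N0 s \<theta>) + H1 s \<theta>"
    and C0: "C0 = A0 ** P +
          (\<Sum>i\<in>UNIV. T *\<^sub>R (A i ** transpose (Q i (- \<tau> i))) + (1/2) *\<^sub>R S i 0)"
    and C: "\<And>i. C i = T *\<^sub>R (A i ** S i (- \<tau> i))"
    and D1: "D1 = block_mat (C0 + transpose C0 + \<epsilon> *\<^sub>R mat 1) (block_row C)
          (transpose (block_row C)) (block_diag (\<lambda>i. - S i (- \<tau> i)))"
    and B: "\<And>i s. B i s = A0 ** Q i s + Q' i s + (\<Sum>j\<in>UNIV. A j ** R j i (- \<tau> j) s)"
    and V: "\<And>i s. V i s = stack_zero (B i s)"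
    and G: "\<And>i j s \<theta>. G i j s \<theta> = Rs i j s \<theta> + transpose (Rs j i \<theta> s)"
    and DE0: "(D0, E0) = L1_map \<tau> D1 V (\<lambda>i s. S' i s + \<epsilon> *\<^sub>R mat 1) G"
    and D: "\<And>s. D s = D0 s + F2 s"
    and E: "\<And>s \<theta>. E s \<theta> = block_mat 0 0 0 (E0 s \<theta>) + H2 s \<theta>"
    and MN_Xi: "(M, N) \<in> Xi \<tau> d"
    and DE_Xi: "(\<lambda>s. - D s, \<lambda>s \<theta>. - E s \<theta>) \<in> Xi \<tau> d"
    and P_eq: "\<And>i. P = T *\<^sub>R transpose (Q i 0) + T *\<^sub>R S i 0"
    and S_sym: "\<And>i s. s \<in> {- \<tau> i..0} \<Longrightarrow> S i s = transpose (S i s)"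
    and R_sym: "\<And>i j s \<theta>. s \<in> {- \<tau> i..0} \<Longrightarrow> \<theta> \<in> {- \<tau> j..0} \<Longrightarrow>
          R i j s \<theta> = transpose (R j i \<theta> s)"
    and QR: "\<And>i j s. s \<in> {- \<tau> j..0} \<Longrightarrow> Q j s = R i j 0 s"
  shows "exponentially_stable A0 A \<tau>"
proof -
  have T0: "0 < T" using tau_last_pos[of \<tau>] delays T by simp
  have Icc: "{- \<tau> i..0} \<in> sets borel" "emeasure lborel {- \<tau> i..0} < \<infinity>" for i
    by (simp_all add: emeasure_lborel_Icc_eq)
  interpret F: dual_functional \<tau> A0 P C0 A C T Q Q' S S' B R Rs G
  proof
    show "set_integrable lborel {- \<tau> i..0} (Q' i)" "set_integrable lborel {- \<tau> i..0} (S' i)" for i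
      using Q_W2[of i] S_W2[of i] Icc[of i] by (auto simp: has_W2_derivative_def intro: square_integrable_imp_set_integrable)
    show "Q i t = Q i (- \<tau> i) + (LINT s:{- \<tau> i..t}|lborel. Q' i s)" if "t \<in> {- \<tau> i..0}" for i t
      using Q_W2[of i] that unfolding has_W2_derivative_def by blast
    show "S i t = S i (- \<tau> i) + (LINT s:{- \<tau> i..t}|lborel. S' i s)" if "t \<in> {- \<tau> i..0}" for i t
      using S_W2[of i] that unfolding has_W2_derivative_def by blast
    show "continuous_on ({- \<tau> i..0} \<times> {- \<tau> j..0}) (\<lambda>(s, \<theta>). R i j s \<theta>)" for i j
      using R_W2[of i j] unfolding has_W2_partials_def by blast
    show "set_integrable lborel ({- \<tau> i..0} \<times> {- \<tau> j..0}) (\<lambda>(s, \<theta>). Rs i j s \<theta>)" for i j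
      using R_W2[of i j] Icc_Times_finite unfolding has_W2_partials_def by (auto intro: square_integrable_imp_set_integrable)
    show "AE \<theta> in lborel. \<theta> \<in> {- \<tau> j..0} \<longrightarrow>
        (\<forall>t\<in>{- \<tau> i..0}. R i j t \<theta> = R i j (- \<tau> i) \<theta> + (LINT s:{- \<tau> i..t}|lborel. Rs i j s \<theta>))" for i j
      using R_W2[of i j] unfolding has_W2_partials_def by blast
  qed (fact delays T C0 C B G P_eq S_sym R_sym QR)+
  have iQ: "set_integrable lborel {- \<tau> i..0} (Q i)" for i by (intro set_integrable_continuous F.Q_cont)
  have iS: "set_integrable lborel {- \<tau> i..0} (S i)" for i by (intro set_integrable_continuous F.S_cont)
  have ic: "set_integrable lborel {- \<tau> i..0} (\<lambda>_. X)" for i and X :: "real^'n^'n"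
    by (intro set_integrable_continuous continuous_on_const)
  have iR: "set_integrable lborel ({- \<tau> i..0} \<times> {- \<tau> j..0}) (\<lambda>(s, \<theta>). R i j s \<theta>)" for i j
    by (intro set_integrable_continuous_Times F.R_cont)
  have iV: "set_integrable lborel {- \<tau> i..0} (V i)" for i
  proof -
    have "set_integrable lborel {- \<tau> i..0} (\<lambda>s. R j i (- \<tau> j) s)" for j
      by (intro set_integrable_continuous F.R_cont_snd) (use F.tau_nonneg in auto)
    then have "set_integrable lborel {- \<tau> i..0} (\<lambda>s. A j ** R j i (- \<tau> j) s)" for j
      by (intro set_integrable_bounded_linear[OF bounded_linear_matrix_mult])
    then have "set_integrable lborel {- \<tau> i..0} (\<lambda>s. \<Sum>j\<in>UNIV. A j ** R j i (- \<tau> j) s)"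
      unfolding set_integrable_def scaleR_sum_right by (intro Bochner_Integration.integrable_sum) auto
    then have "set_integrable lborel {- \<tau> i..0} (\<lambda>s. stack_zero (A0 ** Q i s + Q' i s + (\<Sum>j\<in>UNIV. A j ** R j i (- \<tau> j) s)) :: real^'n^('n + 'k \<times> 'n))"
      by (intro set_integrable_bounded_linear[OF bounded_linear_stack_zero] set_integral_add(1)
         set_integrable_bounded_linear[OF bounded_linear_matrix_mult] iQ F.Q'_int)
    then show ?thesis by (simp add: V[abs_def] B)
  qed
  have iG: "set_integrable lborel ({- \<tau> i..0} \<times> {- \<tau> j..0}) (\<lambda>(s, \<theta>). G i j s \<theta>)" for i j
  proof -
    have "set_integrable lborel ({- \<tau> i..0} \<times> {- \<tau> j..0}) (\<lambda>z. transpose (case z of (s, \<theta>) \<Rightarrow> Rs j i \<theta> s))"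
      by (intro set_integrable_bounded_linear[OF bounded_linear_transpose] set_integral_swap(1)[OF F.Rs_int])
    from set_integral_add(1)[OF F.Rs_int[of i j] this] show ?thesis by (simp add: G case_prod_unfold)
  qed
  obtain M' N' where MN': "ae_eq_pair T (M, N) (M', N')"
    "\<And>v C. v \<in> borel_measurable borel \<Longrightarrow> (\<And>s. norm (v s) \<le> C) \<Longrightarrow> \<exists>c\<ge>0. has_form T M' N' v c"
    using Xi_nonneg_form[OF MN_Xi delays(1) T] by blast
  obtain F1' H1' where FH1': "ae_eq_pair T (F1, H1) (F1', H1')"
    "\<And>h \<psi> C. \<psi> \<in> borel_measurable borel \<Longrightarrow> (\<And>s. norm (\<psi> s) \<le> C) \<Longrightarrow>
       has_form T F1' H1' (\<lambda>s. join_vec h (\<psi> s)) 0"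
    using Theta_zero_form[OF FH1 T T0] by blast
  obtain D' E' where DE': "ae_eq_pair T (\<lambda>s. - D s, \<lambda>s \<theta>. - E s \<theta>) (D', E')"
    "\<And>v C. v \<in> borel_measurable borel \<Longrightarrow> (\<And>s. norm (v s) \<le> C) \<Longrightarrow> \<exists>c\<ge>0. has_form T D' E' v c"
    using Xi_nonneg_form[OF DE_Xi delays(1) T] by blast
  obtain F2' H2' where FH2': "ae_eq_pair T (F2, H2) (F2', H2')"
    "\<And>h \<psi> C. \<psi> \<in> borel_measurable borel \<Longrightarrow> (\<And>s. norm (\<psi> s) \<le> C) \<Longrightarrow>
       has_form T F2' H2' (\<lambda>s. join_vec h (\<psi> s)) 0"
    using Theta_zero_form[OF FH2 T T0] by blast
  \<comment> \<open>The shifts of P and S by epsilon yield the squared norm; the third shift, of the whole matrix M,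
    enters with a favourable sign.\<close>
  have coercive: "\<epsilon> * state_sq \<tau> h \<phi> \<le> delay_form \<tau> P Q S R h \<phi>"
    if phi: "\<And>i. \<phi> i \<in> borel_measurable borel" "\<And>i s. norm (\<phi> i s) \<le> c" for h \<phi> c
  proof -
    let ?v = "\<lambda>s. join_vec h (glue \<tau> \<phi> s)"
    have g: "glue \<tau> \<phi> \<in> borel_measurable borel" "\<And>s. norm (glue \<tau> \<phi> s) \<le> c"
      by (rule borel_measurable_glue[OF phi(1)], unfold glue_def, rule phi(2))
    have gv: "?v \<in> borel_measurable borel" "\<And>s. norm (?v s) \<le> norm h + c"
      using order_trans[OF norm_join_vec_le add_left_mono[OF g(2)]] by (auto intro: borel_measurable_join_vec g(1))
    obtain c0 where c0: "0 \<le> c0" "has_form T M' N' ?v c0" using MN'(2)[OF gv] by blast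
    obtain e where e: "0 \<le> e" "has_form T (\<lambda>_. mat 1) (\<lambda>_ _. 0) ?v e" using has_form_identity[OF gv] by blast
    have "has_form T M0 (\<lambda>s \<theta>. block_mat 0 0 0 (N0 s \<theta>)) ?v
      (delay_form \<tau> (P - \<epsilon> *\<^sub>R mat 1) Q (\<lambda>i s. S i s - \<epsilon> *\<^sub>R mat 1) R h \<phi>)"
      unfolding T by (rule L1_form[OF delays MN0 iQ set_integral_diff(1)[OF iS ic] iR phi])
    from has_form_add[OF has_form_add[OF this FH1'(2)[OF g(1,2)]] has_form_scale[OF e(2), of "- \<epsilon>"]]
    have form: "has_form T (\<lambda>s. M0 s + F1' s + - \<epsilon> *\<^sub>R mat 1) (\<lambda>s \<theta>. block_mat 0 0 0 (N0 s \<theta>) + H1' s \<theta> + - \<epsilon> *\<^sub>R 0) ?v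
      (delay_form \<tau> (P - \<epsilon> *\<^sub>R mat 1) Q (\<lambda>i s. S i s - \<epsilon> *\<^sub>R mat 1) R h \<phi> + 0 + - \<epsilon> * e)" .
    have "c0 = delay_form \<tau> (P - \<epsilon> *\<^sub>R mat 1) Q (\<lambda>i s. S i s - \<epsilon> *\<^sub>R mat 1) R h \<phi> + 0 + - \<epsilon> * e"
    proof (rule has_form_unique_AE[OF c0(2) form])
      show "ae_eq_pair T (M', N') (\<lambda>s. M0 s + F1' s + - \<epsilon> *\<^sub>R mat 1, \<lambda>s \<theta>. block_mat 0 0 0 (N0 s \<theta>) + H1' s \<theta> + - \<epsilon> *\<^sub>R 0)"
        unfolding ae_eq_pair_def fst_conv snd_conv
      proof
        from MN'(1) FH1'(1) have "AE s in lborel. s \<in> {-T..0} \<longrightarrow> M s = M' s" "AE s in lborel. s \<in> {-T..0} \<longrightarrow> F1 s = F1' s"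
          by (simp_all add: ae_eq_pair_def)
        then show "AE s in lborel. s \<in> {- T..0} \<longrightarrow> M' s = M0 s + F1' s + - \<epsilon> *\<^sub>R mat 1"
          by eventually_elim (metis M add_uminus_conv_diff scaleR_minus_left)
        from MN'(1) FH1'(1) have "AE z in lborel. z \<in> {-T..0} \<times> {-T..0} \<longrightarrow> N (fst z) (snd z) = N' (fst z) (snd z)"
          "AE z in lborel. z \<in> {-T..0} \<times> {-T..0} \<longrightarrow> H1 (fst z) (snd z) = H1' (fst z) (snd z)"
          by (simp_all add: ae_eq_pair_def)
        then show "AE z in lborel. z \<in> {- T..0} \<times> {- T..0} \<longrightarrow>
           N' (fst z) (snd z) = block_mat 0 0 0 (N0 (fst z) (snd z)) + H1' (fst z) (snd z) + - \<epsilon> *\<^sub>R 0"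
          by eventually_elim (metis N add.right_neutral scaleR_zero_right)
      qed
    qed
    moreover have "0 \<le> \<epsilon> * e" using eps e by simp
    ultimately have "0 \<le> delay_form \<tau> (P - \<epsilon> *\<^sub>R mat 1) Q (\<lambda>i s. S i s - \<epsilon> *\<^sub>R mat 1) R h \<phi>" using c0(1) by linarith
    also have "\<dots> = delay_form \<tau> (P - \<epsilon> *\<^sub>R mat 1) Q S R h \<phi> - \<epsilon> * (state_sq \<tau> h \<phi> - tau_last \<tau> * (h \<bullet> h))"
      using delay_form_shift[where a = "- \<epsilon>" and \<phi> = \<phi> and \<tau> = \<tau> and S = S and c = c
        and P = "P - \<epsilon> *\<^sub>R mat 1" and Q = Q and R = R and h = h, OF iS phi] by simp
    also have "delay_form \<tau> (P - \<epsilon> *\<^sub>R mat 1) Q S R h \<phi> = delay_form \<tau> P Q S R h \<phi> - \<epsilon> * (tau_last \<tau> * (h \<bullet> h))"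
      by (simp add: delay_form_def matrix_vector_diff scaleR_matrix_vector_assoc[symmetric] inner_diff_right algebra_simps)
    finally show ?thesis by (simp add: algebra_simps)
  qed
  \<comment> \<open>The delayed states are a free vector here, which makes the first component of the test function constant.\<close>
  have dissipative: "F.dissipation x v \<phi> \<le> - \<epsilon> * state_sq \<tau> x \<phi>"
    if phi: "\<And>i. \<phi> i \<in> borel_measurable borel" "\<And>i s. norm (\<phi> i s) \<le> c" for x v \<phi> c
  proof -
    define h where "h = join_vec x (stack_vec v)"
    let ?v = "\<lambda>s. join_vec h (glue \<tau> \<phi> s)"
    have g: "glue \<tau> \<phi> \<in> borel_measurable borel" "\<And>s. norm (glue \<tau> \<phi> s) \<le> c"
      by (rule borel_measurable_glue[OF phi(1)], unfold glue_def, rule phi(2))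
    have gv: "?v \<in> borel_measurable borel" "\<And>s. norm (?v s) \<le> norm h + c"
      using order_trans[OF norm_join_vec_le add_left_mono[OF g(2)]] by (auto intro: borel_measurable_join_vec g(1))
    obtain c0 where c0: "0 \<le> c0" "has_form T D' E' ?v c0" using DE'(2)[OF gv] by blast
    have "has_form T D0 (\<lambda>s \<theta>. block_mat 0 0 0 (E0 s \<theta>)) ?v
      (delay_form \<tau> D1 V (\<lambda>i s. S' i s + \<epsilon> *\<^sub>R mat 1) G h \<phi>)"
      unfolding T by (rule L1_form[OF delays DE0 iV set_integral_add(1)[OF F.S'_int ic] iG phi])
    from has_form_scale[OF has_form_add[OF this FH2'(2)[OF g(1,2)]], of "-1"]
    have form: "has_form T (\<lambda>s. -1 *\<^sub>R (D0 s + F2' s)) (\<lambda>s \<theta>. -1 *\<^sub>R (block_mat 0 0 0 (E0 s \<theta>) + H2' s \<theta>)) ?v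
      (-1 * (delay_form \<tau> D1 V (\<lambda>i s. S' i s + \<epsilon> *\<^sub>R mat 1) G h \<phi> + 0))" .
    have "c0 = -1 * (delay_form \<tau> D1 V (\<lambda>i s. S' i s + \<epsilon> *\<^sub>R mat 1) G h \<phi> + 0)"
    proof (rule has_form_unique_AE[OF c0(2) form])
      show "ae_eq_pair T (D', E') (\<lambda>s. -1 *\<^sub>R (D0 s + F2' s), \<lambda>s \<theta>. -1 *\<^sub>R (block_mat 0 0 0 (E0 s \<theta>) + H2' s \<theta>))"
        unfolding ae_eq_pair_def fst_conv snd_conv
      proof
        from DE'(1) FH2'(1) have "AE s in lborel. s \<in> {-T..0} \<longrightarrow> - D s = D' s" "AE s in lborel. s \<in> {-T..0} \<longrightarrow> F2 s = F2' s"
          by (simp_all add: ae_eq_pair_def)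
        then show "AE s in lborel. s \<in> {- T..0} \<longrightarrow> D' s = -1 *\<^sub>R (D0 s + F2' s)"
          by eventually_elim (metis D scaleR_minus1_left)
        from DE'(1) FH2'(1) have "AE z in lborel. z \<in> {-T..0} \<times> {-T..0} \<longrightarrow> - E (fst z) (snd z) = E' (fst z) (snd z)"
          "AE z in lborel. z \<in> {-T..0} \<times> {-T..0} \<longrightarrow> H2 (fst z) (snd z) = H2' (fst z) (snd z)"
          by (simp_all add: ae_eq_pair_def)
        then show "AE z in lborel. z \<in> {- T..0} \<times> {- T..0} \<longrightarrow>
           E' (fst z) (snd z) = -1 *\<^sub>R (block_mat 0 0 0 (E0 (fst z) (snd z)) + H2' (fst z) (snd z))"
          by eventually_elim (metis E scaleR_minus1_left)
      qed
    qed
    then have "delay_form \<tau> D1 V (\<lambda>i s. S' i s + \<epsilon> *\<^sub>R mat 1) G h \<phi> \<le> 0" using c0(1) by simp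
    then have "delay_form \<tau> D1 V S' G h \<phi> + \<epsilon> * (state_sq \<tau> h \<phi> - T * (h \<bullet> h)) \<le> 0"
      using delay_form_shift[where a = \<epsilon> and \<phi> = \<phi> and \<tau> = \<tau> and S = S' and c = c
        and P = D1 and Q = V and R = G and h = h, OF F.S'_int phi] by (simp add: T)
    moreover have "state_sq \<tau> h \<phi> - T * (h \<bullet> h) = state_sq \<tau> x \<phi> - T * (x \<bullet> x)"
      by (simp add: state_sq_def T distrib_left)
    moreover have "delay_form \<tau> D1 V S' G h \<phi> = F.dissipation x v \<phi> + \<epsilon> * (T * (x \<bullet> x))"
    proof -
      have "stack_vec v \<bullet> (block_diag (\<lambda>i. - S i (- \<tau> i)) *v stack_vec v) = - (\<Sum>i\<in>UNIV. v i \<bullet> (S i (- \<tau> i) *v v i))"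
        by (simp add: block_diag_mult inner_stack_vec matrix_vector_minus sum_negf)
      moreover have "x \<bullet> (transpose C0 *v x) = x \<bullet> (C0 *v x)" by (rule inner_transpose_matrix_vector)
      moreover have "stack_vec v \<bullet> (transpose (block_row C) *v x) = x \<bullet> (block_row C *v stack_vec v)"
        by (rule inner_transpose_matrix_vector)
      moreover have "x \<bullet> (block_row C *v stack_vec v) = (\<Sum>i\<in>UNIV. x \<bullet> (C i *v v i))"
        by (simp only: block_row_mult inner_sum_right)
      ultimately have D1h: "h \<bullet> (D1 *v h) = 2 * (x \<bullet> (C0 *v x)) + (\<Sum>i\<in>UNIV. 2 * (x \<bullet> (C i *v v i)) - v i \<bullet> (S i (- \<tau> i) *v v i)) + \<epsilon> * (x \<bullet> x)"
        unfolding h_def D1 inner_block_mat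
        by (simp add: matrix_vector_mult_add_rdistrib inner_add_right scaleR_matrix_vector_assoc[symmetric]
            sum_subtractf sum_distrib_left[symmetric])
      have Vh: "h \<bullet> (V i s *v w) = x \<bullet> (B i s *v w)" for i s w
        by (simp add: h_def V stack_zero_mult inner_join_vec)
      show ?thesis
        unfolding delay_form_def F.dissipation_def T[symmetric] D1h Vh by (simp add: distrib_left)
    qed
    ultimately show ?thesis by (simp add: algebra_simps)
  qed
  interpret L: dual_lyapunov \<tau> A0 P C0 A C T Q Q' S S' B R Rs G \<epsilon>
    by unfold_locales (fact eps coercive dissipative)+
  show ?thesis by (rule L.stable_system)
qed

end
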